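(* Let $b\ge2$ be an integer, $1/b<\gamma<1$ and $\psi(x)=-2\pi\sin(2\pi x)$. Then there exists a positive integer $q$ such that $\sigma(q)<(b\gamma)^q$.
   Context: $\mathcal{A}=\{0,\dots,b-1\}$. $S(x,\mathbf{i})=\sum_{n\ge1}\gamma^{n-1}\psi\big(\frac{x+i_1+i_2b+\cdots+i_nb^{n-1}}{b^n}\big)$ for $\mathbf{i}\in\mathcal{A}^{\mathbb{Z}^+}$, $S'=\partial_xS$. For $\mathbf{u}\in\mathcal{A}^q$, $x(\mathbf{u})=(x+u_1+u_2b+\cdots+u_qb^{q-1})/b^q$. Sequences $\mathbf{i},\mathbf{j}$ are $(\varepsilon,\delta)$-tangent at $x_0$ if $|S(x_0,\mathbf{i})-S(x_0,\mathbf{j})|\le\varepsilon$ and $|S'(x_0,\mathbf{i})-S'(x_0,\mathbf{j})|\le\delta$. $E(q,x_0;\varepsilon,\delta)$: pairs $(\mathbf{k},\mathbf{l})\in\mathcal{A}^q\times\mathcal{A}^q$ such that for some $\mathbf{u},\mathbf{v}\in\mathcal{A}^{\mathbb{Z}^+}$ the concatenations $\mathbf{ku},\mathbf{lv}$ are $(\varepsilon,\delta)$-tangent at $x_0$. Weight function: measurable $\omega:[0,1)\to(0,\infty)$ with $\omega,1/\omega$ bounded. Admissible testing function of order $q$: measurable $V:[0,1)\times\mathcal{A}^q\times\mathcal{A}^q\to[0,\infty)$ such that for some $\varepsilon,\delta>0$, $V(x,\mathbf{u},\mathbf{v})V(x,\mathbf{v},\mathbf{u})\ge1$ whenever $x\in[0,1)$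 and $(\mathbf{u},\mathbf{v})\in E(q,x;\varepsilon,\delta)$. $\Sigma_{V,\omega}(x)=\sup_{\mathbf{u}}\frac{\omega(x)}{\omega(x(\mathbf{u}))}\sum_{\mathbf{v}}V(x,\mathbf{u},\mathbf{v})$; $\sigma(q)=\inf_{\omega,V}\|\Sigma_{V,\omega}\|_\infty$. *)

theory Defs
  imports "HOL-Analysis.Analysis" "HOL-Probability.Essential_Supremum"
begin

definition psi :: "real \<Rightarrow> real" where
  "psi x = - 2 * pi * sin (2 * pi * x)"

text \<open>Infinite digit sequences in A^{Z+}, encoded 0-indexed: i_1, i_2, ... = i 0, i 1, ...\<close>
definition seqs :: "nat \<Rightarrow> (nat \<Rightarrow> nat) set" where
  "seqs b = {i. \<forall>n. i n < b}"

text \<open>Finite words in A^q, encoded as lists of length q (u_1 = u!0).\<close>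
definition words :: "nat \<Rightarrow> nat \<Rightarrow> nat list set" where
  "words b q = {u. length u = q \<and> (\<forall>d\<in>set u. d < b)}"

definition S :: "nat \<Rightarrow> real \<Rightarrow> (real \<Rightarrow> real) \<Rightarrow> real \<Rightarrow> (nat \<Rightarrow> nat) \<Rightarrow> real" where
  "S b gamma \<psi> x i = (\<Sum>n. gamma ^ n *
      \<psi> ((x + (\<Sum>k<Suc n. real (i k) * real b ^ k)) / real b ^ Suc n))"

definition S' :: "nat \<Rightarrow> real \<Rightarrow> (real \<Rightarrow> real) \<Rightarrow> real \<Rightarrow> (nat \<Rightarrow> nat) \<Rightarrow> real" where
  "S' b gamma \<psi> x i = deriv (\<lambda>y. S b gamma \<psi> y i) x"

definition xw :: "nat \<Rightarrow> real \<Rightarrow> nat list \<Rightarrow> real" where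
  "xw b x u = (x + (\<Sum>k<length u. real (u ! k) * real b ^ k)) / real b ^ length u"

definition concat_seq :: "nat list \<Rightarrow> (nat \<Rightarrow> nat) \<Rightarrow> (nat \<Rightarrow> nat)" where
  "concat_seq k u = (\<lambda>n. if n < length k then k ! n else u (n - length k))"

definition tangent :: "nat \<Rightarrow> real \<Rightarrow> (real \<Rightarrow> real) \<Rightarrow> real \<Rightarrow> real \<Rightarrow> real
    \<Rightarrow> (nat \<Rightarrow> nat) \<Rightarrow> (nat \<Rightarrow> nat) \<Rightarrow> bool" where
  "tangent b gamma \<psi> x0 \<epsilon> \<delta> i j \<longleftrightarrow>
     \<bar>S b gamma \<psi> x0 i - S b gamma \<psi> x0 j\<bar> \<le> \<epsilon> \<and>
     \<bar>S' b gamma \<psi> x0 i - S' b gamma \<psi> x0 j\<bar> \<le> \<delta>"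

definition E :: "nat \<Rightarrow> real \<Rightarrow> (real \<Rightarrow> real) \<Rightarrow> nat \<Rightarrow> real \<Rightarrow> real \<Rightarrow> real
    \<Rightarrow> (nat list \<times> nat list) set" where
  "E b gamma \<psi> q x0 \<epsilon> \<delta> = {(k, l). k \<in> words b q \<and> l \<in> words b q \<and>
     (\<exists>u\<in>seqs b. \<exists>v\<in>seqs b.
        tangent b gamma \<psi> x0 \<epsilon> \<delta> (concat_seq k u) (concat_seq l v))}"

abbreviation unit_ivl :: "real measure" where
  "unit_ivl \<equiv> restrict_space lborel {0..<1}"

definition weight :: "(real \<Rightarrow> real) \<Rightarrow> bool" where
  "weight \<omega> \<longleftrightarrow> \<omega> \<in> borel_measurable unit_ivl \<and>
     (\<forall>x\<in>{0..<1}. \<omega> x > 0) \<and>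
     (\<exists>C. \<forall>x\<in>{0..<1}. \<omega> x \<le> C \<and> 1 / \<omega> x \<le> C)"

definition admissible :: "nat \<Rightarrow> real \<Rightarrow> (real \<Rightarrow> real) \<Rightarrow> nat
    \<Rightarrow> (real \<Rightarrow> nat list \<Rightarrow> nat list \<Rightarrow> real) \<Rightarrow> bool" where
  "admissible b gamma \<psi> q V \<longleftrightarrow>
     (\<forall>u\<in>words b q. \<forall>v\<in>words b q. (\<lambda>x. V x u v) \<in> borel_measurable unit_ivl) \<and>
     (\<forall>x\<in>{0..<1}. \<forall>u\<in>words b q. \<forall>v\<in>words b q. V x u v \<ge> 0) \<and>
     (\<exists>\<epsilon>>0. \<exists>\<delta>>0. \<forall>x\<in>{0..<1}. \<forall>(u, v)\<in>E b gamma \<psi> q x \<epsilon> \<delta>.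
        V x u v * V x v u \<ge> 1)"

definition Sigma_fn :: "nat \<Rightarrow> nat \<Rightarrow> (real \<Rightarrow> nat list \<Rightarrow> nat list \<Rightarrow> real)
    \<Rightarrow> (real \<Rightarrow> real) \<Rightarrow> real \<Rightarrow> real" where
  "Sigma_fn b q V \<omega> x = Max ((\<lambda>u. \<omega> x / \<omega> (xw b x u) * (\<Sum>v\<in>words b q. V x u v)) ` words b q)"

definition sigma :: "nat \<Rightarrow> real \<Rightarrow> (real \<Rightarrow> real) \<Rightarrow> nat \<Rightarrow> ereal" where
  "sigma b gamma \<psi> q = Inf {esssup unit_ivl (\<lambda>x. ereal \<bar>Sigma_fn b q V \<omega> x\<bar>) | \<omega> V.
      weight \<omega> \<and> admissible b gamma \<psi> q V}"

end

theory Submission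
  imports Defs
begin

text \<open>
  Words of length one suffice: for every \<open>b\<close> and \<open>\<gamma>\<close> we find a weight and a testing function of order
  \<open>q = 1\<close> with \<open>\<Sigma> < b \<gamma>\<close>. Two digits \<open>k \<noteq> l\<close> are tangent at \<open>x\<close> only if the sine sum (ratio \<open>\<gamma>\<close>) and the
  cosine sum (ratio \<open>\<gamma> / b\<close>) along two backward orbits of multiplication by \<open>b\<close> on the circle nearly
  agree. The first terms of the two differences are \<open>2 cos \<phi> sin \<mu>\<close> and \<open>-2 sin \<phi> sin \<mu>\<close> with
  \<open>\<phi> = \<pi> (2 x + k + l) / b\<close> and \<open>\<mu> = \<pi> (k - l) / b\<close>, so tangency forces
  \<open>\<bar>sin \<phi> sin \<mu>\<bar> \<le> \<gamma> / (b - \<gamma>)\<close> and \<open>\<bar>sin \<mu>\<bar> \<le> \<gamma> / (1 - \<gamma>)\<close>. For \<open>b \<ge> 4\<close> and \<open>b \<gamma> > 2\<close>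
  fewer than \<open>b \<gamma>\<close> digits \<open>l\<close> satisfy the first condition for given \<open>x\<close> and \<open>k\<close>, and for small \<open>b \<gamma>\<close>
  the second one excludes all pairs. In most of the remaining cases the digits tangent at \<open>x\<close> form a
  matching and occur only for \<open>x\<close> in a small set; since inverse branches lead out of this set for some steps,
  the factor \<open>2\<close> lost there can be spread over several steps by the weight and by an asymmetric testing
  function, which gives bounds such as \<open>sqrt 2\<close> or the golden ratio.
\<close>

section \<open>Backward orbits and tangency\<close>

text \<open>The bounds \<rho> come from one budget. If two digits are tangent at \<open>x\<close>
  and the weight exponents at their children are \<open>m - 1\<close> and \<open>n - 1\<close>, the
  two rows allow the entries \<open>\<rho> ^ m - 1\<close> and \<open>\<rho> ^ n - 1\<close>, whose
  product is at least 1 exactly when \<open>1 / \<rho> ^ m + 1 / \<rho> ^ n <= 1\<close>. The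
  exponent pairs (1,2), (2,2), (2,3), (3,4), (5,5) yield the golden ratio, sqrt 2, the plastic
  number 1.3247, the root 1.2207 of \<open>y ^ 4 = y + 1\<close>, and the fifth root of 2. A bound
  \<rho> helps only for \<open>\<gamma> > \<rho> / b\<close>, so the estimate used below this value
  has to reach up to it. This fixes the cut points of \<gamma> and, through them, most numerical
  constants. The obstacle is the small bases: there the tail of the sine sum can outweigh its first
  term, and a geometric bound on the tail says too little. The tails are therefore estimated through
  the dynamics, by pairs of consecutive terms or by a potential on the circle.\<close>

definition digit_angle :: "nat \<Rightarrow> real \<Rightarrow> (nat \<Rightarrow> nat) \<Rightarrow> nat \<Rightarrow> real" where
  "digit_angle b x i n =
     2 * pi * ((x + (\<Sum>k<Suc n. real (i k) * real b ^ k)) / real b ^ Suc n)"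

text \<open>Each angle is a preimage of the preceding one under multiplication by \<open>b\<close>.
  Congruence modulo \<open>2 * pi\<close> is expressed through cosine and sine because only these
  values enter the sums.\<close>

definition back_orbit :: "nat \<Rightarrow> (nat \<Rightarrow> real) \<Rightarrow> bool" where
  "back_orbit b \<alpha> \<longleftrightarrow>
     (\<forall>n. cos (\<alpha> n) = cos (real b * \<alpha> (Suc n)) \<and> sin (\<alpha> n) = sin (real b * \<alpha> (Suc n)))"

definition near_tangent :: "nat \<Rightarrow> real \<Rightarrow> real \<Rightarrow> (nat \<Rightarrow> real) \<Rightarrow> (nat \<Rightarrow> real) \<Rightarrow> bool" where
  "near_tangent b \<gamma> \<eta> \<alpha> \<beta> \<longleftrightarrow>
     \<bar>\<Sum>n. \<gamma> ^ n * (sin (\<alpha> n) - sin (\<beta> n))\<bar> \<le> \<eta> \<and>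
     \<bar>\<Sum>n. (\<gamma> / real b) ^ n * (cos (\<alpha> n) - cos (\<beta> n))\<bar> \<le> \<eta>"

text \<open>The digit sequences are forgotten: any two backward orbits through the two first points
  may be witnesses. Membership in \<open>E\<close> implies this relation, so a testing function only
  has to respect it.\<close>

definition tangent_digits :: "nat \<Rightarrow> real \<Rightarrow> real \<Rightarrow> real \<Rightarrow> nat \<Rightarrow> nat \<Rightarrow> bool" where
  "tangent_digits b \<gamma> \<eta> x k l \<longleftrightarrow>
     (\<exists>\<alpha> \<beta>. back_orbit b \<alpha> \<and> back_orbit b \<beta> \<and> near_tangent b \<gamma> \<eta> \<alpha> \<beta> \<and>
        \<alpha> 0 = 2 * pi * ((x + real k) / real b) \<and> \<beta> 0 = 2 * pi * ((x + real l) / real b))"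

lemma back_orbit_digit_angle:
  assumes "b \<ge> 1"
  shows "back_orbit b (digit_angle b x i)"
proof -
  have "real b * digit_angle b x i (Suc n) = digit_angle b x i n + 2 * pi * real_of_int (int (i (Suc n)))" for n
    using assms unfolding digit_angle_def by (simp add: field_simps)
  then show ?thesis
    unfolding back_orbit_def
    by (metis sin_int_2pin cos_int_2pin sin_add cos_add add.right_neutral mult.right_neutral mult_zero_right diff_zero)
qed

lemma summable_power_bounded:
  fixes f :: "nat \<Rightarrow> real"
  assumes "0 \<le> r" "r < 1" "\<And>n. \<bar>f n\<bar> \<le> M"
  shows "summable (\<lambda>n. r ^ n * f n)"
proof (rule summable_comparison_test')
  show "summable (\<lambda>n. M * r ^ n)"
    using assms by (intro summable_mult summable_geometric) auto
  show "norm (r ^ n * f n) \<le> M * r ^ n" for n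
    using assms(1) mult_right_mono[OF assms(3)[of n], of "r ^ n"] by (simp add: abs_mult mult.commute)
qed

lemma S_psi_eq:
  assumes "0 \<le> \<gamma>" "\<gamma> < 1"
  shows "S b \<gamma> psi x i = - 2 * pi * (\<Sum>n. \<gamma> ^ n * sin (digit_angle b x i n))"
proof -
  have "summable (\<lambda>n. \<gamma> ^ n * sin (digit_angle b x i n))"
    using assms by (intro summable_power_bounded[where M = 1]) auto
  then have "- 2 * pi * (\<Sum>n. \<gamma> ^ n * sin (digit_angle b x i n))
      = (\<Sum>n. - 2 * pi * (\<gamma> ^ n * sin (digit_angle b x i n)))"
    by (rule suminf_mult[symmetric])
  also have "\<dots> = S b \<gamma> psi x i"
    unfolding S_def psi_def digit_angle_def by (simp only: mult_ac)
  finally show ?thesis by simp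
qed

text \<open>Termwise differentiation brings out the factor \<open>2 * pi / b ^ Suc n\<close>, which
  turns the ratio \<gamma> into \<open>\<gamma> / b\<close>; the differentiated series is dominated
  by \<open>2 * pi * \<gamma> ^ n\<close>.\<close>

lemma S'_psi_eq:
  assumes "0 \<le> \<gamma>" "\<gamma> < 1" "b \<ge> 1"
  shows "S' b \<gamma> psi x i =
    - 4 * pi\<^sup>2 / real b * (\<Sum>n. (\<gamma> / real b) ^ n * cos (digit_angle b x i n))"
proof -
  let ?f = "\<lambda>n y. \<gamma> ^ n * sin (digit_angle b y i n)"
  let ?f' = "\<lambda>n y. \<gamma> ^ n * (cos (digit_angle b y i n) * (2 * pi / real b ^ Suc n))"
  have "(\<lambda>y. \<Sum>n. ?f n y) = (\<lambda>y. S b \<gamma> psi y i / (- 2 * pi))"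
    using S_psi_eq[OF assms(1,2)] by (auto simp: field_simps)
  have der: "((\<lambda>y. digit_angle b y i n) has_field_derivative (2 * pi / real b ^ Suc n)) (at y)" for n y
    using assms(3) unfolding digit_angle_def by (auto intro!: derivative_eq_intros)
  have b1: "1 \<le> real b ^ n" for n
    using assms(3) by (intro one_le_power) simp
  have "((\<lambda>y. \<Sum>n. ?f n y) has_field_derivative (\<Sum>n. ?f' n x)) (at x)"
  proof (rule has_field_derivative_series'(2)[where S = UNIV and ?x0.0 = x])
    show "(?f n has_field_derivative ?f' n y) (at y within UNIV)" for n y
      by (auto intro!: derivative_eq_intros DERIV_fun_sin der simp: mult_ac)
    show "uniformly_convergent_on UNIV (\<lambda>n y. \<Sum>i<n. ?f' i y)"
    proof (rule Weierstrass_m_test')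
      show "norm (?f' n y) \<le> 2 * pi * \<gamma> ^ n" for n y
      proof -
        have "\<bar>cos (digit_angle b y i n)\<bar> * (2 * pi / real b ^ Suc n) \<le> 1 * (2 * pi / 1)"
          using b1[of "Suc n"] assms(3) by (intro mult_mono divide_left_mono) (auto simp del: power_Suc)
        then have "\<gamma> ^ n * (\<bar>cos (digit_angle b y i n)\<bar> * (2 * pi / real b ^ Suc n)) \<le> \<gamma> ^ n * (2 * pi)"
          using assms(1) by (intro mult_left_mono) auto
        then show ?thesis using assms(1) by (simp add: abs_mult mult_ac)
      qed
      show "summable (\<lambda>n. 2 * pi * \<gamma> ^ n)"
        using assms by (intro summable_mult summable_geometric) auto
    qed
    show "summable (\<lambda>n. ?f n x)"
      using assms by (intro summable_power_bounded[where M = 1]) auto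
  qed auto
  then have "((\<lambda>y. - 2 * pi * (\<Sum>n. ?f n y)) has_field_derivative - 2 * pi * (\<Sum>n. ?f' n x)) (at x)"
    by (rule DERIV_cmult)
  then have "S' b \<gamma> psi x i = - 2 * pi * (\<Sum>n. ?f' n x)"
    unfolding S'_def S_psi_eq[OF assms(1,2)] by (rule DERIV_imp_deriv)
  also have "(\<lambda>n. ?f' n x) = (\<lambda>n. 2 * pi / real b * ((\<gamma> / real b) ^ n * cos (digit_angle b x i n)))"
    by (simp add: fun_eq_iff power_divide)
  also have "(\<Sum>n. 2 * pi / real b * ((\<gamma> / real b) ^ n * cos (digit_angle b x i n)))
      = 2 * pi / real b * (\<Sum>n. (\<gamma> / real b) ^ n * cos (digit_angle b x i n))"
    using assms by (intro suminf_mult summable_power_bounded[where M = 1])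
      (auto simp: divide_simps intro: order.strict_trans2)
  finally show ?thesis by (simp add: power2_eq_square)
qed

text \<open>The tolerance \<open>\<eta> / b\<close> matches the factor \<open>1 / b\<close> in the
  derivative. The remaining factors \<open>2 * pi\<close> and \<open>4 * pi\<^sup>2\<close> exceed
  1, so dividing by them keeps the bound \<eta>.\<close>

lemma tangent_imp_near_tangent:
  assumes "0 \<le> \<gamma>" "\<gamma> < 1" "b \<ge> 1"
    and "tangent b \<gamma> psi x \<eta> (\<eta> / real b) i j"
  shows "near_tangent b \<gamma> \<eta> (digit_angle b x i) (digit_angle b x j)"
proof -
  have r: "0 \<le> \<gamma> / real b" "\<gamma> / real b < 1"
    using assms by (auto simp: divide_simps intro: order.strict_trans2)
  have diff: "(\<Sum>n. r ^ n * (f n - g n)) = (\<Sum>n. r ^ n * f n) - (\<Sum>n. r ^ n * g n)"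
    if "0 \<le> r" "r < 1" "\<And>n. \<bar>f n\<bar> \<le> 1" "\<And>n. \<bar>g n\<bar> \<le> 1" for r and f g :: "nat \<Rightarrow> real"
    using suminf_diff[OF summable_power_bounded[OF that(1,2,3)] summable_power_bounded[OF that(1,2,4)]]
    by (simp add: right_diff_distrib)
  have pi1: "1 \<le> 2 * pi" "1 \<le> 4 * pi\<^sup>2"
    using pi_ge_two power_mono[OF pi_ge_two, of 2] by auto
  have scale: "\<bar>u\<bar> \<le> e" if "\<bar>K * u\<bar> \<le> e" "1 \<le> \<bar>K\<bar>" for K u e :: real
    using that mult_right_mono[of 1 "\<bar>K\<bar>" "\<bar>u\<bar>"] by (simp add: abs_mult)
  let ?A = "\<Sum>n. \<gamma> ^ n * (sin (digit_angle b x i n) - sin (digit_angle b x j n))"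
  let ?B = "\<Sum>n. (\<gamma> / real b) ^ n * (cos (digit_angle b x i n) - cos (digit_angle b x j n))"
  have "S b \<gamma> psi x i - S b \<gamma> psi x j = - 2 * pi * ?A"
    using diff[OF assms(1,2), of "\<lambda>n. sin (digit_angle b x i n)" "\<lambda>n. sin (digit_angle b x j n)"]
    by (simp add: S_psi_eq[OF assms(1,2)] right_diff_distrib)
  then have A: "\<bar>- 2 * pi * ?A\<bar> \<le> \<eta>"
    using assms(4) unfolding tangent_def by simp
  have "S' b \<gamma> psi x i - S' b \<gamma> psi x j = - 4 * pi\<^sup>2 * ?B / real b"
    using diff[OF r, of "\<lambda>n. cos (digit_angle b x i n)" "\<lambda>n. cos (digit_angle b x j n)"]
    by (simp add: S'_psi_eq[OF assms(1,2,3)] right_diff_distrib diff_divide_distrib del: power_divide)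
  then have "\<bar>- 4 * pi\<^sup>2 * ?B / real b\<bar> \<le> \<eta> / real b"
    using assms(4) unfolding tangent_def by simp
  then have B: "\<bar>- 4 * pi\<^sup>2 * ?B\<bar> \<le> \<eta>"
    using assms(3) by (simp add: divide_le_cancel)
  show ?thesis
    unfolding near_tangent_def using scale[OF A] scale[OF B] pi1 by auto
qed

lemma E_one_imp_tangent_digits:
  assumes "0 \<le> \<gamma>" "\<gamma> < 1" "b \<ge> 1"
    and "([k], [l]) \<in> E b \<gamma> psi 1 x \<eta> (\<eta> / real b)"
  shows "tangent_digits b \<gamma> \<eta> x k l"
proof -
  obtain u v where "tangent b \<gamma> psi x \<eta> (\<eta> / real b) (concat_seq [k] u) (concat_seq [l] v)"
    using assms(4) unfolding E_def by auto
  then have "near_tangent b \<gamma> \<eta> (digit_angle b x (concat_seq [k] u)) (digit_angle b x (concat_seq [l] v))"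
    by (rule tangent_imp_near_tangent[OF assms(1-3)])
  moreover have "digit_angle b x (concat_seq [m] w) 0 = 2 * pi * ((x + real m) / real b)" for m w
    by (simp add: digit_angle_def concat_seq_def)
  ultimately show ?thesis
    unfolding tangent_digits_def using back_orbit_digit_angle[OF assms(3)] by blast
qed

section \<open>Testing functions of order one\<close>

lemma words_one: "words b 1 = (\<lambda>k. [k]) ` {..<b}"
  unfolding words_def by (auto simp: length_Suc_conv)

lemma inverse_branch_mem:
  fixes x :: real
  assumes "x \<in> {0..<1}" "k < b"
  shows "(x + real k) / real b \<in> {0..<1}"
proof -
  have "real k + 1 \<le> real b" using assms(2) by simp
  then show ?thesis using assms by (auto simp: divide_simps)
qed

text \<open>The row estimate is assumed at every point, so it bounds the essential supremum
  directly. Functions of two digits stand for functions of two words of length one.\<close>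

lemma sigma_one_le:
  fixes \<omega> :: "real \<Rightarrow> real" and V :: "real \<Rightarrow> nat \<Rightarrow> nat \<Rightarrow> real"
  assumes b: "b \<ge> 1" and \<gamma>: "0 \<le> \<gamma>" "\<gamma> < 1" and \<eta>: "\<eta> > 0"
    and \<omega>[measurable]: "\<omega> \<in> borel_measurable borel"
    and \<omega>_bounds: "m > 0" "\<And>x. x \<in> {0..<1} \<Longrightarrow> m \<le> \<omega> x \<and> \<omega> x \<le> M"
    and V[measurable]: "\<And>k l. (\<lambda>x. V x k l) \<in> borel_measurable borel"
    and V_nonneg: "\<And>x k l. x \<in> {0..<1} \<Longrightarrow> k < b \<Longrightarrow> l < b \<Longrightarrow> 0 \<le> V x k l"
    and V_pair: "\<And>x k l. x \<in> {0..<1} \<Longrightarrow> k < b \<Longrightarrow> l < b \<Longrightarrow>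
       tangent_digits b \<gamma> \<eta> x k l \<Longrightarrow> 1 \<le> V x k l * V x l k"
    and row: "\<And>x k. x \<in> {0..<1} \<Longrightarrow> k < b \<Longrightarrow>
       \<omega> x / \<omega> ((x + real k) / real b) * (\<Sum>l<b. V x k l) \<le> \<rho>"
  shows "sigma b \<gamma> psi 1 \<le> ereal \<rho>"
proof -
  define W where "W x u v = V x (hd u) (hd v)" for x :: real and u v :: "nat list"
  have space: "space unit_ivl = {0..<1}" by (simp add: space_restrict_space)
  have \<omega>_pos: "0 < \<omega> x" if "x \<in> {0..<1}" for x
    using \<omega>_bounds that by (meson less_le_trans)
  have weight: "weight \<omega>"
    unfolding weight_def
  proof (intro conjI exI[of _ "max M (1 / m)"] ballI)
    show "\<omega> \<in> borel_measurable unit_ivl" by (simp add: measurable_restrict_space1)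
    show "0 < \<omega> x" if "x \<in> {0..<1}" for x using \<omega>_pos that by blast
    show "\<omega> x \<le> max M (1 / m)" if "x \<in> {0..<1}" for x
      using \<omega>_bounds(2)[OF that] by (simp add: le_max_iff_disj)
    show "1 / \<omega> x \<le> max M (1 / m)" if "x \<in> {0..<1}" for x
      using \<omega>_bounds(1) \<omega>_bounds(2)[OF that] \<omega>_pos[OF that]
      by (intro max.coboundedI2 divide_left_mono) auto
  qed
  have pair: "\<forall>(u, v)\<in>E b \<gamma> psi 1 x \<eta> (\<eta> / real b). 1 \<le> W x u v * W x v u"
    if x: "x \<in> {0..<1}" for x
  proof (clarify)
    fix u v assume uv: "(u, v) \<in> E b \<gamma> psi 1 x \<eta> (\<eta> / real b)"
    then have "u \<in> words b 1" "v \<in> words b 1" unfolding E_def by auto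
    then obtain k l where kl: "u = [k]" "v = [l]" "k < b" "l < b"
      unfolding words_one by auto
    then have "tangent_digits b \<gamma> \<eta> x k l"
      using E_one_imp_tangent_digits[OF \<gamma> b] uv by simp
    then show "1 \<le> W x u v * W x v u" using V_pair[OF x kl(3,4)] kl by (simp add: W_def)
  qed
  have adm: "admissible b \<gamma> psi 1 W"
    unfolding admissible_def
  proof (intro conjI ballI)
    show "(\<lambda>x. W x u v) \<in> borel_measurable unit_ivl" for u v
      unfolding W_def by (simp add: measurable_restrict_space1)
    show "0 \<le> W x u v" if "x \<in> {0..<1}" "u \<in> words b 1" "v \<in> words b 1" for x u v
      using that V_nonneg unfolding W_def words_one by auto
    have "\<eta> / real b > 0" using \<eta> b by simp
    then show "\<exists>\<epsilon>>0. \<exists>\<delta>>0. \<forall>x\<in>{0..<1}. \<forall>(u, v)\<in>E b \<gamma> psi 1 x \<epsilon> \<delta>. 1 \<le> W x u v * W x v u"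
      using \<eta> pair by blast
  qed
  have Sigma: "Sigma_fn b 1 W \<omega> x
      = Max ((\<lambda>k. \<omega> x / \<omega> ((x + real k) / real b) * (\<Sum>l<b. V x k l)) ` {..<b})" for x
  proof -
    have "(\<Sum>v\<in>words b 1. W x [k] v) = (\<Sum>l<b. V x k l)" for k
      unfolding words_one by (subst sum.reindex) (auto simp: inj_on_def W_def)
    then show ?thesis
      unfolding Sigma_fn_def words_one image_image by (simp add: xw_def)
  qed
  have [measurable]: "(\<lambda>x. Sigma_fn b 1 W \<omega> x) \<in> borel_measurable borel"
    unfolding Sigma by (rule borel_measurable_Max) auto
  have bound: "\<bar>Sigma_fn b 1 W \<omega> x\<bar> \<le> \<rho>" if x: "x \<in> {0..<1}" for x
  proof -
    have "Sigma_fn b 1 W \<omega> x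
      \<in> (\<lambda>k. \<omega> x / \<omega> ((x + real k) / real b) * (\<Sum>l<b. V x k l)) ` {..<b}"
      unfolding Sigma using b by (intro Max_in) (auto simp: lessThan_empty_iff)
    then obtain k where k: "k < b"
      "Sigma_fn b 1 W \<omega> x = \<omega> x / \<omega> ((x + real k) / real b) * (\<Sum>l<b. V x k l)" by blast
    have "0 \<le> Sigma_fn b 1 W \<omega> x"
      unfolding k(2) using \<omega>_pos[OF x] \<omega>_pos[OF inverse_branch_mem[OF x k(1)]] V_nonneg[OF x k(1)]
      by (intro mult_nonneg_nonneg divide_nonneg_nonneg sum_nonneg) auto
    then show ?thesis using row[OF x k(1)] k(2) by simp
  qed
  have "sigma b \<gamma> psi 1 \<le> esssup unit_ivl (\<lambda>x. ereal \<bar>Sigma_fn b 1 W \<omega> x\<bar>)"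
    unfolding sigma_def by (rule Inf_lower) (use weight adm in blast)
  also have "\<dots> \<le> ereal \<rho>"
  proof (rule esssup_I)
    show "(\<lambda>x. ereal \<bar>Sigma_fn b 1 W \<omega> x\<bar>) \<in> borel_measurable unit_ivl"
      by (intro measurable_restrict_space1) measurable
    show "AE x in unit_ivl. ereal \<bar>Sigma_fn b 1 W \<omega> x\<bar> \<le> ereal \<rho>"
      using bound by (intro AE_I2) (auto simp: space)
  qed
  finally show ?thesis .
qed

text \<open>For negative \<open>s0\<close> the conclusion is impossible, so
  \<open>confined b \<gamma> (- 1)\<close> says that distinct digits are never tangent.\<close>

definition confined :: "nat \<Rightarrow> real \<Rightarrow> real \<Rightarrow> bool" where
  "confined b \<gamma> s0 \<longleftrightarrow> (\<exists>\<eta>>0. \<forall>x\<in>{0..<1}. \<forall>k<b. \<forall>l<b. k \<noteq> l \<longrightarrow>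
     tangent_digits b \<gamma> \<eta> x k l \<longrightarrow> \<bar>sin (pi * (2 * x + real k + real l) / real b)\<bar> \<le> s0)"

text \<open>With unit weight and the indicator of \<open>R\<close> as testing function, a row sum is
  the number of partners of a digit.\<close>

lemma sigma_one_le_card:
  fixes R :: "real \<Rightarrow> nat \<Rightarrow> nat \<Rightarrow> bool"
  assumes b: "b \<ge> 1" and \<gamma>: "0 \<le> \<gamma>" "\<gamma> < 1" and \<eta>: "\<eta> > 0"
    and [measurable]: "\<And>k l. Measurable.pred borel (\<lambda>x. R x k l)"
    and sym: "\<And>x k l. R x k l \<Longrightarrow> R x l k"
    and R: "\<And>x k l. x \<in> {0..<1} \<Longrightarrow> k < b \<Longrightarrow> l < b \<Longrightarrow> tangent_digits b \<gamma> \<eta> x k l \<Longrightarrow> R x k l"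
    and card: "\<And>x k. x \<in> {0..<1} \<Longrightarrow> k < b \<Longrightarrow> real (card {l. l < b \<and> R x k l}) \<le> \<rho>"
  shows "sigma b \<gamma> psi 1 \<le> ereal \<rho>"
proof (rule sigma_one_le[OF b \<gamma> \<eta>, where \<omega> = "\<lambda>_. 1" and m = 1 and M = 1
      and V = "\<lambda>x k l. if R x k l then 1 else 0"])
  fix x k assume x: "x \<in> {0..<1::real}" and k: "k < b"
  have "(\<Sum>l<b. if R x k l then 1 else 0 :: real) = real (card {l. l < b \<and> R x k l})"
    by (subst sum.inter_filter[symmetric]) (auto intro!: arg_cong[where f = card])
  then show "1 / 1 * (\<Sum>l<b. if R x k l then 1 else 0 :: real) \<le> \<rho>"
    using card[OF x k] by simp
qed (use R sym in auto)

text \<open>The weight \<open>\<rho> ^ \<tau>\<close> defers the loss: \<open>\<tau> x\<close> is a lower bound for the number of inverse branches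
  needed to move \<open>x\<close> to a point with a tangent pair of digits.\<close>

lemma sigma_one_le_matching:
  fixes \<tau> :: "real \<Rightarrow> nat" and \<rho> s0 :: real
  assumes b: "b \<ge> 1" and \<gamma>: "0 \<le> \<gamma>" "\<gamma> < 1" and conf: "confined b \<gamma> s0" and \<rho>: "\<rho> > 1"
    and \<tau>[measurable]: "\<tau> \<in> measurable borel (count_space UNIV)" and \<tau>_le: "\<And>x. \<tau> x \<le> N"
    and unique: "\<And>x k l l'. x \<in> {0..<1} \<Longrightarrow> k < b \<Longrightarrow> l < b \<Longrightarrow> l' < b \<Longrightarrow> l \<noteq> k \<Longrightarrow> l' \<noteq> k \<Longrightarrow>
      \<bar>sin (pi * (2 * x + real k + real l) / real b)\<bar> \<le> s0 \<Longrightarrow>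
      \<bar>sin (pi * (2 * x + real k + real l') / real b)\<bar> \<le> s0 \<Longrightarrow> l = l'"
    and step: "\<And>x k. x \<in> {0..<1} \<Longrightarrow> k < b \<Longrightarrow> \<tau> x \<le> \<tau> ((x + real k) / real b) + 1"
    and pair: "\<And>x k l. x \<in> {0..<1} \<Longrightarrow> k < b \<Longrightarrow> l < b \<Longrightarrow> k \<noteq> l \<Longrightarrow>
      \<bar>sin (pi * (2 * x + real k + real l) / real b)\<bar> \<le> s0 \<Longrightarrow>
      \<tau> x = 0 \<and> 1 \<le> (\<rho> ^ Suc (\<tau> ((x + real k) / real b)) - 1) * (\<rho> ^ Suc (\<tau> ((x + real l) / real b)) - 1)"
  shows "sigma b \<gamma> psi 1 \<le> ereal \<rho>"
proof -
  obtain \<eta> where \<eta>: "\<eta> > 0" and conf': "\<And>x k l. x \<in> {0..<1} \<Longrightarrow> k < b \<Longrightarrow> l < b \<Longrightarrow> k \<noteq> l \<Longrightarrow>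
      tangent_digits b \<gamma> \<eta> x k l \<Longrightarrow> \<bar>sin (pi * (2 * x + real k + real l) / real b)\<bar> \<le> s0"
    using conf unfolding confined_def by blast
  define R where "R x k l \<longleftrightarrow> \<bar>sin (pi * (2 * x + real k + real l) / real b)\<bar> \<le> s0" for x and k l :: nat
  \<comment> \<open>The entry for a partner is the largest that the row allows: with the diagonal
    entry 1 the row sum is \<open>\<rho> ^ Suc (\<tau> ...)\<close>, and the weight quotient reduces
    it to \<rho> because \<tau> vanishes at \<open>x\<close>. A row without partner has sum 1, and
    there \<open>step\<close> bounds the weight quotient by \<rho>.\<close>
  define V where "V x k l = (if k = l then 1 else if R x k l then \<rho> ^ Suc (\<tau> ((x + real k) / real b)) - 1 else 0)"
    for x k l
  have sym: "R x k l = R x l k" for x k l unfolding R_def by (simp add: add_ac)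
  have [measurable]: "Measurable.pred borel (\<lambda>x. R x k l)" for k l unfolding R_def by measurable
  have pow1: "1 \<le> \<rho> ^ n" for n using \<rho> by (simp add: one_le_power)
  have V_measurable: "(\<lambda>x. V x k l) \<in> borel_measurable borel" for k l
    unfolding V_def by measurable
  have row: "\<rho> ^ \<tau> x / \<rho> ^ \<tau> ((x + real k) / real b) * (\<Sum>l<b. V x k l) \<le> \<rho>"
    if x: "x \<in> {0..<1}" and k: "k < b" for x k
  proof (cases "\<exists>l<b. l \<noteq> k \<and> R x k l")
    case True
    then obtain l where l: "l < b" "l \<noteq> k" "R x k l" by blast
    have "V x k l' = 0" if "l' \<in> {..<b} - {k, l}" for l'
      using unique[OF x k l(1), of l'] l that unfolding V_def R_def by auto
    then have "(\<Sum>l'<b. V x k l') = (\<Sum>l'\<in>{k, l}. V x k l')"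
      using k l by (intro sum.mono_neutral_right) auto
    also have "\<dots> = \<rho> ^ Suc (\<tau> ((x + real k) / real b))"
      using l by (simp add: V_def)
    moreover have "\<tau> x = 0" using pair[OF x k l(1)] l unfolding R_def by auto
    ultimately show ?thesis using \<rho> by simp
  next
    case False
    have "(\<Sum>l<b. V x k l) = (\<Sum>l<b. if l = k then 1 else 0)"
      using False by (intro sum.cong) (auto simp: V_def)
    then have "(\<Sum>l<b. V x k l) = 1" using k by simp
    moreover have "\<rho> ^ \<tau> x \<le> \<rho> ^ (\<tau> ((x + real k) / real b) + 1)"
      using step[OF x k] \<rho> by (intro power_increasing) auto
    moreover have "0 < \<rho> ^ \<tau> ((x + real k) / real b)" using \<rho> by simp
    ultimately show ?thesis by (simp add: pos_divide_le_eq mult.commute)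
  qed
  show ?thesis
  proof (rule sigma_one_le[OF b \<gamma> \<eta>, where \<omega> = "\<lambda>x. \<rho> ^ \<tau> x" and V = V and m = 1 and M = "\<rho> ^ N"])
    show "(\<lambda>x. \<rho> ^ \<tau> x) \<in> borel_measurable borel" by measurable
    show "1 \<le> \<rho> ^ \<tau> x \<and> \<rho> ^ \<tau> x \<le> \<rho> ^ N" for x
      using pow1 \<tau>_le \<rho> by (auto intro: power_increasing)
    show "0 \<le> V x k l" for x k l
      using pow1[of "Suc (\<tau> ((x + real k) / real b))"] unfolding V_def by auto
    show "1 \<le> V x k l * V x l k"
      if "x \<in> {0..<1}" "k < b" "l < b" "tangent_digits b \<gamma> \<eta> x k l" for x k l
    proof (cases "k = l")
      case True then show ?thesis by (simp add: V_def)
    next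
      case False
      then have R: "R x k l" using conf' that unfolding R_def by blast
      then show ?thesis
        using pair[OF that(1-3) False] sym[of x k l] False unfolding V_def R_def by auto
    qed
  qed (use V_measurable row in auto)
qed

lemma sigma_one_le_transversal:
  assumes b: "b \<ge> 1" and \<gamma>: "0 \<le> \<gamma>" "\<gamma> < 1" and conf: "confined b \<gamma> (- 1)"
  shows "sigma b \<gamma> psi 1 \<le> 1"
proof -
  obtain \<eta> where \<eta>: "\<eta> > 0" and conf': "\<And>x k l. x \<in> {0..<1} \<Longrightarrow> k < b \<Longrightarrow> l < b \<Longrightarrow> k \<noteq> l \<Longrightarrow>
      tangent_digits b \<gamma> \<eta> x k l \<Longrightarrow> \<bar>sin (pi * (2 * x + real k + real l) / real b)\<bar> \<le> - 1"
    using conf unfolding confined_def by blast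
  have "sigma b \<gamma> psi 1 \<le> ereal 1"
  proof (rule sigma_one_le_card[OF b \<gamma> \<eta>, where R = "\<lambda>x k l. k = l"])
    show "k = l" if "x \<in> {0..<1}" "k < b" "l < b" "tangent_digits b \<gamma> \<eta> x k l" for x k l
    proof (rule ccontr)
      assume "k \<noteq> l"
      from conf'[OF that(1-3) this that(4)] show False by linarith
    qed
    show "real (card {l. l < b \<and> k = l}) \<le> 1" if "k < b" for k
    proof -
      have "{l. l < b \<and> k = l} = {k}" using that by auto
      then show ?thesis by simp
    qed
  qed auto
  then show ?thesis by (simp add: one_ereal_def)
qed

section \<open>Geometric series along backward orbits\<close>

text \<open>Telescoping against a bounded potential.\<close>
lemma suminf_le_potential:
  fixes f u :: "nat \<Rightarrow> real"
  assumes r: "0 \<le> r" "r < 1" and f: "\<And>n. \<bar>f n\<bar> \<le> M" and u: "\<And>n. \<bar>u n\<bar> \<le> M'"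
    and step: "\<And>n. f n + r * u (Suc n) \<le> u n"
  shows "(\<Sum>n. r ^ n * f n) \<le> u 0"
proof -
  have partial: "(\<Sum>i<n. r ^ i * f i) + r ^ n * u n \<le> u 0" for n
  proof (induction n)
    case (Suc n)
    have "r ^ n * (f n + r * u (Suc n)) \<le> r ^ n * u n"
      using r step by (intro mult_left_mono) auto
    then show ?case using Suc by (simp add: algebra_simps)
  qed simp
  have "(\<lambda>n. r ^ n * u n) \<longlonglongrightarrow> 0"
    using summable_power_bounded[OF r u] by (rule summable_LIMSEQ_zero)
  then have "(\<lambda>n. (\<Sum>i<n. r ^ i * f i) + r ^ n * u n) \<longlonglongrightarrow> (\<Sum>n. r ^ n * f n) + 0"
    using summable_power_bounded[OF r f] by (intro tendsto_add summable_LIMSEQ)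
  then show ?thesis
    using partial by (intro LIMSEQ_le_const2) auto
qed

lemma suminf_le_geometric:
  fixes f :: "nat \<Rightarrow> real"
  assumes r: "0 \<le> r" "r < 1" and f: "\<And>n. \<bar>f n\<bar> \<le> M" and "\<And>n. f n \<le> K"
  shows "(\<Sum>n. r ^ n * f n) \<le> K / (1 - r)"
proof (rule suminf_le_potential[OF r f, where u = "\<lambda>_. K / (1 - r)"])
  show "f n + r * (K / (1 - r)) \<le> K / (1 - r)" for n
  proof -
    have "K / (1 - r) - r * (K / (1 - r)) = (1 - r) * (K / (1 - r))"
      by (simp only: left_diff_distrib mult_1)
    also have "\<dots> = K" using r by simp
    finally show ?thesis using assms(4)[of n] by linarith
  qed
qed auto

lemma abs_suminf_le_geometric:
  fixes f :: "nat \<Rightarrow> real"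
  assumes r: "0 \<le> r" "r < 1" and f: "\<And>n. \<bar>f n\<bar> \<le> K"
  shows "\<bar>\<Sum>n. r ^ n * f n\<bar> \<le> K / (1 - r)"
proof -
  have "f n \<le> K" "- f n \<le> K" for n using f[of n] by auto
  then have "(\<Sum>n. r ^ n * f n) \<le> K / (1 - r)" "(\<Sum>n. r ^ n * - f n) \<le> K / (1 - r)"
    using f by (intro suminf_le_geometric[OF r, where M = K]; simp)+
  moreover have "(\<Sum>n. r ^ n * - f n) = - (\<Sum>n. r ^ n * f n)"
    using suminf_minus[OF summable_power_bounded[OF r f]] by simp
  ultimately show ?thesis by linarith
qed

lemma suminf_power_split:
  fixes f :: "nat \<Rightarrow> real"
  assumes r: "0 \<le> r" "r < 1" and f: "\<And>n. \<bar>f n\<bar> \<le> M"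
  shows "(\<Sum>n. r ^ n * f n) = f 0 + r * (\<Sum>n. r ^ n * f (Suc n))"
proof -
  have "(\<Sum>n. r ^ n * f n) = f 0 + (\<Sum>n. r ^ Suc n * f (Suc n))"
    using suminf_split_head[OF summable_power_bounded[OF r, of f M, OF f]] by simp
  also have "(\<Sum>n. r ^ Suc n * f (Suc n)) = (\<Sum>n. r * (r ^ n * f (Suc n)))"
    by (simp add: mult_ac)
  also have "\<dots> = r * (\<Sum>n. r ^ n * f (Suc n))"
    by (rule suminf_mult) (rule summable_power_bounded[OF r f])
  finally show ?thesis .
qed

text \<open>Grouping the terms in blocks of two gives a series of ratio \<open>r\<^sup>2\<close>.
  This gains when two consecutive terms cannot both be extremal, as happens along orbits of
  multiplication by 2 or 3.\<close>

lemma suminf_le_pairs: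
  fixes f :: "nat \<Rightarrow> real"
  assumes r: "0 \<le> r" "r < 1" and f: "\<And>n. \<bar>f n\<bar> \<le> M" and pair: "\<And>n. f n + r * f (Suc n) \<le> K"
  shows "(\<Sum>n. r ^ n * f n) \<le> K / (1 - r\<^sup>2)"
proof -
  have r2: "0 \<le> r\<^sup>2" "r\<^sup>2 < 1" using r by (auto simp: power_less_one_iff)
  have "(\<Sum>n. r ^ n * f n) = (\<Sum>n. \<Sum>i\<in>{n * 2..<n * 2 + 2}. r ^ i * f i)"
    using sums_group[OF summable_sums[OF summable_power_bounded[OF r, of f M, OF f]], of 2]
    by (simp only: sums_iff zero_less_numeral simp_thms)
  also have "\<dots> = (\<Sum>n. (r\<^sup>2) ^ n * (f (2 * n) + r * f (Suc (2 * n))))"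
  proof (rule suminf_cong)
    fix n :: nat
    have "{n * 2..<n * 2 + 2} = {2 * n, Suc (2 * n)}" by auto
    then show "(\<Sum>i\<in>{n * 2..<n * 2 + 2}. r ^ i * f i) = (r\<^sup>2) ^ n * (f (2 * n) + r * f (Suc (2 * n)))"
      by (simp add: algebra_simps flip: power_mult)
  qed
  also have "\<dots> \<le> K / (1 - r\<^sup>2)"
  proof (rule suminf_le_geometric[OF r2, where M = "M + r * M"])
    show "\<bar>f (2 * n) + r * f (Suc (2 * n))\<bar> \<le> M + r * M" for n
      using f[of "2 * n"] mult_left_mono[OF f[of "Suc (2 * n)"] r(1)] r(1)
      by (intro order.trans[OF abs_triangle_ineq] add_mono) (auto simp: abs_mult)
  qed (use pair in auto)
  finally show ?thesis .
qed

lemma abs_sin_diff_le: "\<bar>sin a - sin b\<bar> \<le> (2::real)"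
  using abs_sin_le_one[of a] abs_sin_le_one[of b] by linarith

lemma abs_cos_diff_le: "\<bar>cos a - cos b\<bar> \<le> (2::real)"
  using abs_cos_le_one[of a] abs_cos_le_one[of b] by linarith

section \<open>First terms of the two tangency sums\<close>

lemma near_tangent_split:
  assumes \<gamma>: "0 \<le> \<gamma>" "\<gamma> < 1" and b: "b \<ge> 1" and nt: "near_tangent b \<gamma> \<eta> \<alpha> \<beta>"
  shows "\<bar>sin (\<alpha> 0) - sin (\<beta> 0)
      + \<gamma> * (\<Sum>n. \<gamma> ^ n * (sin (\<alpha> (Suc n)) - sin (\<beta> (Suc n))))\<bar> \<le> \<eta>"
    and "\<bar>cos (\<alpha> 0) - cos (\<beta> 0)
      + \<gamma> / real b * (\<Sum>n. (\<gamma> / real b) ^ n * (cos (\<alpha> (Suc n)) - cos (\<beta> (Suc n))))\<bar> \<le> \<eta>"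
proof -
  have g: "0 \<le> \<gamma> / real b" "\<gamma> / real b < 1"
    using \<gamma> b by (auto simp: divide_simps intro: order.strict_trans2)
  note split = suminf_power_split[OF \<gamma>, of "\<lambda>n. sin (\<alpha> n) - sin (\<beta> n)" 2, OF abs_sin_diff_le]
    suminf_power_split[OF g, of "\<lambda>n. cos (\<alpha> n) - cos (\<beta> n)" 2, OF abs_cos_diff_le]
  show "\<bar>sin (\<alpha> 0) - sin (\<beta> 0)
      + \<gamma> * (\<Sum>n. \<gamma> ^ n * (sin (\<alpha> (Suc n)) - sin (\<beta> (Suc n))))\<bar> \<le> \<eta>"
    and "\<bar>cos (\<alpha> 0) - cos (\<beta> 0)
      + \<gamma> / real b * (\<Sum>n. (\<gamma> / real b) ^ n * (cos (\<alpha> (Suc n)) - cos (\<beta> (Suc n))))\<bar> \<le> \<eta>"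
    using nt unfolding near_tangent_def split by auto
qed

text \<open>A chord of the unit circle has length at most 2, by the parallelogram law. This couples
  the two sums: a large sine difference forces a small cosine difference.\<close>

lemma sin_cos_diff_sq_le: "(cos a - cos b)\<^sup>2 + (sin a - sin b)\<^sup>2 \<le> (4::real)"
proof -
  have "(c - d)\<^sup>2 + (s - t)\<^sup>2 = 2 * (s\<^sup>2 + c\<^sup>2) + 2 * (t\<^sup>2 + d\<^sup>2) - ((c + d)\<^sup>2 + (s + t)\<^sup>2)"
    for c d s t :: real
    by (simp add: power2_eq_square algebra_simps)
  then have "(cos a - cos b)\<^sup>2 + (sin a - sin b)\<^sup>2 = 2 * ((sin a)\<^sup>2 + (cos a)\<^sup>2)
      + 2 * ((sin b)\<^sup>2 + (cos b)\<^sup>2) - ((cos a + cos b)\<^sup>2 + (sin a + sin b)\<^sup>2)" .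
  also have "\<dots> \<le> 4" by simp
  finally show ?thesis .
qed

lemma tangent_digitsE:
  assumes "tangent_digits b \<gamma> \<eta> x k l"
  obtains \<alpha> \<beta> where "back_orbit b \<alpha>" "back_orbit b \<beta>" "near_tangent b \<gamma> \<eta> \<alpha> \<beta>"
    "\<alpha> 0 = pi * (2 * x + real k + real l) / real b + pi * (real k - real l) / real b"
    "\<beta> 0 = pi * (2 * x + real k + real l) / real b - pi * (real k - real l) / real b"
proof -
  have "2 * pi * ((x + real k) / real b)
      = pi * (2 * x + real k + real l) / real b + pi * (real k - real l) / real b"
    "2 * pi * ((x + real l) / real b)
      = pi * (2 * x + real k + real l) / real b - pi * (real k - real l) / real b"
    by (auto simp: algebra_simps add_divide_distrib diff_divide_distrib)
  then show thesis using assms that unfolding tangent_digits_def by metis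
qed

text \<open>With \<open>\<alpha> 0 = \<phi> + \<mu>\<close> and \<open>\<beta> 0 = \<phi> - \<mu>\<close> the first terms of the two tangency sums are
  \<open>2 cos \<phi> sin \<mu>\<close> and \<open>-2 sin \<phi> sin \<mu>\<close>.\<close>

lemma near_tangent_first_step:
  assumes \<gamma>: "0 \<le> \<gamma>" "\<gamma> < 1" and b: "b \<ge> 1" and nt: "near_tangent b \<gamma> \<eta> \<alpha> \<beta>"
    and start: "\<alpha> 0 = \<phi> + \<mu>" "\<beta> 0 = \<phi> - \<mu>"
  shows "\<exists>X Y. 0 \<le> X \<and> 0 \<le> Y \<and> X\<^sup>2 + Y\<^sup>2 \<le> 4 \<and>
    2 * \<bar>sin \<phi> * sin \<mu>\<bar> \<le> \<gamma> / real b * (X + \<gamma> / real b * (2 / (1 - \<gamma> / real b))) + \<eta> \<and>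
    2 * \<bar>cos \<phi> * sin \<mu>\<bar> \<le> \<gamma> * (Y + \<gamma> * (2 / (1 - \<gamma>))) + \<eta>"
proof (intro exI conjI)
  have g: "0 \<le> \<gamma> / real b" "\<gamma> / real b < 1"
    using \<gamma> b by (auto simp: divide_simps intro: order.strict_trans2)
  let ?X = "\<bar>cos (\<alpha> 1) - cos (\<beta> 1)\<bar>" and ?Y = "\<bar>sin (\<alpha> 1) - sin (\<beta> 1)\<bar>"
  show "0 \<le> ?X" "0 \<le> ?Y" by auto
  show "?X\<^sup>2 + ?Y\<^sup>2 \<le> 4" using sin_cos_diff_sq_le by simp
  have tail: "\<bar>\<Sum>n. r ^ n * f (Suc n)\<bar> \<le> \<bar>f 1\<bar> + r * (2 / (1 - r))"
    if "0 \<le> r" "r < 1" and f: "\<And>n. \<bar>f n\<bar> \<le> 2" for r and f :: "nat \<Rightarrow> real"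
  proof -
    have "(\<Sum>n. r ^ n * f (Suc n)) = f 1 + r * (\<Sum>n. r ^ n * f (Suc (Suc n)))"
      using suminf_power_split[OF that(1,2), of "\<lambda>n. f (Suc n)" 2] f by simp
    moreover have "\<bar>r * (\<Sum>n. r ^ n * f (Suc (Suc n)))\<bar> \<le> r * (2 / (1 - r))"
      using mult_left_mono[OF abs_suminf_le_geometric[OF that(1,2), of "\<lambda>n. f (Suc (Suc n))" 2] that(1)] f that(1)
      by (simp add: abs_mult)
    ultimately show ?thesis by linarith
  qed
  have combine: "2 * \<bar>z\<bar> \<le> r * T + \<eta>" if "\<bar>2 * z + r * t\<bar> \<le> \<eta>" "\<bar>t\<bar> \<le> T" "0 \<le> r" for z r t T
  proof -
    have "\<bar>r * t\<bar> \<le> r * T" using that by (simp add: abs_mult mult_left_mono)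
    then show ?thesis using that(1) by linarith
  qed
  have "cos (\<alpha> 0) - cos (\<beta> 0) = 2 * - (sin \<phi> * sin \<mu>)" "sin (\<alpha> 0) - sin (\<beta> 0) = 2 * (cos \<phi> * sin \<mu>)"
    by (simp_all add: start sin_add sin_diff cos_add cos_diff)
  note near_tangent_split[OF \<gamma> b nt, unfolded this]
  note combine[OF this(1) tail[OF \<gamma>, of "\<lambda>n. sin (\<alpha> n) - sin (\<beta> n)", OF abs_sin_diff_le] \<gamma>(1)]
    combine[OF this(2) tail[OF g, of "\<lambda>n. cos (\<alpha> n) - cos (\<beta> n)", OF abs_cos_diff_le] g(1)]
  then show "2 * \<bar>sin \<phi> * sin \<mu>\<bar> \<le> \<gamma> / real b * (?X + \<gamma> / real b * (2 / (1 - \<gamma> / real b))) + \<eta>"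
    "2 * \<bar>cos \<phi> * sin \<mu>\<bar> \<le> \<gamma> * (?Y + \<gamma> * (2 / (1 - \<gamma>))) + \<eta>"
    by simp_all
qed

lemma near_tangent_sin_sin_le:
  assumes \<gamma>: "0 \<le> \<gamma>" "\<gamma> < 1" and b: "b \<ge> 1" and nt: "near_tangent b \<gamma> \<eta> \<alpha> \<beta>"
    and start: "\<alpha> 0 = \<phi> + \<mu>" "\<beta> 0 = \<phi> - \<mu>"
  shows "2 * \<bar>sin \<phi> * sin \<mu>\<bar> \<le> 2 * \<gamma> / (real b - \<gamma>) + \<eta>"
proof -
  obtain X Y where XY: "0 \<le> X" "X\<^sup>2 + Y\<^sup>2 \<le> 4"
    "2 * \<bar>sin \<phi> * sin \<mu>\<bar> \<le> \<gamma> / real b * (X + \<gamma> / real b * (2 / (1 - \<gamma> / real b))) + \<eta>"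
    using near_tangent_first_step[OF assms] by auto
  have four_eq: "(2::real)\<^sup>2 = 4" by simp
  have "X\<^sup>2 \<le> 2\<^sup>2" using XY(2) zero_le_power2[of Y] unfolding four_eq by linarith
  then have X: "X \<le> 2" using power2_le_imp_le[of X 2] by simp
  have "\<gamma> < real b" "0 < real b" using \<gamma> b by linarith+
  have "\<gamma> / real b * (X + \<gamma> / real b * (2 / (1 - \<gamma> / real b)))
      \<le> \<gamma> / real b * (2 + \<gamma> / real b * (2 / (1 - \<gamma> / real b)))"
    using X \<gamma> by (intro mult_left_mono) auto
  also have "\<dots> = 2 * \<gamma> / (real b - \<gamma>)"
    using \<open>\<gamma> < real b\<close> \<open>0 < real b\<close> by (simp add: divide_simps)
  finally show ?thesis using XY(3) by linarith
qed

text \<open>Pairing the two tangency sums with the unit vector \<open>(cos \<phi>, - sin \<phi>)\<close> makes the first term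
  \<open>2 sin \<mu>\<close>.\<close>
lemma near_tangent_sin_le:
  assumes \<gamma>: "0 \<le> \<gamma>" "\<gamma> < 1" and b: "b \<ge> 1" and nt: "near_tangent b \<gamma> \<eta> \<alpha> \<beta>"
    and start: "\<alpha> 0 = \<phi> + \<mu>" "\<beta> 0 = \<phi> - \<mu>"
  shows "\<bar>sin \<mu>\<bar> \<le> \<gamma> / (1 - \<gamma>) + \<eta>"
proof -
  have g: "0 \<le> \<gamma> / real b" "\<gamma> / real b < 1"
    using \<gamma> b by (auto simp: divide_simps intro: order.strict_trans2)
  \<comment> \<open>The factor \<open>(1 / b) ^ n\<close> is moved from the ratio into the term, so
    that both sums can be combined into one series of ratio \<gamma>.\<close>
  define f where "f n = cos \<phi> * (sin (\<alpha> n) - sin (\<beta> n))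
    - sin \<phi> * ((1 / real b) ^ n * (cos (\<alpha> n) - cos (\<beta> n)))" for n
  \<comment> \<open>The linear form with coefficients \<open>cos \<phi>\<close> and
    \<open>- h * sin \<phi>\<close> has norm at most 1, hence is at most 1 on the unit
    circle.\<close>
  have contraction: "\<bar>cos \<phi> * sin y - sin \<phi> * (h * cos y)\<bar> \<le> 1" if "0 \<le> h" "h \<le> 1" for h y
  proof -
    have "(c * s' - s * (h * c'))\<^sup>2 + (c * c' + s * (h * s'))\<^sup>2 = (c\<^sup>2 + h\<^sup>2 * s\<^sup>2) * (s'\<^sup>2 + c'\<^sup>2)"
      for c s c' s' :: real
      by (simp add: power2_eq_square algebra_simps)
    then have "(cos \<phi> * sin y - sin \<phi> * (h * cos y))\<^sup>2 + (cos \<phi> * cos y + sin \<phi> * (h * sin y))\<^sup>2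
        = ((cos \<phi>)\<^sup>2 + h\<^sup>2 * (sin \<phi>)\<^sup>2) * ((sin y)\<^sup>2 + (cos y)\<^sup>2)" .
    also have "\<dots> = (cos \<phi>)\<^sup>2 + h\<^sup>2 * (sin \<phi>)\<^sup>2" by simp
    also have "\<dots> \<le> (cos \<phi>)\<^sup>2 + 1 * (sin \<phi>)\<^sup>2"
      using that by (intro add_left_mono mult_right_mono) (auto simp: power_le_one)
    also have "\<dots> = 1" by simp
    finally have "(cos \<phi> * sin y - sin \<phi> * (h * cos y))\<^sup>2 \<le> 1"
      using zero_le_power2[of "cos \<phi> * cos y + sin \<phi> * (h * sin y)"] by linarith
    then show ?thesis by (simp add: abs_square_le_1)
  qed
  have f2: "\<bar>f n\<bar> \<le> 2" for n
  proof -
    have h: "0 \<le> (1 / real b) ^ n" "(1 / real b) ^ n \<le> 1"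
      using b by (auto intro!: power_le_one)
    have "f n = (cos \<phi> * sin (\<alpha> n) - sin \<phi> * ((1 / real b) ^ n * cos (\<alpha> n)))
        - (cos \<phi> * sin (\<beta> n) - sin \<phi> * ((1 / real b) ^ n * cos (\<beta> n)))"
      unfolding f_def by (simp add: algebra_simps)
    then show ?thesis using contraction[OF h, of "\<alpha> n"] contraction[OF h, of "\<beta> n"] by linarith
  qed
  let ?A = "\<Sum>n. \<gamma> ^ n * (sin (\<alpha> n) - sin (\<beta> n))"
  let ?B = "\<Sum>n. (\<gamma> / real b) ^ n * (cos (\<alpha> n) - cos (\<beta> n))"
  have sA: "summable (\<lambda>n. \<gamma> ^ n * (sin (\<alpha> n) - sin (\<beta> n)))"
    using \<gamma> abs_sin_diff_le by (rule summable_power_bounded)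
  have sB: "summable (\<lambda>n. (\<gamma> / real b) ^ n * (cos (\<alpha> n) - cos (\<beta> n)))"
    using g abs_cos_diff_le by (rule summable_power_bounded)
  have "(\<Sum>n. \<gamma> ^ n * f n) = (\<Sum>n. cos \<phi> * (\<gamma> ^ n * (sin (\<alpha> n) - sin (\<beta> n)))
      - sin \<phi> * ((\<gamma> / real b) ^ n * (cos (\<alpha> n) - cos (\<beta> n))))"
    unfolding f_def by (intro suminf_cong) (simp add: algebra_simps power_divide diff_divide_distrib)
  also have "\<dots> = cos \<phi> * ?A - sin \<phi> * ?B"
    by (simp only: suminf_diff[OF summable_mult[OF sA] summable_mult[OF sB], symmetric]
        suminf_mult[OF sA] suminf_mult[OF sB])
  finally have sum: "(\<Sum>n. \<gamma> ^ n * f n) = cos \<phi> * ?A - sin \<phi> * ?B" .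
  have "\<bar>cos \<phi> * ?A\<bar> \<le> 1 * \<eta>" "\<bar>sin \<phi> * ?B\<bar> \<le> 1 * \<eta>"
    unfolding abs_mult using nt unfolding near_tangent_def by (intro mult_mono; simp)+
  then have "\<bar>\<Sum>n. \<gamma> ^ n * f n\<bar> \<le> 2 * \<eta>" unfolding sum by linarith
  moreover have "(\<Sum>n. \<gamma> ^ n * f n) = f 0 + \<gamma> * (\<Sum>n. \<gamma> ^ n * f (Suc n))"
    using suminf_power_split[OF \<gamma>, of f 2] f2 by blast
  moreover have "\<bar>\<gamma> * (\<Sum>n. \<gamma> ^ n * f (Suc n))\<bar> \<le> \<gamma> * (2 / (1 - \<gamma>))"
    using mult_left_mono[OF abs_suminf_le_geometric[OF \<gamma>, of "\<lambda>n. f (Suc n)" 2] \<gamma>(1)] f2 \<gamma>(1)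
    by (simp add: abs_mult)
  moreover have "f 0 = 2 * sin \<mu>"
  proof -
    have "f 0 = cos \<phi> * (2 * cos \<phi> * sin \<mu>) - sin \<phi> * (- 2 * sin \<phi> * sin \<mu>)"
      unfolding f_def by (simp add: start sin_add sin_diff cos_add cos_diff)
    also have "c * (2 * c * m) - s * (- 2 * s * m) = 2 * m * (s\<^sup>2 + c\<^sup>2)" for c s m :: real
      by (simp add: power2_eq_square algebra_simps)
    finally show ?thesis by simp
  qed
  moreover have "\<gamma> * (2 / (1 - \<gamma>)) = 2 * (\<gamma> / (1 - \<gamma>))" by simp
  ultimately show ?thesis by linarith
qed

text \<open>The sine increases up to \<open>pi / 2\<close>, and the reflection from \<open>m\<close>
  to \<open>b - m\<close> handles the rest. Applied to differences of digits this is the basic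
  separation \<open>sin (pi / b) <= \<bar>sin \<mu>\<bar>\<close>.\<close>

lemma sin_ge_sin_pi_div:
  assumes "\<bar>m\<bar> \<ge> 1" "\<bar>m\<bar> \<le> real b - 1" "b \<ge> 2"
  shows "sin (pi / real b) \<le> \<bar>sin (pi * m / real b)\<bar>"
proof -
  have "\<bar>sin (pi * m / real b)\<bar> = \<bar>sin (pi * \<bar>m\<bar> / real b)\<bar>"
    by (cases "m \<ge> 0") auto
  moreover have mono: "sin (pi / real b) \<le> sin (pi * y / real b)" if "1 \<le> y" "y \<le> real b / 2" for y
  proof (rule sin_monotone_2pi_le)
    have "0 < pi / real b" using assms by simp
    then show "- (pi / 2) \<le> pi / real b" using pi_gt_zero by linarith
    show "pi / real b \<le> pi * y / real b" "pi * y / real b \<le> pi / 2"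
      using assms(3) that by (auto simp: field_simps)
  qed
  have "sin (pi / real b) \<le> sin (pi * \<bar>m\<bar> / real b)"
  proof (cases "\<bar>m\<bar> \<le> real b / 2")
    case False
    have "pi * (real b - \<bar>m\<bar>) / real b = pi - pi * \<bar>m\<bar> / real b"
      using assms(3) by (simp add: field_simps)
    then have "sin (pi * \<bar>m\<bar> / real b) = sin (pi * (real b - \<bar>m\<bar>) / real b)"
      by simp
    then show ?thesis using mono[of "real b - \<bar>m\<bar>"] False assms by simp
  qed (use mono assms in auto)
  ultimately show ?thesis by linarith
qed

lemma sin_digit_diff_ge:
  assumes "k < b" "l < b" "k \<noteq> l"
  shows "sin (pi / real b) \<le> \<bar>sin (pi * (real k - real l) / real b)\<bar>"
proof (rule sin_ge_sin_pi_div)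
  show "1 \<le> \<bar>real k - real l\<bar>" "\<bar>real k - real l\<bar> \<le> real b - 1" "2 \<le> b"
    using assms by linarith+
qed

lemma sin_pi_div_pos: "b \<ge> 2 \<Longrightarrow> 0 < sin (pi / real b)"
  by (intro sin_gt_zero) (auto simp: field_simps)

text \<open>Tangency forces
  \<open>\<bar>sin \<mu>\<bar> <= \<gamma> / (1 - \<gamma>) + \<eta>\<close>, while distinct digits
  have \<open>\<bar>sin \<mu>\<bar> >= sin (pi / b)\<close>; half of the gap serves as
  \<eta>.\<close>

lemma confined_transversal:
  assumes \<gamma>: "0 \<le> \<gamma>" "\<gamma> < 1" and b: "b \<ge> 2" and gap: "\<gamma> / (1 - \<gamma>) < sin (pi / real b)"
  shows "confined b \<gamma> (- 1)"
  unfolding confined_def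
proof (intro exI[of _ "(sin (pi / real b) - \<gamma> / (1 - \<gamma>)) / 2"] conjI ballI allI impI)
  let ?\<eta> = "(sin (pi / real b) - \<gamma> / (1 - \<gamma>)) / 2"
  show "?\<eta> > 0" using gap by simp
  fix x k l assume kl: "k < b" "l < b" "k \<noteq> l" and t: "tangent_digits b \<gamma> ?\<eta> x k l"
  have b1: "1 \<le> b" using b by simp
  obtain \<alpha> \<beta> where "near_tangent b \<gamma> ?\<eta> \<alpha> \<beta>"
    "\<alpha> 0 = pi * (2 * x + real k + real l) / real b + pi * (real k - real l) / real b"
    "\<beta> 0 = pi * (2 * x + real k + real l) / real b - pi * (real k - real l) / real b"
    using tangent_digitsE[OF t] by blast
  from near_tangent_sin_le[OF \<gamma> b1 this] sin_digit_diff_ge[OF kl] gap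
  show "\<bar>sin (pi * (2 * x + real k + real l) / real b)\<bar> \<le> - 1" by argo
qed

section \<open>Counting tangent digits\<close>

lemma sin_ge_cubic:
  fixes y :: real
  assumes "0 \<le> y"
  shows "y - y ^ 3 / 6 \<le> sin y"
proof -
  have "\<bar>sin y - (\<Sum>m<3. sin_coeff m * y ^ m)\<bar> \<le> inverse (fact 3) * \<bar>y\<bar> ^ 3"
    by (rule Maclaurin_sin_bound)
  then have "\<bar>sin y - y\<bar> \<le> y ^ 3 / 6"
    using assms by (simp add: sin_coeff_def numeral_eq_Suc fact_reduce)
  then show ?thesis by linarith
qed

lemma pi_squared_bounds: "9.8696 \<le> pi\<^sup>2" "pi\<^sup>2 \<le> 9.8697"
proof -
  have "3.1415926\<^sup>2 \<le> pi\<^sup>2" "pi\<^sup>2 \<le> 3.1415927\<^sup>2"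
    using pi_approx by (intro power_mono; simp)+
  then show "9.8696 \<le> pi\<^sup>2" "pi\<^sup>2 \<le> 9.8697" by (simp_all add: power2_eq_square)
qed

text \<open>The square of the cubic Taylor bound, weakened by
  \<open>(1 - z / 6)\<^sup>2 >= 1 - z / 3\<close> and by decimal bounds for
  \<open>pi\<^sup>2\<close>; 3.2899 is 9.8697 / 3. Being rational in \<open>b\<close>, it turns
  estimates for all \<open>b\<close> into polynomial inequalities.\<close>

lemma sin_pi_div_squared_ge:
  assumes "b \<ge> 2"
  shows "9.8696 / (real b)\<^sup>2 * (1 - 3.2899 / (real b)\<^sup>2) \<le> (sin (pi / real b))\<^sup>2"
proof -
  define y where "y = pi / real b"
  have b4: "4 \<le> (real b)\<^sup>2" using power_mono[of 2 "real b" 2] assms by simp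
  have y2: "y\<^sup>2 = pi\<^sup>2 / (real b)\<^sup>2" unfolding y_def by (simp add: power_divide)
  have y0: "0 \<le> y" unfolding y_def by simp
  have y3: "9.8696 / (real b)\<^sup>2 \<le> y\<^sup>2" "y\<^sup>2 / 3 \<le> 3.2899 / (real b)\<^sup>2"
    using pi_squared_bounds b4 assms unfolding y2 by (auto simp: divide_simps)
  have "3.2899 / (real b)\<^sup>2 \<le> 3.2899 / 4" using b4 assms by (intro divide_left_mono) auto
  then have s1: "y\<^sup>2 / 3 \<le> 1" using y3 by simp
  have "9.8696 / (real b)\<^sup>2 * (1 - 3.2899 / (real b)\<^sup>2) \<le> y\<^sup>2 * (1 - y\<^sup>2 / 3)"
    using y3 s1 \<open>3.2899 / (real b)\<^sup>2 \<le> 3.2899 / 4\<close> by (intro mult_mono) auto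
  also have "1 - z / 3 \<le> (1 - z / 6)\<^sup>2" for z :: real
    by (simp add: power2_eq_square algebra_simps)
  then have "y\<^sup>2 * (1 - y\<^sup>2 / 3) \<le> y\<^sup>2 * (1 - y\<^sup>2 / 6)\<^sup>2"
    by (intro mult_left_mono) auto
  also have "\<dots> = (y - y ^ 3 / 6)\<^sup>2"
    by (simp add: power2_eq_square power3_eq_cube algebra_simps)
  also have "\<dots> \<le> (sin y)\<^sup>2"
  proof (rule power_mono[OF sin_ge_cubic[OF y0]])
    have "y - y ^ 3 / 6 = y * (1 - y\<^sup>2 / 6)" by (simp add: power2_eq_square power3_eq_cube algebra_simps)
    then show "0 \<le> y - y ^ 3 / 6" using y0 s1 by simp
  qed
  finally show ?thesis unfolding y_def .
qed

lemma abs_sin_diff_le_add: "\<bar>sin (x - y)\<bar> \<le> \<bar>sin x\<bar> + \<bar>sin (y::real)\<bar>"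
proof -
  have "\<bar>sin x * cos y\<bar> \<le> \<bar>sin x\<bar> * 1" "\<bar>cos x * sin y\<bar> \<le> 1 * \<bar>sin y\<bar>"
    unfolding abs_mult by (intro mult_mono; simp)+
  then show ?thesis unfolding sin_diff by linarith
qed

lemma abs_sin_less_imp_near_multiple:
  assumes "0 \<le> z" "z \<le> pi / 2" "\<bar>sin y\<bar> < sin z"
  obtains n :: int where "\<bar>y - of_int n * pi\<bar> < z"
proof -
  define n where "n = round (y / pi)"
  define w where "w = y - of_int n * pi"
  have "\<bar>of_int n - y / pi\<bar> \<le> 1 / 2" unfolding n_def by (rule of_int_round_abs_le)
  then have "\<bar>of_int n - y / pi\<bar> * pi \<le> 1 / 2 * pi" by (intro mult_right_mono) auto
  moreover have "\<bar>of_int n - y / pi\<bar> * pi = \<bar>w\<bar>"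
    unfolding w_def by (simp add: abs_mult_pos[symmetric] field_simps abs_minus_commute)
  ultimately have w: "\<bar>w\<bar> \<le> pi / 2" by simp
  have "y = w + of_int n * pi" unfolding w_def by simp
  then have "sin y = sin w * cos (of_int n * pi)"
    using sin_zero_iff_int2[of "of_int n * pi"] by (auto simp: sin_add)
  then have "\<bar>sin y\<bar> = \<bar>sin w\<bar>"
    by (simp add: abs_mult mult.commute[of _ pi])
  then have "\<bar>sin y\<bar> = sin \<bar>w\<bar>"
    using w sin_ge_zero[of "\<bar>w\<bar>"] by (cases "w \<ge> 0") auto
  then have "\<bar>w\<bar> < z"
    using assms w sin_monotone_2pi_le[of z "\<bar>w\<bar>"] pi_gt_zero by (cases "z \<le> \<bar>w\<bar>") auto
  then show thesis using that unfolding w_def by blast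
qed

text \<open>The sine is small when \<open>\<theta> + l\<close> lies within distance \<open>j\<close>
  of a multiple of \<open>b\<close>. So \<open>l\<close> is the residue of an integer in an open
  interval of length \<open>2 * j\<close>, which contains \<open>2 * j\<close> integers, or one less
  when \<theta> is an integer; the difference of ceiling and floor records which.\<close>

lemma card_abs_sin_less:
  assumes b: "b \<ge> 1" and j: "1 \<le> j" "2 * j \<le> b"
  shows "int (card {l. l < b \<and> \<bar>sin (pi * (\<theta> + real l) / real b)\<bar> < sin (pi * real j / real b)})
    \<le> \<lceil>- \<theta>\<rceil> - \<lfloor>- \<theta>\<rfloor> + 2 * int j - 1"
    (is "int (card ?S) \<le> _")
proof (cases "?S = {}")
  case True
  have "\<lfloor>- \<theta>\<rfloor> \<le> \<lceil>- \<theta>\<rceil>" by (rule floor_le_ceiling)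
  then show ?thesis unfolding True using j(1) by (simp only: card.empty)
next
  case False
  let ?I = "{\<lfloor>- \<theta> - real j\<rfloor> + 1 .. \<lceil>- \<theta> + real j\<rceil> - 1}"
  have sub: "?S \<subseteq> (\<lambda>p. nat (p mod int b)) ` ?I"
  proof
    fix l assume "l \<in> ?S"
    then have l: "l < b" "\<bar>sin (pi * (\<theta> + real l) / real b)\<bar> < sin (pi * real j / real b)" by auto
    have "0 \<le> pi * real j / real b" "pi * real j / real b \<le> pi / 2"
      using b j by (auto simp: field_simps)
    then obtain n :: int where n: "\<bar>pi * (\<theta> + real l) / real b - of_int n * pi\<bar> < pi * real j / real b"
      using l(2) by (rule abs_sin_less_imp_near_multiple)
    define p where "p = int l - n * int b"
    have "pi * (\<theta> + real l) / real b - of_int n * pi = (\<theta> + of_int p) * (pi / real b)"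
      using b unfolding p_def by (simp add: field_simps)
    then have "\<bar>\<theta> + of_int p\<bar> * (pi / real b) < real j * (pi / real b)"
      using n by (simp add: abs_mult mult.commute)
    then have "\<bar>\<theta> + of_int p\<bar> < real j"
      using b by (simp add: mult_less_cancel_right divide_less_cancel)
    then have "p \<in> ?I"
      by (auto simp: floor_less_iff less_ceiling_iff) linarith+
    moreover have "nat (p mod int b) = l"
    proof -
      have "p mod int b = int l mod int b" unfolding p_def by (metis mod_diff_right_eq mod_mult_self2_is_0 diff_zero)
      then show ?thesis using l(1) by simp
    qed
    ultimately show "l \<in> (\<lambda>p. nat (p mod int b)) ` ?I" by force
  qed
  have "card ?S \<le> card ((\<lambda>p. nat (p mod int b)) ` ?I)"
    by (rule card_mono[OF _ sub]) simp
  also have "\<dots> \<le> card ?I" by (rule card_image_le) simp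
  finally have "card ?S \<le> card ?I" .
  \<comment> \<open>Nonemptiness keeps the cardinality of the integer interval from being a
    truncated difference.\<close>
  moreover have "card ?I > 0"
  proof -
    have "?I \<noteq> {}" using False sub by blast
    then show ?thesis unfolding card_gt_0_iff by simp
  qed
  moreover have "\<lfloor>- \<theta> - real j\<rfloor> = \<lfloor>- \<theta>\<rfloor> - int j" "\<lceil>- \<theta> + real j\<rceil> = \<lceil>- \<theta>\<rceil> + int j"
    by linarith+
  ultimately have "int (card ?I) = \<lceil>- \<theta>\<rceil> - \<lfloor>- \<theta>\<rfloor> + 2 * int j - 1" by simp
  then show ?thesis using \<open>card ?S \<le> card ?I\<close> by linarith
qed

definition near_digits :: "nat \<Rightarrow> real \<Rightarrow> real \<Rightarrow> nat \<Rightarrow> nat \<Rightarrow> bool" where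
  "near_digits b T x k l \<longleftrightarrow>
     \<bar>sin (pi * (2 * x + real k + real l) / real b) * sin (pi * (real k - real l) / real b)\<bar> \<le> T"

lemma near_digits_sym: "near_digits b T x k l \<Longrightarrow> near_digits b T x l k"
proof -
  have "\<bar>sin (pi * (real k - real l) / real b)\<bar> = \<bar>sin (pi * (real l - real k) / real b)\<bar>"
  proof -
    have "pi * (real k - real l) / real b = - (pi * (real l - real k) / real b)"
      by (simp add: minus_divide_left[symmetric] right_diff_distrib diff_divide_distrib)
    then show ?thesis by simp
  qed
  then show "near_digits b T x k l \<Longrightarrow> near_digits b T x l k"
    unfolding near_digits_def by (simp add: abs_mult add_ac)
qed

text \<open>A product below a square has a factor below the root. The factor with
  \<open>k - l\<close> has an integer offset and admits at most \<open>2 * j - 1\<close> digits, the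
  other one at most \<open>2 * j\<close>.\<close>

lemma card_near_digits:
  assumes b: "b \<ge> 1" and j: "j \<ge> 1" "2 * j \<le> b" and k: "k < b"
    and T: "T < (sin (pi * real j / real b))\<^sup>2"
  shows "card {l. l < b \<and> near_digits b T x k l} \<le> 4 * j - 1"
proof -
  let ?s = "sin (pi * real j / real b)"
  let ?D = "{l. l < b \<and> \<bar>sin (pi * (- real k + real l) / real b)\<bar> < ?s}"
  let ?E = "{l. l < b \<and> \<bar>sin (pi * (2 * x + real k + real l) / real b)\<bar> < ?s}"
  have s0: "0 \<le> ?s" using b j by (intro sin_ge_zero) (auto simp: field_simps)
  have "{l. l < b \<and> near_digits b T x k l} \<subseteq> ?D \<union> ?E"
  proof
    fix l assume l: "l \<in> {l. l < b \<and> near_digits b T x k l}"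
    have "pi * (- real k + real l) / real b = - (pi * (real k - real l) / real b)"
      using b by (simp add: field_simps)
    then have eq: "\<bar>sin (pi * (- real k + real l) / real b)\<bar> = \<bar>sin (pi * (real k - real l) / real b)\<bar>"
      by simp
    have "\<bar>sin (pi * (2 * x + real k + real l) / real b)\<bar> * \<bar>sin (pi * (real k - real l) / real b)\<bar> < ?s * ?s"
      using l T unfolding near_digits_def power2_eq_square abs_mult by simp
    then have "\<bar>sin (pi * (2 * x + real k + real l) / real b)\<bar> < ?s \<or> \<bar>sin (pi * (real k - real l) / real b)\<bar> < ?s"
      using s0 by (meson mult_mono abs_ge_zero not_le)
    then show "l \<in> ?D \<union> ?E" using l eq by auto
  qed
  then have "card {l. l < b \<and> near_digits b T x k l} \<le> card (?D \<union> ?E)"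
    by (intro card_mono) auto
  also have "\<dots> \<le> card ?D + card ?E" by (rule card_Un_le)
  finally have "card {l. l < b \<and> near_digits b T x k l} \<le> card ?D + card ?E" .
  moreover have "int (card ?D) \<le> 2 * int j - 1"
    using card_abs_sin_less[OF b j, of "- real k"] by simp
  moreover have "int (card ?E) \<le> 2 * int j"
  proof -
    have "\<lceil>- (2 * x + real k)\<rceil> \<le> \<lfloor>- (2 * x + real k)\<rfloor> + 1" by linarith
    then show ?thesis
      using card_abs_sin_less[OF b j, of "2 * x + real k"] by linarith
  qed
  ultimately show ?thesis by linarith
qed

text \<open>Two partners would give two angles \<phi> with sines at most
  \<open>T / sin (pi / b)\<close>, although the sine of their difference is at least
  \<open>sin (pi / b)\<close>.\<close>

lemma near_digits_unique:
  assumes T: "2 * T < (sin (pi / real b))\<^sup>2" and b: "b \<ge> 2"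
    and kl: "k < b" "l < b" "l' < b" "k \<noteq> l" "k \<noteq> l'"
    and near: "near_digits b T x k l" "near_digits b T x k l'"
  shows "l = l'"
proof (rule ccontr)
  assume "l \<noteq> l'"
  let ?s = "sin (pi / real b)"
  let ?\<phi> = "\<lambda>l. pi * (2 * x + real k + real l) / real b"
  have s: "0 < ?s" using b by (rule sin_pi_div_pos)
  have bound: "\<bar>sin (?\<phi> m)\<bar> * ?s \<le> T" if "m < b" "k \<noteq> m" "near_digits b T x k m" for m
    using that sin_digit_diff_ge[OF kl(1) that(1,2)] mult_left_mono[OF _ abs_ge_zero]
    unfolding near_digits_def abs_mult by (meson order.trans)
  have "?s \<le> \<bar>sin (?\<phi> l - ?\<phi> l')\<bar>"
  proof -
    have "?\<phi> l - ?\<phi> l' = pi * (real l - real l') / real b"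
      by (simp add: diff_divide_distrib[symmetric] algebra_simps)
    then show ?thesis using sin_digit_diff_ge[OF kl(2,3) \<open>l \<noteq> l'\<close>] by simp
  qed
  also have "\<dots> \<le> \<bar>sin (?\<phi> l)\<bar> + \<bar>sin (?\<phi> l')\<bar>" by (rule abs_sin_diff_le_add)
  finally have "?s * ?s \<le> (\<bar>sin (?\<phi> l)\<bar> + \<bar>sin (?\<phi> l')\<bar>) * ?s"
    using s by (intro mult_right_mono) auto
  also have "\<dots> \<le> T + T"
    unfolding distrib_right using bound kl near by (intro add_mono) auto
  finally show False using T by (simp add: power2_eq_square)
qed

text \<open>The tolerance is exactly the slack that raises the bound
  \<open>\<gamma> / (b - \<gamma>)\<close> on the product of sines to \<open>T\<close>.\<close>

lemma tangent_digits_imp_near_digits: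
  assumes \<gamma>: "0 \<le> \<gamma>" "\<gamma> < 1" and b: "b \<ge> 1" and T: "\<gamma> / (real b - \<gamma>) < T"
    and t: "tangent_digits b \<gamma> (2 * (T - \<gamma> / (real b - \<gamma>))) x k l"
  shows "near_digits b T x k l"
proof -
  obtain \<alpha> \<beta> where "near_tangent b \<gamma> (2 * (T - \<gamma> / (real b - \<gamma>))) \<alpha> \<beta>"
    "\<alpha> 0 = pi * (2 * x + real k + real l) / real b + pi * (real k - real l) / real b"
    "\<beta> 0 = pi * (2 * x + real k + real l) / real b - pi * (real k - real l) / real b"
    using tangent_digitsE[OF t] by blast
  from near_tangent_sin_sin_le[OF \<gamma> b this] show ?thesis
    unfolding near_digits_def by simp
qed

lemma sigma_one_le_card_near_digits:
  assumes b: "b \<ge> 1" and \<gamma>: "0 \<le> \<gamma>" "\<gamma> < 1" and T: "\<gamma> / (real b - \<gamma>) < T"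
    and card: "\<And>x k. k < b \<Longrightarrow> card {l. l < b \<and> near_digits b T x k l} \<le> n"
  shows "sigma b \<gamma> psi 1 \<le> ereal (real n)"
proof (rule sigma_one_le_card[OF b \<gamma>, where \<eta> = "2 * (T - \<gamma> / (real b - \<gamma>))" and R = "near_digits b T"])
  show "Measurable.pred borel (\<lambda>x. near_digits b T x k l)" for k l
    unfolding near_digits_def by measurable
qed (use T card near_digits_sym tangent_digits_imp_near_digits[OF \<gamma> b T] in auto)

lemma sigma_one_le_2:
  assumes b: "b \<ge> 2" and \<gamma>: "0 \<le> \<gamma>" "\<gamma> < 1"
    and T: "2 * (\<gamma> / (real b - \<gamma>)) < (sin (pi / real b))\<^sup>2"
  shows "sigma b \<gamma> psi 1 \<le> 2"
proof -
  have "\<gamma> / (real b - \<gamma>) < (sin (pi / real b))\<^sup>2 / 2" using T by linarith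
  then obtain T' where T': "\<gamma> / (real b - \<gamma>) < T'" "T' < (sin (pi / real b))\<^sup>2 / 2"
    using dense by blast
  have "sigma b \<gamma> psi 1 \<le> ereal (real 2)"
  proof (rule sigma_one_le_card_near_digits[OF _ \<gamma> T'(1)])
    fix x k assume k: "k < b"
    let ?S = "{l. l < b \<and> near_digits b T' x k l} - {k}"
    have "card ?S \<le> Suc 0"
    proof (subst card_le_Suc0_iff_eq)
      have "2 * T' < (sin (pi / real b))\<^sup>2" using T' by simp
      from near_digits_unique[OF this b k]
      show "\<forall>l\<in>?S. \<forall>l'\<in>?S. l = l'" by auto
    qed auto
    moreover have "card {l. l < b \<and> near_digits b T' x k l} \<le> card (insert k ?S)"
      by (intro card_mono) auto
    moreover have "card (insert k ?S) = Suc (card ?S)" by (intro card_insert_disjoint) auto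
    ultimately show "card {l. l < b \<and> near_digits b T' x k l} \<le> 2" by linarith
  qed (use b in auto)
  then show ?thesis by simp
qed

lemma frac_gamma_le:
  assumes "real b * \<gamma> \<le> c" "c < (real b)\<^sup>2" "\<gamma> < 1" "b \<ge> 1"
  shows "\<gamma> / (real b - \<gamma>) \<le> c / ((real b)\<^sup>2 - c)"
proof -
  have pos: "0 < real b - \<gamma>" "0 < (real b)\<^sup>2 - c" using assms by linarith+
  have "real b * (real b * \<gamma>) \<le> real b * c" using assms by (intro mult_left_mono) auto
  then have "\<gamma> * ((real b)\<^sup>2 - c) \<le> c * (real b - \<gamma>)"
    by (simp add: power2_eq_square algebra_simps)
  then show ?thesis using pos by (simp add: divide_simps mult.commute)
qed

section \<open>Bases at least four with product above two\<close>

lemma sigma_one_less_count_2: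
  assumes b: "b \<ge> 4" and \<gamma>: "0 \<le> \<gamma>" "\<gamma> < 1" and t: "2 < real b * \<gamma>" "real b * \<gamma> \<le> 3"
  shows "sigma b \<gamma> psi 1 < ereal (real b * \<gamma>)"
proof -
  define B where "B = (real b)\<^sup>2"
  have B: "16 \<le> B" unfolding B_def using power_mono[of 4 "real b" 2] b by simp
  have "2 * (\<gamma> / (real b - \<gamma>)) \<le> 2 * (3 / (B - 3))"
    unfolding B_def using t \<gamma> b B by (intro mult_left_mono frac_gamma_le) (auto simp: B_def)
  also have "\<dots> < 9.8696 / B * (1 - 3.2899 / B)"
  proof -
    \<comment> \<open>After clearing denominators the difference of the two sides, expanded around
      16, the least value of \<open>B\<close>, has only positive coefficients.\<close>
    have "0 \<le> (B - 16) * (B - 16)" "0 \<le> B - 16" using B by auto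
    then have "0 < 3.8696 * ((B - 16) * (B - 16)) + 61.74840296 * (B - 16) + 94.76683848"
      by (intro add_nonneg_pos add_nonneg_nonneg mult_nonneg_nonneg) auto
    also have "\<dots> = 9.8696 * (B - 3.2899) * (B - 3) - 6 * (B * B)"
      by (simp add: field_simps)
    finally have "6 * (B * B) < 9.8696 * (B - 3.2899) * (B - 3)" by (simp only: diff_gt_0_iff_gt)
    then show ?thesis using B by (simp add: field_simps)
  qed
  also have "\<dots> \<le> (sin (pi / real b))\<^sup>2"
    unfolding B_def using b by (intro sin_pi_div_squared_ge) auto
  finally have "sigma b \<gamma> psi 1 \<le> 2"
    using b \<gamma> by (intro sigma_one_le_2) auto
  also have "2 < ereal (real b * \<gamma>)"
    using t(1) by (metis ereal_less(2) ereal_less_eq less_ereal.simps(1) numeral_eq_ereal)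
  finally show ?thesis .
qed

lemma sigma_one_less_count_3:
  assumes b: "b \<ge> 4" and \<gamma>: "0 \<le> \<gamma>" "\<gamma> < 1" and t: "3 < real b * \<gamma>" "real b * \<gamma> \<le> 7"
  shows "sigma b \<gamma> psi 1 < ereal (real b * \<gamma>)"
proof -
  define B where "B = (real b)\<^sup>2"
  \<comment> \<open>Since \<open>\<gamma> < 1\<close>, the product is also at most \<open>b\<close>;
    for the smallest bases the bound 7 alone would be too weak.\<close>
  define c where "c = min (real b) 7"
  have "real b * \<gamma> \<le> real b" using \<gamma> b by simp
  then have tc: "real b * \<gamma> \<le> c" unfolding c_def using t by simp
  have B: "16 \<le> B" unfolding B_def using power_mono[of 4 "real b" 2] b by simp
  have "real b < B" unfolding B_def using b by (simp add: power2_eq_square)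
  then have cB: "c < B" "0 < c" unfolding c_def using b by auto
  have "\<gamma> / (real b - \<gamma>) \<le> c / (B - c)"
    unfolding B_def using tc \<gamma> b cB by (intro frac_gamma_le) (auto simp: B_def)
  also have "\<dots> < 9.8696 / B * (1 - 3.2899 / B)"
  proof -
    have "c * (B * B) < 9.8696 * (B - 3.2899) * (B - c)"
    proof (cases "b \<ge> 7")
      case True
      have B49: "49 \<le> B" unfolding B_def using power_mono[of 7 "real b" 2] True by simp
      have c: "c = 7" unfolding c_def using True by simp
      have "0 \<le> (B - 49) * (B - 49)" "0 \<le> B - 49" using B49 by auto
      then have "0 < 2.8696 * ((B - 49) * (B - 49)) + 179.66360296 * (B - 49) + 2140.89692432"
        by (intro add_nonneg_pos add_nonneg_nonneg mult_nonneg_nonneg) auto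
      also have "\<dots> = 9.8696 * (B - 3.2899) * (B - 7) - 7 * (B * B)"
        by (simp add: field_simps)
      finally have "7 * (B * B) < 9.8696 * (B - 3.2899) * (B - 7)" by (simp only: diff_gt_0_iff_gt)
      with c show ?thesis by simp
    next
      case False
      then have "b = 4 \<or> b = 5 \<or> b = 6" using b by auto
      then show ?thesis unfolding B_def c_def by auto
    qed
    then show ?thesis using B cB by (simp add: field_simps)
  qed
  also have "\<dots> \<le> (sin (pi / real b))\<^sup>2"
    unfolding B_def using b by (intro sin_pi_div_squared_ge) auto
  finally obtain T where T: "\<gamma> / (real b - \<gamma>) < T" "T < (sin (pi / real b))\<^sup>2"
    using dense by blast
  have "sigma b \<gamma> psi 1 \<le> ereal (real 3)"
  proof (rule sigma_one_le_card_near_digits[OF _ \<gamma> T(1)])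
    show "card {l. l < b \<and> near_digits b T x k l} \<le> 3" if "k < b" for x k
      using card_near_digits[of b 1 k T x] that b T(2) by simp
  qed (use b in auto)
  also have "\<dots> < ereal (real b * \<gamma>)" using t(1) by simp
  finally show ?thesis .
qed

text \<open>The count \<open>4 * j - 1\<close> grows only like the square root of
  \<open>t = b * \<gamma>\<close>. For \<open>t < 14\<close> one has \<open>j <= 2\<close> and the
  count is at most 7; from 14 on, \<open>4 * sqrt (2 * t / 7) + 3 < t\<close>.\<close>

lemma sigma_one_less_count_large:
  assumes b: "b \<ge> 1" and \<gamma>: "0 \<le> \<gamma>" "\<gamma> < 1" and t: "7 < real b * \<gamma>"
  shows "sigma b \<gamma> psi 1 < ereal (real b * \<gamma>)"
proof -
  define t where "t = real b * \<gamma>"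
  define B where "B = (real b)\<^sup>2"
  \<comment> \<open>From \<open>t < B / 8\<close> follows
    \<open>t / (B - t) < 8 * t / (7 * B)\<close>. The integer \<open>j\<close> just above
    \<open>sqrt (2 * t / 7)\<close> makes \<open>(2 * j / b)\<^sup>2\<close> exceed this
    \<open>T\<close>, and \<open>2 * j / b\<close> bounds \<open>sin (pi * j / b)\<close> from
    below.\<close>
  define T where "T = 8 * t / (7 * B)"
  define j where "j = nat \<lfloor>sqrt (2 * t / 7)\<rfloor> + 1"
  have t7: "7 < t" using t unfolding t_def .
  have tb: "t < real b" unfolding t_def using \<gamma> b by simp
  have "7 < real b" using tb t7 by linarith
  then have b8: "8 \<le> real b" by simp
  have B8: "8 * real b \<le> B" unfolding B_def using b8 by (simp add: power2_eq_square)
  have tB: "t < B / 8" using tb B8 by linarith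
  have "\<gamma> / (real b - \<gamma>) \<le> t / (B - t)"
    unfolding B_def using \<gamma> b tB t7 by (intro frac_gamma_le) (simp_all flip: t_def B_def)
  also have "\<dots> < T"
  proof -
    have "t * (7 * B) < 8 * t * (B - t)"
      using mult_strict_left_mono[OF tB, of t] t7 by (simp add: algebra_simps)
    then show ?thesis unfolding T_def using tB t7 by (simp add: divide_simps mult.commute)
  qed
  finally have T: "\<gamma> / (real b - \<gamma>) < T" .
  have sq: "0 \<le> sqrt (2 * t / 7)" "(sqrt (2 * t / 7))\<^sup>2 = 2 * t / 7" using t7 by auto
  have "real j = of_int \<lfloor>sqrt (2 * t / 7)\<rfloor> + 1" unfolding j_def using sq(1) by simp
  then have j: "sqrt (2 * t / 7) < real j" "real j \<le> sqrt (2 * t / 7) + 1"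
    using of_int_floor_le[of "sqrt (2 * t / 7)"] real_of_int_floor_add_one_gt[of "sqrt (2 * t / 7)"] by linarith+
  \<comment> \<open>With \<open>j / b <= 0.46\<close> the cubic Taylor bound gives
    \<open>sin y >= 0.65 * y\<close>, and \<open>0.65 * pi > 2\<close> turns this into the chord
    bound \<open>2 * j / b\<close>.\<close>
  have "sqrt (2 * t / 7) \<le> 0.46 * real b - 1"
  proof (rule real_le_lsqrt)
    have "0 \<le> (real b - 8) * (real b - 8)" "0 \<le> real b - 8" using b8 by auto
    then show "2 * t / 7 \<le> (0.46 * real b - 1)\<^sup>2"
      using tb by (simp add: power2_eq_square algebra_simps)
  qed (use t7 b8 in auto)
  then have jb: "real j \<le> 0.46 * real b" using j(2) by linarith
  have "T < (sin (pi * real j / real b))\<^sup>2"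
  proof -
    define y where "y = pi * real j / real b"
    have "real j / real b \<le> 0.46" using jb b8 by (simp add: field_simps)
    then have y: "0 \<le> y" "y \<le> 0.46 * pi" unfolding y_def
      using mult_left_mono[of "real j / real b" "0.46" pi] by auto
    have "y\<^sup>2 \<le> (0.46 * pi)\<^sup>2" using y by (intro power_mono)
    also have "\<dots> \<le> 2.1" using pi_squared_bounds by (simp add: power_mult_distrib power2_eq_square)
    finally have y2: "0.65 \<le> 1 - y\<^sup>2 / 6" by simp
    have "2 * (real j / real b) \<le> 0.65 * pi * (real j / real b)"
      using pi_approx by (intro mult_right_mono) auto
    then have "2 * real j / real b \<le> 0.65 * y" unfolding y_def by simp
    also have "\<dots> \<le> y * (1 - y\<^sup>2 / 6)" using mult_left_mono[OF y2 y(1)] by (simp add: mult.commute)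
    also have "\<dots> = y - y ^ 3 / 6" by (simp add: power2_eq_square power3_eq_cube algebra_simps)
    also have "\<dots> \<le> sin y" using y(1) by (rule sin_ge_cubic)
    finally have "(2 * real j / real b)\<^sup>2 \<le> (sin y)\<^sup>2" using b8 by (intro power_mono) auto
    moreover have "T < (2 * real j / real b)\<^sup>2"
    proof -
      have "2 * t / 7 < (real j)\<^sup>2" using power_strict_mono[OF j(1) sq(1), of 2] sq(2) by simp
      then have "8 * t / 7 / B < 4 * (real j)\<^sup>2 / B" using tB t7 by (intro divide_strict_right_mono) auto
      then show ?thesis unfolding T_def by (simp add: B_def power_mult_distrib power_divide)
    qed
    ultimately show ?thesis unfolding y_def by linarith
  qed
  then have "card {l. l < b \<and> near_digits b T x k l} \<le> 4 * j - 1" if "k < b" for x k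
    using b that jb unfolding j_def[symmetric] by (intro card_near_digits) (auto simp: j_def)
  then have "sigma b \<gamma> psi 1 \<le> ereal (real (4 * j - 1))"
    using b by (intro sigma_one_le_card_near_digits[OF _ \<gamma> T]) auto
  also have "real (4 * j - 1) < t"
  proof (cases "t < 14")
    case True
    have "sqrt (2 * t / 7) < 2" by (rule real_less_lsqrt) (use True t7 in auto)
    then have "j \<le> 2" unfolding j_def by (simp add: nat_le_iff floor_le_iff; linarith)
    then show ?thesis using t7 by linarith
  next
    case False
    have "4 * sqrt (2 * t / 7) < t - 3"
    proof (rule power2_less_imp_less)
      have "0 \<le> (t - 14) * (t - 14)" "0 \<le> t - 14" using False by auto
      then have "16 * (2 * t / 7) < (t - 3)\<^sup>2" by (simp add: power2_eq_square algebra_simps)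
      then show "(4 * sqrt (2 * t / 7))\<^sup>2 < (t - 3)\<^sup>2" using sq(2) by (simp add: power_mult_distrib)
    qed (use False in auto)
    moreover have "real (4 * j - 1) = 4 * real j - 1" unfolding j_def by simp
    ultimately show ?thesis using j(2) by linarith
  qed
  finally show ?thesis unfolding t_def by simp
qed

section \<open>Small products: no tangent pairs\<close>

lemma sigma_one_less_transversal:
  assumes b: "b \<ge> 2" and \<gamma>: "1 / real b < \<gamma>" "\<gamma> < 1" and conf: "confined b \<gamma> (- 1)"
  shows "sigma b \<gamma> psi 1 < ereal (real b * \<gamma>)"
proof -
  have \<gamma>0: "0 \<le> \<gamma>" using \<gamma>(1) zero_le_divide_1_iff[of "real b"] by linarith
  have "sigma b \<gamma> psi 1 \<le> 1" using sigma_one_le_transversal[OF _ \<gamma>0 \<gamma>(2) conf] b by simp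
  also have "1 < ereal (real b * \<gamma>)" using \<gamma> b by (simp add: field_simps one_ereal_def)
  finally show ?thesis .
qed

text \<open>Here \<open>\<gamma> / (1 - \<gamma>)\<close> is at most \<open>2 / (b - 2)\<close>, to
  be compared with \<open>sin (pi / b)\<close>, which is close to \<open>pi / b\<close>. At
  \<open>b = 7\<close> the inequality \<open>2 / (b - 2) <= 2.8 / b\<close> begins to hold.\<close>

lemma sigma_one_less_small_product:
  assumes b: "b \<ge> 7" and \<gamma>: "1 / real b < \<gamma>" "\<gamma> < 1" and t: "real b * \<gamma> \<le> 2"
  shows "sigma b \<gamma> psi 1 < ereal (real b * \<gamma>)"
proof (rule sigma_one_less_transversal[OF _ \<gamma>])
  have \<gamma>0: "0 \<le> \<gamma>" using \<gamma>(1) zero_le_divide_1_iff[of "real b"] by linarith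
  define y where "y = pi / real b"
  have b7: "7 \<le> real b" using b by simp
  have y: "0 \<le> y" "y \<le> 0.449" unfolding y_def using pi_approx b7 by (auto simp: divide_simps)
  have "\<gamma> \<le> 2 / real b" using t b by (simp add: field_simps)
  then have "\<gamma> / (1 - \<gamma>) \<le> (2 / real b) / (1 - 2 / real b)"
  proof (intro frac_le)
    show "1 - 2 / real b \<le> 1 - \<gamma>" using \<open>\<gamma> \<le> 2 / real b\<close> by linarith
  qed (use \<open>\<gamma> \<le> 2 / real b\<close> b7 in \<open>auto simp: divide_simps\<close>)
  also have "\<dots> = 2 / (real b - 2)" using b7 by (simp add: divide_simps)
  also have "\<dots> \<le> 2.8 / real b" using b7 by (simp add: divide_simps)
  also have "\<dots> < 0.96 * y" unfolding y_def using pi_approx b7 by (simp add: divide_simps)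
  also have "\<dots> \<le> y * (1 - y\<^sup>2 / 6)"
  proof -
    have "y\<^sup>2 \<le> 0.449\<^sup>2" using y by (intro power_mono)
    then have "0.96 \<le> 1 - y\<^sup>2 / 6" by (simp add: power2_eq_square)
    from mult_left_mono[OF this y(1)] show ?thesis by (simp add: mult.commute)
  qed
  also have "\<dots> = y - y ^ 3 / 6" by (simp add: power2_eq_square power3_eq_cube algebra_simps)
  also have "\<dots> \<le> sin y" using y(1) by (rule sin_ge_cubic)
  finally show "confined b \<gamma> (- 1)"
    using b \<gamma>0 \<gamma> unfolding y_def by (intro confined_transversal) auto
qed (use b in auto)

section \<open>Confinement and weights for bases three to six\<close>

lemma confinedI_near_tangent:
  assumes \<eta>: "\<eta> > 0" and b: "b \<ge> 2"
    and main: "\<And>\<alpha> \<beta> \<phi> \<mu>. back_orbit b \<alpha> \<Longrightarrow> back_orbit b \<beta> \<Longrightarrow> near_tangent b \<gamma> \<eta> \<alpha> \<beta> \<Longrightarrow>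
      \<alpha> 0 = \<phi> + \<mu> \<Longrightarrow> \<beta> 0 = \<phi> - \<mu> \<Longrightarrow> sin (pi / real b) \<le> \<bar>sin \<mu>\<bar> \<Longrightarrow> \<bar>sin \<phi>\<bar> \<le> s0"
  shows "confined b \<gamma> s0"
  unfolding confined_def
proof (intro exI[of _ \<eta>] conjI ballI allI impI)
  fix x k l assume kl: "k < b" "l < b" "k \<noteq> l" and t: "tangent_digits b \<gamma> \<eta> x k l"
  from tangent_digitsE[OF t] main[OF _ _ _ _ _ sin_digit_diff_ge[OF kl]]
  show "\<bar>sin (pi * (2 * x + real k + real l) / real b)\<bar> \<le> s0" by metis
qed (rule \<eta>)

lemma near_tangent_sin_phi_le:
  assumes \<gamma>: "0 \<le> \<gamma>" "\<gamma> < 1" and b: "b \<ge> 1" and nt: "near_tangent b \<gamma> \<eta> \<alpha> \<beta>"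
    and start: "\<alpha> 0 = \<phi> + \<mu>" "\<beta> 0 = \<phi> - \<mu>"
    and le: "\<gamma> \<le> \<gamma>0" "\<gamma>0 < 1" and s1: "0 < s1" "s1 \<le> \<bar>sin \<mu>\<bar>"
    and bound: "2 * \<gamma>0 / (real b - \<gamma>0) + \<eta> \<le> 2 * (s1 * c)"
  shows "\<bar>sin \<phi>\<bar> \<le> c"
proof -
  have "2 * (s1 * \<bar>sin \<phi>\<bar>) \<le> 2 * \<bar>sin \<phi> * sin \<mu>\<bar>"
    using mult_right_mono[OF s1(2) abs_ge_zero[of "sin \<phi>"]] by (simp add: abs_mult mult.commute)
  also have "\<dots> \<le> 2 * \<gamma> / (real b - \<gamma>) + \<eta>"
    by (rule near_tangent_sin_sin_le[OF \<gamma> b nt start])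
  also have "2 * \<gamma> / (real b - \<gamma>) \<le> 2 * \<gamma>0 / (real b - \<gamma>0)"
    using le \<gamma> b by (intro frac_le) auto
  finally have "s1 * \<bar>sin \<phi>\<bar> \<le> s1 * c" using bound by linarith
  then show ?thesis using s1(1) by simp
qed

text \<open>A bootstrap between the two sums. The crude bound \<open>c\<close> for
  \<open>\<bar>sin \<phi>\<bar>\<close> makes \<open>\<bar>cos \<phi>\<bar>\<close> at least
  \<open>C\<close>; the sine sum can cancel such a first term only if the second sine difference is
  at least \<open>Y0\<close>; the chord bound then limits the second cosine difference to
  \<open>X0\<close>, and the cosine sum returns the finer bound \<open>s0\<close>.\<close>

lemma confined_first_step:
  fixes s1 s0 c C X0 Y0 :: real
  assumes b: "b \<ge> 2" and \<gamma>: "0 \<le> \<gamma>" "\<gamma> \<le> \<gamma>0" "\<gamma>0 < 1" and s1: "0 < s1" "s1 \<le> sin (pi / real b)" and \<eta>: "\<eta> > 0"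
    and crude: "2 * \<gamma>0 / (real b - \<gamma>0) + \<eta> \<le> 2 * (s1 * c)" "c\<^sup>2 + C\<^sup>2 \<le> 1"
    and Y0: "0 \<le> Y0" "\<gamma>0 * (Y0 + \<gamma>0 * (2 / (1 - \<gamma>0))) + \<eta> < 2 * (s1 * C)"
    and X0: "0 \<le> X0" "4 \<le> X0\<^sup>2 + Y0\<^sup>2"
    and fine: "g0 = \<gamma>0 / real b" "g0 * (X0 + g0 * (2 / (1 - g0))) + \<eta> \<le> 2 * (s1 * s0)"
  shows "confined b \<gamma> s0"
proof (rule confinedI_near_tangent[OF \<eta> b])
  fix \<alpha> \<beta> \<phi> \<mu>
  assume nt: "near_tangent b \<gamma> \<eta> \<alpha> \<beta>" and start: "\<alpha> 0 = \<phi> + \<mu>" "\<beta> 0 = \<phi> - \<mu>"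
    and \<mu>: "sin (pi / real b) \<le> \<bar>sin \<mu>\<bar>"
  have \<gamma>1: "\<gamma> < 1" and b1: "1 \<le> b" using \<gamma> b by auto
  have s1\<mu>: "s1 \<le> \<bar>sin \<mu>\<bar>" using s1 \<mu> by linarith
  obtain X Y where XY: "0 \<le> X" "0 \<le> Y" "X\<^sup>2 + Y\<^sup>2 \<le> 4"
    and X: "2 * \<bar>sin \<phi> * sin \<mu>\<bar> \<le> \<gamma> / real b * (X + \<gamma> / real b * (2 / (1 - \<gamma> / real b))) + \<eta>"
    and Y: "2 * \<bar>cos \<phi> * sin \<mu>\<bar> \<le> \<gamma> * (Y + \<gamma> * (2 / (1 - \<gamma>))) + \<eta>"
    using near_tangent_first_step[OF \<gamma>(1) \<gamma>1 b1 nt start] by blast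
  have mono: "r * (Z + r * (2 / (1 - r))) \<le> r0 * (Z + r0 * (2 / (1 - r0)))"
    if "0 \<le> r" "r \<le> r0" "r0 < 1" "0 \<le> Z" for r r0 Z :: real
    using that by (intro mult_mono add_mono frac_le) (auto intro!: divide_nonneg_nonneg mult_nonneg_nonneg add_nonneg_nonneg)
  have low: "2 * (s1 * \<bar>z\<bar>) \<le> 2 * \<bar>z * sin \<mu>\<bar>" for z
    using mult_right_mono[OF s1\<mu> abs_ge_zero[of z]] by (simp add: abs_mult mult.commute)
  have "\<bar>sin \<phi>\<bar> \<le> c"
    by (rule near_tangent_sin_phi_le[OF \<gamma>(1) \<gamma>1 b1 nt start \<gamma>(2,3) s1(1) s1\<mu> crude(1)])
  then have "(sin \<phi>)\<^sup>2 \<le> c\<^sup>2" by (metis abs_ge_zero power2_abs power_mono)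
  then have "C\<^sup>2 \<le> (cos \<phi>)\<^sup>2" using crude(2) sin_cos_squared_add[of \<phi>] by linarith
  then have C: "C \<le> \<bar>cos \<phi>\<bar>" by (metis abs_ge_zero power2_abs power2_le_imp_le)
  have "Y0 \<le> Y"
  proof (rule ccontr)
    assume "\<not> Y0 \<le> Y"
    then have "\<gamma>0 * (Y + \<gamma>0 * (2 / (1 - \<gamma>0))) \<le> \<gamma>0 * (Y0 + \<gamma>0 * (2 / (1 - \<gamma>0)))"
      using \<gamma> by (intro mult_left_mono) auto
    moreover have "2 * (s1 * C) \<le> 2 * (s1 * \<bar>cos \<phi>\<bar>)" using C s1(1) by simp
    ultimately show False
      using Y low[of "cos \<phi>"] mono[OF \<gamma> XY(2)] Y0(2) \<eta> by argo
  qed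
  then have "Y0\<^sup>2 \<le> Y\<^sup>2" using Y0(1) by (intro power_mono)
  then have "X\<^sup>2 \<le> X0\<^sup>2" using XY(3) X0(2) by linarith
  then have "X \<le> X0" using X0(1) by (rule power2_le_imp_le)
  have g0: "\<gamma> / real b \<le> g0" "g0 < 1" "0 \<le> g0" using \<gamma> b unfolding fine(1) by (auto simp: divide_simps)
  have "g0 * (X + g0 * (2 / (1 - g0))) \<le> g0 * (X0 + g0 * (2 / (1 - g0)))"
    using g0 \<open>X \<le> X0\<close> by (intro mult_left_mono) auto
  then have "2 * (s1 * \<bar>sin \<phi>\<bar>) \<le> 2 * (s1 * s0)"
    using X low[of "sin \<phi>"] mono[of "\<gamma> / real b" g0 X] g0 XY(1) fine(2) \<gamma>(1) by auto
  then show "\<bar>sin \<phi>\<bar> \<le> s0" using s1(1) by simp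
qed

lemma abs_sin_mult_le: "\<bar>sin (real n * x)\<bar> \<le> real n * \<bar>sin x\<bar>"
proof (induction n)
  case (Suc n)
  have "\<bar>sin (real n * x) * cos x\<bar> \<le> (real n * \<bar>sin x\<bar>) * 1" "\<bar>cos (real n * x) * sin x\<bar> \<le> 1 * \<bar>sin x\<bar>"
    unfolding abs_mult using Suc by (intro mult_mono; simp)+
  moreover have "sin (real (Suc n) * x) = sin (real n * x) * cos x + cos (real n * x) * sin x"
    by (simp add: distrib_right add.commute[of x] sin_add)
  ultimately show ?case by (simp add: distrib_right)
qed simp

lemma abs_sin_add_int_pi: "\<bar>sin (x + of_int n * pi)\<bar> = \<bar>sin x\<bar>"
proof -
  have "sin (of_int n * pi) = 0" "\<bar>cos (of_int n * pi)\<bar> = 1"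
    by (auto simp: mult.commute[of _ pi])
  then show ?thesis by (simp add: sin_add abs_mult)
qed

text \<open>Writing \<open>\<phi> = pi (2 x + k + l) / b\<close> and \<open>\<mu> = pi (k - l) / b\<close>, the angles of the two children are
  \<open>\<phi> + \<mu>\<close> and \<open>\<phi> - \<mu>\<close>, and \<open>b \<phi>\<close> is the angle of \<open>x\<close> modulo \<open>pi\<close>.\<close>
lemma digit_angle_relations:
  assumes "b \<ge> 1"
  defines "\<phi> \<equiv> \<lambda>x k l. pi * (2 * x + real k + real l) / real b"
  shows "\<bar>sin (2 * pi * x)\<bar> = \<bar>sin (real b * \<phi> x k l)\<bar>"
    "2 * pi * ((x + real k) / real b) = \<phi> x k l + pi * (real k - real l) / real b"
    "2 * pi * ((x + real l) / real b) = \<phi> x k l - pi * (real k - real l) / real b"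
proof -
  have "real b * \<phi> x k l = 2 * pi * x + of_int (int k + int l) * pi"
    using assms(1) unfolding \<phi>_def by (simp add: field_simps)
  then show "\<bar>sin (2 * pi * x)\<bar> = \<bar>sin (real b * \<phi> x k l)\<bar>"
    by (simp only: abs_sin_add_int_pi)
qed (auto simp: \<phi>_def algebra_simps add_divide_distrib diff_divide_distrib)

lemma confined_partner_unique:
  assumes s0: "2 * s0 < sin (pi / real b)" and l: "l < b" "l' < b"
    and "\<bar>sin (pi * (2 * x + real k + real l) / real b)\<bar> \<le> s0"
    and "\<bar>sin (pi * (2 * x + real k + real l') / real b)\<bar> \<le> s0"
  shows "l = l'"
proof (rule ccontr)
  let ?\<phi> = "\<lambda>l. pi * (2 * x + real k + real l) / real b"
  assume "l \<noteq> l'"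
  have "?\<phi> l - ?\<phi> l' = pi * (real l - real l') / real b"
    by (simp add: diff_divide_distrib[symmetric] algebra_simps)
  then have "sin (pi / real b) \<le> \<bar>sin (?\<phi> l - ?\<phi> l')\<bar>"
    using sin_digit_diff_ge[OF l \<open>l \<noteq> l'\<close>] by simp
  then show False using abs_sin_diff_le_add[of "?\<phi> l" "?\<phi> l'"] assms by linarith
qed

lemma two_valued_weight_measurable:
  "(\<lambda>x::real. if \<bar>sin (2 * pi * x)\<bar> < \<kappa> then 0 else 1::nat) \<in> measurable borel (count_space UNIV)"
  by measurable

text \<open>The exponent \<tau> is 0 near the real axis of the circle and 1 elsewhere. A point with
  a tangent pair has \<tau> = 0 by \<open>expand\<close>, and at least one of its two children has
  \<tau> = 1. The worst case is therefore \<open>(\<rho> - 1) * (\<rho>\<^sup>2 - 1) >= 1\<close>,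
  with equality at the golden ratio.\<close>

lemma sigma_one_le_golden:
  assumes b: "b \<ge> 2" and \<gamma>: "0 \<le> \<gamma>" "\<gamma> < 1" and conf: "confined b \<gamma> s0"
    and s0: "0 \<le> s0" "2 * s0 < sin (pi / real b)" "sin (pi / real b) \<le> 1 - s0\<^sup>2"
    and expand: "\<And>\<phi>. \<bar>sin \<phi>\<bar> \<le> s0 \<Longrightarrow> \<bar>sin (real b * \<phi>)\<bar> < sin (pi / real b)"
  shows "sigma b \<gamma> psi 1 \<le> ereal 1.6181"
proof -
  define \<kappa> where "\<kappa> = sin (pi / real b)"
  define \<tau> where "\<tau> x = (if \<bar>sin (2 * pi * x)\<bar> < \<kappa> then 0 else 1 :: nat)" for x
  have b1: "b \<ge> 1" using b by simp
  have \<kappa>0: "0 < \<kappa>" unfolding \<kappa>_def by (rule sin_pi_div_pos[OF b])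
  have far: "\<kappa> \<le> \<bar>sin (\<phi> + \<mu>)\<bar> \<or> \<kappa> \<le> \<bar>sin (\<phi> - \<mu>)\<bar>"
    if \<phi>: "\<bar>sin \<phi>\<bar> \<le> s0" and \<mu>: "\<kappa> \<le> \<bar>sin \<mu>\<bar>" for \<phi> \<mu>
  proof -
    \<comment> \<open>The larger of \<open>\<bar>A + B\<bar>\<close> and
      \<open>\<bar>A - B\<bar>\<close> is \<open>\<bar>A\<bar> + \<bar>B\<bar>\<close>.\<close>
    have "\<bar>sin \<phi>\<bar> * \<bar>cos \<mu>\<bar> + \<bar>cos \<phi>\<bar> * \<bar>sin \<mu>\<bar> \<le> max \<bar>sin (\<phi> + \<mu>)\<bar> \<bar>sin (\<phi> - \<mu>)\<bar>"
      unfolding sin_add sin_diff abs_mult[symmetric] by linarith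
    moreover have "\<kappa> \<le> \<bar>sin \<phi>\<bar> * \<bar>cos \<mu>\<bar> + \<bar>cos \<phi>\<bar> * \<bar>sin \<mu>\<bar>"
    proof -
      have sq: "(sin \<phi>)\<^sup>2 \<le> s0\<^sup>2" using power_mono[OF \<phi>, of 2] by simp
      have cos_sq: "\<bar>cos \<phi>\<bar> * \<bar>cos \<phi>\<bar> = 1 - (sin \<phi>)\<^sup>2"
        by (simp add: cos_squared_eq flip: power2_eq_square)
      have cos\<phi>: "1 - (sin \<phi>)\<^sup>2 \<le> \<bar>cos \<phi>\<bar>"
        using mult_left_mono[of "\<bar>cos \<phi>\<bar>" 1 "\<bar>cos \<phi>\<bar>"] unfolding cos_sq by simp
      show ?thesis
      \<comment> \<open>In the first case the cosine term makes up for the loss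
        \<open>(sin \<phi>)\<^sup>2 * \<bar>sin \<mu>\<bar>\<close>. In the second one,
        \<open>\<bar>sin \<mu>\<bar> >= \<bar>cos \<phi>\<bar>\<close>, so the product alone is at
        least \<open>(cos \<phi>)\<^sup>2\<close>.\<close>
      proof (cases "\<bar>sin \<phi>\<bar> \<le> \<bar>cos \<mu>\<bar>")
        case True
        have "(sin \<phi>)\<^sup>2 * \<bar>sin \<mu>\<bar> \<le> (sin \<phi>)\<^sup>2 * 1" by (intro mult_left_mono) auto
        also have "\<dots> \<le> \<bar>sin \<phi>\<bar> * \<bar>cos \<mu>\<bar>"
          using mult_left_mono[OF True, of "\<bar>sin \<phi>\<bar>"] by (simp add: power2_eq_square)
        finally have "(sin \<phi>)\<^sup>2 * \<bar>sin \<mu>\<bar> \<le> \<bar>sin \<phi>\<bar> * \<bar>cos \<mu>\<bar>" .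
        moreover have "(1 - (sin \<phi>)\<^sup>2) * \<bar>sin \<mu>\<bar> \<le> \<bar>cos \<phi>\<bar> * \<bar>sin \<mu>\<bar>"
          using cos\<phi> by (intro mult_right_mono) auto
        ultimately show ?thesis using \<mu> by (simp add: left_diff_distrib)
      next
        case False
        then have "\<bar>cos \<mu>\<bar>\<^sup>2 \<le> \<bar>sin \<phi>\<bar>\<^sup>2" by (intro power_mono) auto
        then have "(cos \<mu>)\<^sup>2 \<le> (sin \<phi>)\<^sup>2" by simp
        then have "(cos \<phi>)\<^sup>2 \<le> (sin \<mu>)\<^sup>2"
          using sin_cos_squared_add[of \<phi>] sin_cos_squared_add[of \<mu>] by linarith
        then have "\<bar>cos \<phi>\<bar> \<le> \<bar>sin \<mu>\<bar>" by (simp add: abs_le_square_iff)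
        then have "\<bar>cos \<phi>\<bar> * \<bar>cos \<phi>\<bar> \<le> \<bar>cos \<phi>\<bar> * \<bar>sin \<mu>\<bar>" by (intro mult_left_mono) auto
        moreover have "0 \<le> \<bar>sin \<phi>\<bar> * \<bar>cos \<mu>\<bar>" by simp
        ultimately show ?thesis using sq s0(3) unfolding \<kappa>_def cos_sq by linarith
      qed
    qed
    ultimately show ?thesis by linarith
  qed
  show ?thesis
  proof (rule sigma_one_le_matching[OF b1 \<gamma> conf, where \<tau> = \<tau> and N = 1])
    show "\<tau> \<in> measurable borel (count_space UNIV)"
      unfolding \<tau>_def using two_valued_weight_measurable .
    fix x :: real and k l assume kl: "k < b" "l < b" "k \<noteq> l"
      and small: "\<bar>sin (pi * (2 * x + real k + real l) / real b)\<bar> \<le> s0"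
    have "\<tau> x = 0"
      using expand[OF small] digit_angle_relations(1)[OF b1, of x k l] unfolding \<tau>_def \<kappa>_def by simp
    moreover have "\<tau> ((x + real k) / real b) = 1 \<or> \<tau> ((x + real l) / real b) = 1"
      using far[OF small, of "pi * (real k - real l) / real b"] sin_digit_diff_ge[OF kl]
      unfolding \<tau>_def \<kappa>_def digit_angle_relations(2)[OF b1, of x k l, symmetric]
        digit_angle_relations(3)[OF b1, of x l k, symmetric] by auto
    moreover have "\<tau> y = 0 \<or> \<tau> y = 1" for y unfolding \<tau>_def by simp
    ultimately have "\<tau> x = 0" "\<tau> ((x + real k) / real b) = 1 \<and> \<tau> ((x + real l) / real b) = 1 \<or>
        \<tau> ((x + real k) / real b) = 1 \<and> \<tau> ((x + real l) / real b) = 0 \<or>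
        \<tau> ((x + real k) / real b) = 0 \<and> \<tau> ((x + real l) / real b) = 1"
      by blast+
    then show "\<tau> x = 0 \<and> 1 \<le> (1.6181 ^ Suc (\<tau> ((x + real k) / real b)) - 1) *
        (1.6181 ^ Suc (\<tau> ((x + real l) / real b)) - (1::real))"
      by (elim disjE conjE) (simp_all add: power2_eq_square)
  next
    fix x k l l' assume "l < b" "l' < b" "\<bar>sin (pi * (2 * x + real k + real l) / real b)\<bar> \<le> s0"
      "\<bar>sin (pi * (2 * x + real k + real l') / real b)\<bar> \<le> s0"
    then show "l = l'" by (rule confined_partner_unique[OF s0(2)])
  qed (auto simp: \<tau>_def)
qed

lemma sin_pi_div_ge:
  assumes "b \<ge> 2" "0 \<le> s" "s\<^sup>2 \<le> 9.8696 / (real b)\<^sup>2 * (1 - 3.2899 / (real b)\<^sup>2)"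
  shows "s \<le> sin (pi / real b)"
proof (rule power2_le_imp_le)
  show "s\<^sup>2 \<le> (sin (pi / real b))\<^sup>2" using sin_pi_div_squared_ge[OF assms(1)] assms(3) by linarith
qed (use sin_pi_div_pos[OF assms(1)] in simp)

lemma sin_pi_div_5_ge: "0.585 \<le> sin (pi / 5)"
  using sin_pi_div_ge[of 5 "0.585"] by (simp add: power2_eq_square)

lemma sqrt_2_bounds: "1.4142 \<le> sqrt 2" "sqrt 2 \<le> 1.41422"
  by (rule real_le_rsqrt real_le_lsqrt; simp add: power2_eq_square)+

lemma sqrt_3_bounds: "1.73205 \<le> sqrt 3" "sqrt 3 \<le> 1.73206"
  by (rule real_le_rsqrt real_le_lsqrt; simp add: power2_eq_square)+

section \<open>Bases four, five and six\<close>

lemma sigma_one_less_base_4: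
  assumes \<gamma>: "1 / 4 < \<gamma>" "\<gamma> \<le> 1 / 2"
  shows "sigma 4 \<gamma> psi 1 < ereal (real 4 * \<gamma>)"
proof (cases "\<gamma> \<le> 0.407")
  case True
  have "\<gamma> / (1 - \<gamma>) \<le> 0.407 / (1 - 0.407)" using True \<gamma> by (intro frac_le) auto
  also have "\<dots> < sin (pi / real 4)" using sqrt_2_bounds by (simp add: sin_45)
  finally show ?thesis
    using \<gamma> True by (intro sigma_one_less_transversal confined_transversal) auto
next
  case False
  have s1: "0.7071 \<le> sin (pi / real 4)" "sin (pi / real 4) \<le> 0.70711"
    using sqrt_2_bounds by (auto simp: sin_45)
  \<comment> \<open>The parameters result one after the other from the hypotheses of the bootstrap
    at the largest \<gamma>, here 1/2, each rounded to the safe side.\<close>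
  have "confined 4 \<gamma> 0.19"
    by (rule confined_first_step[where ?\<gamma>0.0 = "1/2" and ?s1.0 = "0.7071" and \<eta> = "1/10000" and c = "0.2022"
          and C = "0.979" and ?Y0.0 = "0.768" and ?X0.0 = "1.847" and ?g0.0 = "1/8"])
      (use \<gamma> s1 in \<open>auto simp: power2_eq_square\<close>)
  then have "sigma 4 \<gamma> psi 1 \<le> ereal 1.6181"
  proof (rule sigma_one_le_golden[rotated 3])
    show "2 * 0.19 < sin (pi / real 4)" "sin (pi / real 4) \<le> 1 - 0.19\<^sup>2"
      using s1 by (auto simp: power2_eq_square)
    fix \<phi> :: real assume "\<bar>sin \<phi>\<bar> \<le> 0.19"
    then have "\<bar>sin \<phi>\<bar>\<^sup>2 \<le> 0.19\<^sup>2" by (intro power_mono) auto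
    then have w: "(sin \<phi>)\<^sup>2 \<le> 0.0361" by (simp add: power2_eq_square)
    \<comment> \<open>The linear bound \<open>4 * \<bar>sin \<phi>\<bar>\<close> would only give
      0.76, more than \<open>sin (pi / 4)\<close>; applying the double angle formula twice is
      sharper.\<close>
    define z where "z = (sin (2 * \<phi>))\<^sup>2"
    have "z = 4 * ((sin \<phi>)\<^sup>2 * (cos \<phi>)\<^sup>2)" unfolding z_def sin_double by (simp add: power2_eq_square)
    also have "\<dots> \<le> 4 * ((sin \<phi>)\<^sup>2 * 1)" by (intro mult_left_mono) (auto simp: abs_square_le_1)
    finally have z: "z \<le> 0.1444" using w by simp
    have "(sin (real 4 * \<phi>))\<^sup>2 = (sin (2 * (2 * \<phi>)))\<^sup>2" by simp
    also have "\<dots> = 4 * (z * (1 - z))"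
      unfolding sin_double[of "2 * \<phi>"] z_def by (simp add: power_mult_distrib cos_squared_eq)
    also have "\<dots> < 0.7071\<^sup>2"
    proof -
      have "0 \<le> (0.1444 - z) * (0.8556 - z)" using z by (intro mult_nonneg_nonneg) auto
      also have "\<dots> = 0.12354864 - z * (1 - z)" by (simp add: field_simps)
      finally show ?thesis by (simp add: power2_eq_square)
    qed
    finally have "\<bar>sin (real 4 * \<phi>)\<bar> < 0.7071"
      by (intro power2_less_imp_less[of "\<bar>sin (real 4 * \<phi>)\<bar>"]) auto
    then show "\<bar>sin (real 4 * \<phi>)\<bar> < sin (pi / real 4)" using s1 by linarith
  qed (use \<gamma> in auto)
  also have "\<dots> < ereal (real 4 * \<gamma>)" using False by simp
  finally show ?thesis .
qed

lemma sigma_one_less_base_5: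
  assumes \<gamma>: "1 / 5 < \<gamma>" "\<gamma> \<le> 2 / 5"
  shows "sigma 5 \<gamma> psi 1 < ereal (real 5 * \<gamma>)"
proof (cases "\<gamma> \<le> 0.325")
  case True
  have "\<gamma> / (1 - \<gamma>) \<le> 0.325 / (1 - 0.325)" using True \<gamma> by (intro frac_le) auto
  also have "\<dots> < sin (pi / real 5)" using sin_pi_div_5_ge by simp
  finally show ?thesis
    using \<gamma> True by (intro sigma_one_less_transversal confined_transversal) auto
next
  case False
  have s1: "0.585 \<le> sin (pi / real 5)" using sin_pi_div_5_ge by simp
  have "sin (pi / real 5) \<le> pi / real 5" by (rule sin_x_le_x) simp
  then have s2: "sin (pi / real 5) \<le> 0.64" using pi_approx by simp
  have "confined 5 \<gamma> 0.11"
    by (rule confined_first_step[where ?\<gamma>0.0 = "2/5" and ?s1.0 = "0.585" and \<eta> = "1/10000" and c = "0.149"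
          and C = "0.988" and ?Y0.0 = "1.55" and ?X0.0 = "1.27" and ?g0.0 = "2/25"])
      (use \<gamma> s1 in \<open>auto simp: power2_eq_square\<close>)
  then have "sigma 5 \<gamma> psi 1 \<le> ereal 1.6181"
  proof (rule sigma_one_le_golden[rotated 3])
    show "2 * 0.11 < sin (pi / real 5)" "sin (pi / real 5) \<le> 1 - 0.11\<^sup>2"
      using s1 s2 by (auto simp: power2_eq_square)
    fix \<phi> :: real assume "\<bar>sin \<phi>\<bar> \<le> 0.11"
    then show "\<bar>sin (real 5 * \<phi>)\<bar> < sin (pi / real 5)" using abs_sin_mult_le[of 5 \<phi>] s1 by simp
  qed (use \<gamma> in auto)
  also have "\<dots> < ereal (real 5 * \<gamma>)" using False by simp
  finally show ?thesis .
qed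

lemma sigma_one_less_base_6:
  assumes \<gamma>: "1 / 6 < \<gamma>" "\<gamma> \<le> 1 / 3"
  shows "sigma 6 \<gamma> psi 1 < ereal (real 6 * \<gamma>)"
proof (cases "\<gamma> < 1 / 3")
  case True
  have "\<gamma> / (1 - \<gamma>) < 1 / 2" using True \<gamma> by (simp add: field_simps)
  also have "\<dots> = sin (pi / real 6)" by (simp add: sin_30)
  finally show ?thesis
    using \<gamma> True by (intro sigma_one_less_transversal confined_transversal) auto
next
  case False
  \<comment> \<open>Only \<gamma> = 1/3 is left, where \<open>\<gamma> / (1 - \<gamma>)\<close>
    equals \<open>sin (pi / 6)\<close> and transversality just fails to follow.\<close>
  have s1: "sin (pi / real 6) = 1 / 2" by (simp add: sin_30)
  have "confined 6 \<gamma> 0.08"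
    by (rule confined_first_step[where ?\<gamma>0.0 = "1/3" and ?s1.0 = "1/2" and \<eta> = "1/10000" and c = "0.118"
          and C = "0.99" and ?Y0.0 = "1.96" and ?X0.0 = "0.4" and ?g0.0 = "1/18"])
      (use \<gamma> s1 in \<open>auto simp: power2_eq_square\<close>)
  then have "sigma 6 \<gamma> psi 1 \<le> ereal 1.6181"
  proof (rule sigma_one_le_golden[rotated 3])
    show "2 * 0.08 < sin (pi / real 6)" "sin (pi / real 6) \<le> 1 - 0.08\<^sup>2"
      unfolding s1 by (auto simp: power2_eq_square)
    fix \<phi> :: real assume "\<bar>sin \<phi>\<bar> \<le> 0.08"
    then show "\<bar>sin (real 6 * \<phi>)\<bar> < sin (pi / real 6)" using abs_sin_mult_le[of 6 \<phi>] unfolding s1 by simp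
  qed (use \<gamma> in auto)
  also have "\<dots> < ereal (real 6 * \<gamma>)" using False by simp
  finally show ?thesis .
qed

section \<open>Base three\<close>

lemma sin_pi_div_3: "sin (pi / real 3) = sqrt 3 / 2" "1.73205 / 2 \<le> sin (pi / real 3)"
  using sqrt_3_bounds by (simp_all add: sin_60)

lemma sin_triple: "sin (3 * x) = 3 * sin x - 4 * sin x ^ 3" for x :: real
proof -
  have "sin (3 * x) = sin (2 * x + x)" by simp
  also have "\<dots> = 2 * sin x * (cos x)\<^sup>2 + (1 - 2 * (sin x)\<^sup>2) * sin x"
    unfolding sin_add sin_double cos_double_sin by (simp add: power2_eq_square)
  also have "\<dots> = 3 * sin x - 4 * sin x ^ 3"
    unfolding cos_squared_eq by (simp add: power2_eq_square power3_eq_cube algebra_simps)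
  finally show ?thesis .
qed

text \<open>The cubic \<open>3 * u - 4 * u ^ 3\<close> increases on [0, 1/2], so the bound on the
  sine can be inserted into the triple angle formula.\<close>

lemma abs_sin_triple_le:
  fixes x s :: real
  assumes "\<bar>sin x\<bar> \<le> s" "s \<le> 1 / 2"
  shows "\<bar>sin (3 * x)\<bar> \<le> 3 * s - 4 * s ^ 3"
proof -
  define y where "y = \<bar>sin x\<bar>"
  have y: "0 \<le> y" "y \<le> s" "y \<le> 1 / 2" unfolding y_def using assms by auto
  have mono: "3 * u - 4 * u ^ 3 \<le> 3 * v - 4 * v ^ 3" if "0 \<le> u" "u \<le> v" "v \<le> 1 / 2" for u v :: real
  proof -
    have "u * u \<le> 1 / 2 * (1 / 2)" "u * v \<le> 1 / 2 * (1 / 2)" "v * v \<le> 1 / 2 * (1 / 2)"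
      using that by (intro mult_mono; simp)+
    then have "0 \<le> (v - u) * (3 - 4 * (u * u + u * v + v * v))"
      using that by (intro mult_nonneg_nonneg) auto
    also have "\<dots> = (3 * v - 4 * v ^ 3) - (3 * u - 4 * u ^ 3)"
      by (simp add: power3_eq_cube algebra_simps)
    finally show ?thesis by simp
  qed
  have "\<bar>sin (3 * x)\<bar> = \<bar>3 * y - 4 * y ^ 3\<bar>"
    unfolding sin_triple y_def by (cases "0 \<le> sin x") (auto simp: power3_eq_cube)
  also have "\<dots> = 3 * y - 4 * y ^ 3" using mono[of 0 y] y by simp
  also have "\<dots> \<le> 3 * s - 4 * s ^ 3" using mono y assms by simp
  finally show ?thesis .
qed

text \<open>Two consecutive sines of a tripling orbit cannot both be extremal.\<close>
lemma triple_sine_pair_le: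
  assumes "\<bar>s\<bar> \<le> 1" "0 \<le> \<gamma>" "\<gamma> \<le> 0.4715"
  shows "3 * s - 4 * s ^ 3 + \<gamma> * s \<le> (1.26::real)"
proof (cases "0 \<le> s")
  case True
  \<comment> \<open>This replaces \<open>s ^ 3\<close> by its tangent line at 0.54, which is close
    to the maximum of \<open>3.4715 * s - 4 * s ^ 3\<close>.\<close>
  then have "0 \<le> (s - 0.54)\<^sup>2 * (s + 1.08)" by simp
  also have "\<dots> = s ^ 3 - 0.8748 * s + 0.314928"
    by (simp add: power2_eq_square power3_eq_cube field_simps)
  finally have "3.4992 * s \<le> 4 * s ^ 3 + 1.259712" by simp
  moreover have "\<gamma> * s \<le> 0.4715 * s" using True assms by (intro mult_right_mono) auto
  ultimately show ?thesis using True by simp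
next
  case False
  define w where "w = - s"
  have w: "0 \<le> w" "w \<le> 1" unfolding w_def using False assms by auto
  then have "w ^ 3 \<le> w" using power_decreasing[of 1 3 w] by simp
  moreover have "0 \<le> \<gamma> * w" using w assms by simp
  moreover have "3 * s - 4 * s ^ 3 + \<gamma> * s = - 3 * w + 4 * w ^ 3 - \<gamma> * w"
    unfolding w_def by (simp add: power3_eq_cube)
  ultimately have "3 * s - 4 * s ^ 3 + \<gamma> * s \<le> 1" using w by linarith
  then show ?thesis by simp
qed

text \<open>The cosine sum gives \<open>\<bar>sin \<phi>\<bar> <= 0.22\<close>. The geometric bound
  on the sine tail would allow \<open>\<bar>cos \<phi>\<bar>\<close> to be 1, but the bound on
  consecutive pairs yields \<open>\<bar>cos \<phi>\<bar> < 0.9\<close>, and the two are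
  incompatible.\<close>

lemma confined_base_3_transversal:
  assumes \<gamma>: "0 \<le> \<gamma>" "\<gamma> \<le> 0.4715"
  shows "confined 3 \<gamma> (- 1)"
proof (rule confinedI_near_tangent[where \<eta> = "1/1000"])
  fix \<alpha> \<beta> \<phi> \<mu>
  assume orb: "back_orbit 3 \<alpha>" "back_orbit 3 \<beta>" and nt: "near_tangent 3 \<gamma> (1/1000) \<alpha> \<beta>"
    and start: "\<alpha> 0 = \<phi> + \<mu>" "\<beta> 0 = \<phi> - \<mu>" and \<mu>: "sin (pi / real 3) \<le> \<bar>sin \<mu>\<bar>"
  have \<gamma>1: "\<gamma> < 1" and b1: "1 \<le> (3::nat)" using \<gamma> by auto
  have s1: "0.866 \<le> \<bar>sin \<mu>\<bar>" using \<mu> sin_pi_div_3(2) by simp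
  have sin\<phi>: "\<bar>sin \<phi>\<bar> \<le> 0.22"
    by (rule near_tangent_sin_phi_le[OF \<gamma>(1) \<gamma>1 b1 nt start \<gamma>(2) _ _ s1]) simp_all
  have "\<bar>cos \<phi>\<bar> < 0.9"
  proof -
    have one_side: "(\<Sum>n. \<gamma> ^ n * (e * sin (\<zeta> (Suc n)))) \<le> 1.26 / (1 - \<gamma>\<^sup>2)"
      if "back_orbit 3 \<zeta>" "e = 1 \<or> e = - 1" for \<zeta> e
    proof (rule suminf_le_pairs[OF \<gamma>(1) \<gamma>1, where M = 1])
      show "\<bar>e * sin (\<zeta> (Suc n))\<bar> \<le> 1" for n using that(2) by auto
      show "e * sin (\<zeta> (Suc n)) + \<gamma> * (e * sin (\<zeta> (Suc (Suc n)))) \<le> 1.26" for n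
      proof -
        let ?s = "sin (\<zeta> (Suc (Suc n)))"
        have "sin (\<zeta> (Suc n)) = sin (3 * \<zeta> (Suc (Suc n)))" using that(1) unfolding back_orbit_def by simp
        then have "e * sin (\<zeta> (Suc n)) + \<gamma> * (e * ?s) = 3 * (e * ?s) - 4 * (e * ?s) ^ 3 + \<gamma> * (e * ?s)"
          using that(2) unfolding sin_triple by auto
        also have "\<dots> \<le> 1.26"
          using \<gamma> that(2) by (intro triple_sine_pair_le) auto
        finally show ?thesis .
      qed
    qed
    let ?A = "\<Sum>n. \<gamma> ^ n * (sin (\<alpha> (Suc n)) - sin (\<beta> (Suc n)))"
    have sm: "summable (\<lambda>n. \<gamma> ^ n * (e * sin (\<zeta> (Suc n))))" if "e = 1 \<or> e = - 1" for \<zeta> e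
      using that by (intro summable_power_bounded[OF \<gamma>(1) \<gamma>1, where M = 1]) auto
    have sum_eq: "(\<Sum>n. \<gamma> ^ n * (e * sin (\<alpha> (Suc n)))) + (\<Sum>n. \<gamma> ^ n * (- e * sin (\<beta> (Suc n))))
        = (\<Sum>n. e * (\<gamma> ^ n * (sin (\<alpha> (Suc n)) - sin (\<beta> (Suc n)))))" if e: "e = 1 \<or> e = - 1" for e
    proof -
      have "- e = 1 \<or> - e = - 1" using e by auto
      from suminf_add[OF sm[OF e] sm[OF this]] show ?thesis by (simp add: algebra_simps)
    qed
    have sA: "summable (\<lambda>n. \<gamma> ^ n * (sin (\<alpha> (Suc n)) - sin (\<beta> (Suc n))))"
      using abs_sin_diff_le by (rule summable_power_bounded[OF \<gamma>(1) \<gamma>1])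
    have "e * ?A \<le> 2 * (1.26 / (1 - \<gamma>\<^sup>2))" if "e = 1 \<or> e = - 1" for e
      using sum_eq[OF that] one_side[OF orb(1) that] one_side[OF orb(2), of "- e"] that suminf_mult[OF sA, of e]
      by (simp; linarith)
    from this[of 1] this[of "- 1"] have "\<bar>?A\<bar> \<le> 2 * (1.26 / (1 - \<gamma>\<^sup>2))" by (simp; linarith)
    also have "\<gamma>\<^sup>2 \<le> 0.4715\<^sup>2" using \<gamma> by (intro power_mono)
    then have "2 * (1.26 / (1 - \<gamma>\<^sup>2)) \<le> 2 * (1.26 / (1 - 0.4715\<^sup>2))"
      by (intro mult_left_mono frac_le) (auto simp: power2_eq_square)
    also have "\<dots> \<le> 3.241" by (simp add: power2_eq_square)
    finally have A: "\<gamma> * \<bar>?A\<bar> \<le> 0.4715 * 3.241" using \<gamma> by (intro mult_mono) auto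
    have "sin (\<alpha> 0) - sin (\<beta> 0) = 2 * (cos \<phi> * sin \<mu>)" by (simp add: start sin_add sin_diff)
    then have "2 * \<bar>cos \<phi> * sin \<mu>\<bar> \<le> \<gamma> * \<bar>?A\<bar> + 1 / 1000"
      using near_tangent_split(1)[OF \<gamma>(1) \<gamma>1 b1 nt] \<gamma>(1) abs_mult[of \<gamma> ?A] by linarith
    moreover have "\<bar>cos \<phi>\<bar> * 0.866 \<le> \<bar>cos \<phi> * sin \<mu>\<bar>"
      unfolding abs_mult using s1 by (intro mult_left_mono) auto
    ultimately show ?thesis using A by simp
  qed
  then have "\<bar>cos \<phi>\<bar>\<^sup>2 \<le> 0.9\<^sup>2" "\<bar>sin \<phi>\<bar>\<^sup>2 \<le> 0.22\<^sup>2" using sin\<phi> by (intro power_mono; simp)+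
  then show "\<bar>sin \<phi>\<bar> \<le> - 1"
    using sin_cos_squared_add[of \<phi>] by (simp add: power2_eq_square)
qed auto

lemma confined_base_3:
  assumes \<gamma>: "0 \<le> \<gamma>" "\<gamma> \<le> \<gamma>0" "\<gamma>0 < 1" and s0: "2 * \<gamma>0 / (3 - \<gamma>0) + 1 / 100000 \<le> 1.73205 * s0"
  shows "confined 3 \<gamma> s0"
proof (rule confinedI_near_tangent[where \<eta> = "1/100000"])
  fix \<alpha> \<beta> \<phi> \<mu>
  assume nt: "near_tangent 3 \<gamma> (1/100000) \<alpha> \<beta>"
    and start: "\<alpha> 0 = \<phi> + \<mu>" "\<beta> 0 = \<phi> - \<mu>" and \<mu>: "sin (pi / real 3) \<le> \<bar>sin \<mu>\<bar>"
  have s1: "1.73205 / 2 \<le> \<bar>sin \<mu>\<bar>" using \<mu> sin_pi_div_3(2) by linarith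
  show "\<bar>sin \<phi>\<bar> \<le> s0"
    by (rule near_tangent_sin_phi_le[OF \<gamma>(1) _ _ nt start \<gamma>(2,3) _ s1]) (use \<gamma> s0 in simp_all)
qed auto

text \<open>For smaller \<gamma> the threshold 0.7 lies above \<open>3 * s0 - 4 * s0 ^ 3\<close> and
  below the sines of both children. Both exponents are then 2, and the condition becomes
  \<open>(\<rho>\<^sup>2 - 1)\<^sup>2 >= 1\<close>.\<close>

lemma sigma_one_le_base_3_sqrt_2:
  assumes \<gamma>: "0 \<le> \<gamma>" "\<gamma> \<le> 0.5394"
  shows "sigma 3 \<gamma> psi 1 \<le> ereal 1.4143"
proof -
  have conf: "confined 3 \<gamma> 0.2532"
    by (rule confined_base_3[of _ "0.5394"]) (use \<gamma> in auto)
  define \<tau> where "\<tau> x = (if \<bar>sin (2 * pi * x)\<bar> < 0.7 then 0 else 1 :: nat)" for x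
  have far: "0.7 \<le> \<bar>sin (\<phi> + \<mu>)\<bar> \<and> 0.7 \<le> \<bar>sin (\<phi> - \<mu>)\<bar>"
    if \<phi>: "\<bar>sin \<phi>\<bar> \<le> 0.2532" and \<mu>: "sin (pi / real 3) \<le> \<bar>sin \<mu>\<bar>" for \<phi> \<mu>
  proof -
    have "\<bar>sin \<phi>\<bar>\<^sup>2 \<le> 0.2532\<^sup>2" using \<phi> by (intro power_mono) auto
    then have "0.967\<^sup>2 \<le> \<bar>cos \<phi>\<bar>\<^sup>2"
      using sin_cos_squared_add[of \<phi>] by (simp add: power2_eq_square)
    then have c\<phi>: "0.967 \<le> \<bar>cos \<phi>\<bar>" by (rule power2_le_imp_le) simp
    have s\<mu>: "0.866 \<le> \<bar>sin \<mu>\<bar>" using \<mu> sin_pi_div_3(2) by simp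
    then have "0.866\<^sup>2 \<le> \<bar>sin \<mu>\<bar>\<^sup>2" by (intro power_mono) auto
    then have "\<bar>cos \<mu>\<bar>\<^sup>2 \<le> 0.51\<^sup>2"
      using sin_cos_squared_add[of \<mu>] by (simp add: power2_eq_square)
    then have "\<bar>cos \<mu>\<bar> \<le> 0.51" by (rule power2_le_imp_le) simp
    then have "\<bar>sin \<phi> * cos \<mu>\<bar> \<le> 0.2532 * 0.51"
      unfolding abs_mult using \<phi> by (intro mult_mono) auto
    moreover have "0.967 * 0.866 \<le> \<bar>cos \<phi> * sin \<mu>\<bar>"
      unfolding abs_mult using c\<phi> s\<mu> by (intro mult_mono) auto
    ultimately have "\<bar>sin \<phi> * cos \<mu>\<bar> \<le> 13 / 100" "83 / 100 \<le> \<bar>cos \<phi> * sin \<mu>\<bar>"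
      by simp_all
    then have "7 / 10 \<le> \<bar>sin (\<phi> + \<mu>)\<bar> \<and> 7 / 10 \<le> \<bar>sin (\<phi> - \<mu>)\<bar>"
      unfolding sin_add sin_diff by linarith
    then show ?thesis by simp
  qed
  have b1: "1 \<le> (3::nat)" by simp
  show ?thesis
  proof (rule sigma_one_le_matching[OF b1 \<gamma>(1) _ conf, where \<tau> = \<tau> and N = 1])
    show "\<tau> \<in> measurable borel (count_space UNIV)"
      unfolding \<tau>_def using two_valued_weight_measurable .
    fix x :: real and k l :: nat assume kl: "k < 3" "l < 3" "k \<noteq> l"
      and small: "\<bar>sin (pi * (2 * x + real k + real l) / real 3)\<bar> \<le> 0.2532"
    have "\<bar>sin (2 * pi * x)\<bar> < 0.7"
      using abs_sin_triple_le[OF small] digit_angle_relations(1)[OF b1, of x k l]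
      by (simp add: power3_eq_cube)
    then have "\<tau> x = 0" unfolding \<tau>_def by simp
    moreover have "\<tau> ((x + real k) / real 3) = 1" "\<tau> ((x + real l) / real 3) = 1"
      using far[OF small sin_digit_diff_ge[OF kl]]
      unfolding \<tau>_def digit_angle_relations(2)[OF b1, of x k l, symmetric]
        digit_angle_relations(3)[OF b1, of x l k, symmetric] by auto
    ultimately show "\<tau> x = 0 \<and> 1 \<le> (1.4143 ^ Suc (\<tau> ((x + real k) / real 3)) - 1) *
        (1.4143 ^ Suc (\<tau> ((x + real l) / real 3)) - (1::real))"
      by (simp add: power2_eq_square)
  next
    fix x :: real and k l l' :: nat assume "l < 3" "l' < 3" "\<bar>sin (pi * (2 * x + real k + real l) / real 3)\<bar> \<le> 0.2532"
      "\<bar>sin (pi * (2 * x + real k + real l') / real 3)\<bar> \<le> 0.2532"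
    moreover have "2 * 0.2532 < sin (pi / real 3)" using sin_pi_div_3(2) by simp
    ultimately show "l = l'" using confined_partner_unique by blast
  qed (use \<gamma> in \<open>auto simp: \<tau>_def\<close>)
qed

lemma sin_sq_equally_spaced: "(sin x)\<^sup>2 + (sin (x + pi / 3))\<^sup>2 + (sin (x + 2 * pi / 3))\<^sup>2 = 3 / 2" for x :: real
proof -
  have "(sin (x + pi / 3))\<^sup>2 + (sin (x + 2 * pi / 3))\<^sup>2 = (sin x)\<^sup>2 / 2 + 3 / 2 * (cos x)\<^sup>2"
    unfolding sin_add sin_60 cos_60 sin_120 cos_120
    by (simp add: power2_eq_square algebra_simps)
  then show ?thesis unfolding cos_squared_eq by argo
qed

text \<open>At most two of the three pairs of digits are tangent at a given point. If two are, they share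
  a digit, and the weight is shifted from this digit to the other two.\<close>
lemma sigma_one_le_base_3_path:
  assumes \<gamma>: "0 \<le> \<gamma>" "\<gamma> < 1"
  shows "sigma 3 \<gamma> psi 1 \<le> ereal (1 + sqrt 2)"
proof -
  define R where "R = near_digits 3 (1 / 2)"
  have T: "\<gamma> / (real 3 - \<gamma>) < 1 / 2" using \<gamma> by (simp add: field_simps)
  have R_sym: "R x k l \<longleftrightarrow> R x l k" for x k l unfolding R_def using near_digits_sym by blast
  have small: "(sin (pi * (2 * x + real k + real l) / 3))\<^sup>2 \<le> 1 / 3"
    if "k < 3" "l < 3" "k \<noteq> l" "R x k l" for x k l
  proof -
    let ?s = "sin (pi * (2 * x + real k + real l) / 3)"
    have "sqrt 3 / 2 \<le> \<bar>sin (pi * (real k - real l) / 3)\<bar>"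
      using sin_digit_diff_ge[OF that(1-3)] sin_pi_div_3(1) by simp
    then have "\<bar>?s\<bar> * (sqrt 3 / 2) \<le> \<bar>?s\<bar> * \<bar>sin (pi * (real k - real l) / 3)\<bar>"
      by (rule mult_left_mono) simp
    also have "\<dots> \<le> 1 / 2" using that(4) unfolding R_def near_digits_def by (simp add: abs_mult)
    finally have "(\<bar>?s\<bar> * sqrt 3)\<^sup>2 \<le> 1" by (intro power_le_one) auto
    then show ?thesis by (simp add: power_mult_distrib)
  qed
  have no_triangle: "\<not> (R x 0 1 \<and> R x 0 2 \<and> R x 1 2)" for x
  proof
    assume "R x 0 1 \<and> R x 0 2 \<and> R x 1 2"
    then have "(sin (pi * (2 * x + 1) / 3))\<^sup>2 + (sin (pi * (2 * x + 2) / 3))\<^sup>2 + (sin (pi * (2 * x + 3) / 3))\<^sup>2 \<le> 1"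
      using small[of 0 1 x] small[of 0 2 x] small[of 1 2 x] by (simp add: add.assoc)
    moreover have "pi * (2 * x + 2) / 3 = pi * (2 * x + 1) / 3 + pi / 3"
      "pi * (2 * x + 3) / 3 = pi * (2 * x + 1) / 3 + 2 * pi / 3" by (simp_all add: field_simps)
    ultimately show False using sin_sq_equally_spaced[of "pi * (2 * x + 1) / 3"] by simp
  qed
  \<comment> \<open>The third digit is \<open>3 - (k + l)\<close>. When two pairs are tangent, the
    entries are the quotients of the Perron eigenvector (1, sqrt 2, 1) of a path with three
    vertices; all three row sums then equal its eigenvalue sqrt 2 plus the diagonal entry 1.\<close>
  define V where "V x k l = (if k = l then 1 else if \<not> R x k l then 0
    else if R x k (3 - (k + l)) then 1 / sqrt 2 else if R x l (3 - (k + l)) then sqrt 2 else 1)"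
    for x :: real and k l :: nat
  have [measurable]: "Measurable.pred borel (\<lambda>x. R x k l)" for k l
    unfolding R_def near_digits_def by measurable
  have inv: "1 / sqrt 2 + 1 / sqrt 2 = sqrt 2" by (simp add: real_div_sqrt)
  have half: "1 / sqrt 2 \<le> 1" "1 \<le> sqrt 2" by auto
  have lt3: "k = 0 \<or> k = 1 \<or> k = 2" if "k < 3" for k :: nat using that by auto
  show ?thesis
  proof (rule sigma_one_le[OF _ \<gamma>, where \<omega> = "\<lambda>_. 1" and m = 1 and M = 1 and V = V
        and \<eta> = "2 * (1 / 2 - \<gamma> / (real 3 - \<gamma>))"])
    show "(\<lambda>x. V x k l) \<in> borel_measurable borel" for k l unfolding V_def by measurable
    show "1 \<le> V x k l * V x l k" if "k < 3" "l < 3"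
      "tangent_digits 3 \<gamma> (2 * (1 / 2 - \<gamma> / (real 3 - \<gamma>))) x k l" for x k l
    proof -
      have "R x k l" unfolding R_def
        by (rule tangent_digits_imp_near_digits[OF \<gamma> _ T that(3)]) simp
      then show ?thesis
        using lt3[OF that(1)] lt3[OF that(2)] no_triangle[of x] R_sym[of x]
        unfolding V_def by (elim disjE) (auto simp: numeral_3_eq_3 numeral_2_eq_2)
    qed
    show "1 / 1 * (\<Sum>l<3. V x k l) \<le> 1 + sqrt 2" if "k < 3" for x k
    proof -
      have "(\<Sum>l<3. V x k l) = V x k 0 + V x k 1 + V x k 2"
        by (simp add: numeral_3_eq_3 numeral_2_eq_2)
      then show ?thesis
        using lt3[OF that] inv half unfolding V_def by (elim disjE) auto
    qed
    show "0 \<le> V x k l" for x k l unfolding V_def by simp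
    show "0 < 2 * (1 / 2 - \<gamma> / (real 3 - \<gamma>))" using T by (simp only: zero_less_mult_iff diff_gt_0_iff_gt) simp
  qed auto
qed

lemma sigma_one_less_base_3:
  assumes \<gamma>: "1 / 3 < \<gamma>" "\<gamma> < 1"
  shows "sigma 3 \<gamma> psi 1 < ereal (real 3 * \<gamma>)"
proof -
  \<comment> \<open>The cut points are, up to rounding upwards, one third of the bounds proved to
    the right of them: sqrt 2, the golden ratio, 2 and 1 + sqrt 2.\<close>
  consider "\<gamma> \<le> 0.4715" | "0.4715 < \<gamma>" "\<gamma> \<le> 0.5394" | "0.5394 < \<gamma>" "\<gamma> \<le> 2 / 3"
    | "2 / 3 < \<gamma>" "\<gamma> \<le> 0.81" | "0.81 < \<gamma>" by linarith
  then show ?thesis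
  proof cases
    case 1
    then show ?thesis
      using \<gamma> by (intro sigma_one_less_transversal confined_base_3_transversal) auto
  next
    case 2
    have "sigma 3 \<gamma> psi 1 \<le> ereal 1.4143" using 2 by (intro sigma_one_le_base_3_sqrt_2) auto
    also have "\<dots> < ereal (real 3 * \<gamma>)" using 2 by simp
    finally show ?thesis .
  next
    case 3
    have "confined 3 \<gamma> 0.33"
      by (rule confined_base_3[of _ "2/3"]) (use 3 in auto)
    then have "sigma 3 \<gamma> psi 1 \<le> ereal 1.6181"
    proof (rule sigma_one_le_golden[rotated 3])
      show "2 * 0.33 < sin (pi / real 3)" using sin_pi_div_3(2) by simp
      show "sin (pi / real 3) \<le> 1 - 0.33\<^sup>2"
        unfolding sin_pi_div_3(1) using sqrt_3_bounds by (simp add: power2_eq_square)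
      show "\<bar>sin (real 3 * \<phi>)\<bar> < sin (pi / real 3)" if "\<bar>sin \<phi>\<bar> \<le> 0.33" for \<phi>
        using abs_sin_triple_le[OF that] sin_pi_div_3(2) by (simp add: power3_eq_cube)
    qed (use 3 in auto)
    also have "\<dots> < ereal (real 3 * \<gamma>)" using 3 by simp
    finally show ?thesis .
  next
    case 4
    have "(sin (pi / real 3))\<^sup>2 = 3 / 4" unfolding sin_pi_div_3(1) by (simp add: power_divide)
    then have "2 * (\<gamma> / (real 3 - \<gamma>)) < (sin (pi / real 3))\<^sup>2"
      unfolding \<open>(sin (pi / real 3))\<^sup>2 = 3 / 4\<close> using 4 by (simp add: field_simps)
    then have "sigma 3 \<gamma> psi 1 \<le> 2" using \<gamma> by (intro sigma_one_le_2) auto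
    also have "2 < ereal (real 3 * \<gamma>)"
      using 4 by (metis ereal_less(2) less_ereal.simps(1) numeral_eq_ereal mult.commute divide_less_eq_numeral1(1) of_nat_numeral)
    finally show ?thesis .
  next
    case 5
    have "sigma 3 \<gamma> psi 1 \<le> ereal (1 + sqrt 2)" using \<gamma> by (intro sigma_one_le_base_3_path) auto
    also have "\<dots> < ereal (real 3 * \<gamma>)" using 5 sqrt_2_bounds by simp
    finally show ?thesis .
  qed
qed

section \<open>Base two\<close>

text \<open>For \<open>b = 2\<close> two orbits with different first digits start at opposite points of the circle.
  After a reflection or an exchange of the orbits, the first one starts in the first quadrant.\<close>

locale opposite_doubling_orbits =
  fixes \<gamma> \<eta> :: real and c s d t :: "nat \<Rightarrow> real"
  assumes \<gamma>: "0 \<le> \<gamma>" "\<gamma> < 1"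
    and circle: "(c n)\<^sup>2 + (s n)\<^sup>2 = 1" "(d n)\<^sup>2 + (t n)\<^sup>2 = 1"
    and double: "c n = 2 * (c (Suc n))\<^sup>2 - 1" "s n = 2 * s (Suc n) * c (Suc n)"
      "d n = 2 * (d (Suc n))\<^sup>2 - 1" "t n = 2 * t (Suc n) * d (Suc n)"
    and opposite: "d 0 = - c 0" "t 0 = - s 0" and quadrant: "0 \<le> c 0" "0 \<le> s 0"
    and tangent: "\<bar>\<Sum>n. \<gamma> ^ n * (s n - t n)\<bar> \<le> \<eta>" "\<bar>\<Sum>n. (\<gamma> / 2) ^ n * (c n - d n)\<bar> \<le> \<eta>"
begin

text \<open>Cosine and sine of half the starting angle of the first orbit.\<close>

definition "P = sqrt ((1 + c 0) / 2)"
definition "Q = sqrt ((1 - c 0) / 2)"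

lemma bounded: "\<bar>c n\<bar> \<le> 1" "\<bar>s n\<bar> \<le> 1" "\<bar>d n\<bar> \<le> 1" "\<bar>t n\<bar> \<le> 1"
proof -
  have *: "\<bar>x\<bar> \<le> 1" if "x\<^sup>2 + y\<^sup>2 = 1" for x y :: real
    using that zero_le_power2[of y] by (subst abs_square_le_1[symmetric]) linarith
  show "\<bar>c n\<bar> \<le> 1" "\<bar>d n\<bar> \<le> 1" using circle by (auto intro: *)
  show "\<bar>s n\<bar> \<le> 1" "\<bar>t n\<bar> \<le> 1"
    using *[of "s n" "c n"] *[of "t n" "d n"] circle[of n] by (simp_all add: add.commute)
qed

lemma c0_le: "c 0 \<le> 1" using bounded(1)[of 0] by simp

lemma diff_bounded: "\<bar>c n - d n\<bar> \<le> 2" "\<bar>s n - t n\<bar> \<le> 2"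
  using bounded(1,3)[of n] bounded(2,4)[of n] by linarith+

lemma PQ: "P\<^sup>2 = (1 + c 0) / 2" "Q\<^sup>2 = (1 - c 0) / 2" "0 \<le> Q" "0 < P" "Q \<le> P"
  using quadrant(1) c0_le unfolding P_def Q_def by auto

lemma PQ_prod: "2 * P * Q = s 0"
proof -
  have "(2 * P * Q)\<^sup>2 = 1 - (c 0)\<^sup>2"
    unfolding power_mult_distrib PQ(1,2) by (simp add: power2_eq_square field_simps)
  also have "\<dots> = (s 0)\<^sup>2" using circle(1)[of 0] by linarith
  finally show ?thesis using quadrant(2) PQ by (simp add: power2_eq_iff_nonneg)
qed

lemma PQ_sum_sq: "(P + Q)\<^sup>2 = 1 + s 0"
  unfolding power2_sum PQ(1,2) using PQ_prod by (simp add: field_simps)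

lemma PQ_sum: "1 \<le> P + Q" "P + Q \<le> 1.41422"
proof -
  show "1 \<le> P + Q" by (rule power2_le_imp_le) (use PQ_sum_sq quadrant PQ in auto)
  show "P + Q \<le> 1.41422"
    by (rule power2_le_imp_le) (use PQ_sum_sq bounded(2)[of 0] in \<open>auto simp: power2_eq_square\<close>)
qed

text \<open>\<open>(P - Q) * (P + Q) = c 0\<close> and \<open>P + Q >= 1\<close>. This lets a term
  \<open>P - Q\<close> in the cosine sum be absorbed by the leading \<open>2 * c 0\<close>.\<close>

lemma PQ_diff: "P - Q \<le> c 0" "0 \<le> P - Q"
proof -
  have "(P - Q) * 1 \<le> (P - Q) * (P + Q)" using PQ PQ_sum by (intro mult_left_mono) auto
  also have "\<dots> = P\<^sup>2 - Q\<^sup>2" by (simp add: power2_eq_square algebra_simps)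
  also have "\<dots> = c 0" unfolding PQ(1,2) by (simp add: field_simps)
  finally show "P - Q \<le> c 0" by simp
  show "0 \<le> P - Q" using PQ by simp
qed

text \<open>Halving an angle leaves one sign open for each orbit. The opposite starting point turns
  the half angle by a quarter circle, which exchanges the roles of \<open>P\<close> and
  \<open>Q\<close>. The four combinations form the case distinction of the later estimates.\<close>

lemma second_points:
  "(c 1 = P \<and> s 1 = Q \<or> c 1 = - P \<and> s 1 = - Q) \<and> (d 1 = - Q \<and> t 1 = P \<or> d 1 = Q \<and> t 1 = - P)"
proof
  have "(c 1)\<^sup>2 = P\<^sup>2" using double(1)[of 0] unfolding PQ by simp
  then have c1: "c 1 = P \<or> c 1 = - P" by (simp add: power2_eq_iff)
  have "s 1 * c 1 = P * Q" using double(2)[of 0] PQ_prod by simp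
  then have "c 1 = P \<Longrightarrow> s 1 * P = Q * P" "c 1 = - P \<Longrightarrow> - s 1 * P = Q * P" by (simp_all add: mult.commute)
  then show "c 1 = P \<and> s 1 = Q \<or> c 1 = - P \<and> s 1 = - Q"
    using c1 PQ(4) unfolding mult_cancel_right by auto
  have "(d 1)\<^sup>2 = Q\<^sup>2" using double(3)[of 0] opposite unfolding PQ by simp
  then have "(t 1)\<^sup>2 = P\<^sup>2" using circle(2)[of 1] unfolding PQ by (simp add: field_simps)
  then have t1: "t 1 = P \<or> t 1 = - P" by (simp add: power2_eq_iff)
  have "t 1 * d 1 = - (P * Q)" using double(4)[of 0] opposite PQ_prod by simp
  then have "t 1 = P \<Longrightarrow> - d 1 * P = Q * P" "t 1 = - P \<Longrightarrow> d 1 * P = Q * P" by (simp_all add: mult.commute)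
  then show "d 1 = - Q \<and> t 1 = P \<or> d 1 = Q \<and> t 1 = - P"
    using t1 PQ(4) unfolding mult_cancel_right by auto
qed

text \<open>The first summand comes from bounding the first orbit by consecutive pairs, the second
  from the trivial bound 1 on the cosines of the other orbit.\<close>

definition "T g = (1 + g\<^sup>2 / 8) / (1 - g\<^sup>2) + 1 / (1 - g)" for g :: real

lemma T_mono: "0 \<le> g \<Longrightarrow> g \<le> g' \<Longrightarrow> g' < 1 \<Longrightarrow> T g \<le> T g'"
  unfolding T_def by (intro add_mono frac_le) (auto simp: power_mono power_less_one_iff)

lemma T_nonneg: "0 \<le> g \<Longrightarrow> g < 1 \<Longrightarrow> 0 \<le> T g"
  unfolding T_def by (intro add_nonneg_nonneg divide_nonneg_nonneg) (auto simp: power_le_one)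

text \<open>The cosines of a doubling orbit satisfy \<open>c n + g c (n + 1) = 2 y^2 - 1 + g y\<close> with
  \<open>y = c (n + 1)\<close>, which is at least \<open>-1 - g^2 / 8\<close>.\<close>
lemma cosine_tail_ge: "- T (\<gamma> / 2) \<le> (\<Sum>n. (\<gamma> / 2) ^ n * (c (n + m) - d (n + m)))"
proof -
  let ?g = "\<gamma> / 2"
  have g: "0 \<le> ?g" "?g < 1" using \<gamma> by auto
  have "(\<Sum>n. ?g ^ n * - c (n + m)) \<le> (1 + ?g\<^sup>2 / 8) / (1 - ?g\<^sup>2)"
  proof (rule suminf_le_pairs[OF g, where M = 1])
    show "- c (n + m) + ?g * - c (Suc n + m) \<le> 1 + ?g\<^sup>2 / 8" for n
    proof -
      let ?y = "c (Suc (n + m))"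
      have "0 \<le> 2 * (?y + ?g / 4)\<^sup>2" by simp
      also have "\<dots> = (2 * ?y\<^sup>2 - 1) + ?g * ?y + (1 + ?g\<^sup>2 / 8)"
        by (simp add: power2_eq_square field_simps)
      finally show ?thesis using double(1)[of "n + m"] by simp
    qed
  qed (use bounded in auto)
  moreover have "(\<Sum>n. ?g ^ n * d (n + m)) \<le> 1 / (1 - ?g)"
    using bounded(3) abs_le_iff by (intro suminf_le_geometric[OF g, where M = 1]) auto
  moreover have "(\<Sum>n. ?g ^ n * - c (n + m)) + (\<Sum>n. ?g ^ n * d (n + m))
      = - (\<Sum>n. ?g ^ n * (c (n + m) - d (n + m)))"
  proof -
    have "summable (\<lambda>n. ?g ^ n * - c (n + m))" "summable (\<lambda>n. ?g ^ n * d (n + m))"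
      using bounded by (intro summable_power_bounded[OF g, where M = 1]; simp)+
    from suminf_add[OF this]
    have "(\<Sum>n. ?g ^ n * - c (n + m)) + (\<Sum>n. ?g ^ n * d (n + m))
      = (\<Sum>n. - (?g ^ n * (c (n + m) - d (n + m))))" by (simp add: algebra_simps)
    also have "\<dots> = - (\<Sum>n. ?g ^ n * (c (n + m) - d (n + m)))"
      using diff_bounded(1) by (intro suminf_minus summable_power_bounded[OF g, where M = 2]) auto
    finally show ?thesis .
  qed
  ultimately show ?thesis unfolding T_def by linarith
qed

lemma cosine_expand_2: "2 * c 0 + \<gamma> / 2 * (c 1 - d 1) \<le> (\<gamma> / 2)\<^sup>2 * T (\<gamma> / 2) + \<eta>"
  and cosine_expand_3:
    "2 * c 0 + \<gamma> / 2 * (c 1 - d 1) + (\<gamma> / 2)\<^sup>2 * (c 2 - d 2) \<le> (\<gamma> / 2) ^ 3 * T (\<gamma> / 2) + \<eta>"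
proof -
  let ?g = "\<gamma> / 2"
  have g: "0 \<le> ?g" "?g < 1" using \<gamma> by auto
  define B where "B m = (\<Sum>n. ?g ^ n * (c (n + m) - d (n + m)))" for m
  have split: "B m = (c m - d m) + ?g * B (Suc m)" for m
    using suminf_power_split[OF g, of "\<lambda>n. c (n + m) - d (n + m)" 2] diff_bounded unfolding B_def by simp
  have B0: "B 0 \<le> \<eta>" using tangent(2) unfolding B_def by simp
  have B1: "B 0 = 2 * c 0 + ?g * (c 1 - d 1) + ?g\<^sup>2 * B 2"
  proof -
    have B0: "B 0 = 2 * c 0 + ?g * B 1" using split[of 0] opposite by simp
    have B1: "B 1 = (c 1 - d 1) + ?g * B 2" using split[of 1] by (simp add: numeral_2_eq_2)
    show ?thesis unfolding B0 B1 by (simp add: power2_eq_square algebra_simps)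
  qed
  have "?g\<^sup>2 * - T ?g \<le> ?g\<^sup>2 * B 2" unfolding B_def by (intro mult_left_mono cosine_tail_ge) auto
  then show "2 * c 0 + ?g * (c 1 - d 1) \<le> ?g\<^sup>2 * T ?g + \<eta>" using B0 B1 by simp
  have B2': "B 2 = (c 2 - d 2) + ?g * B 3" using split[of 2] by (simp add: numeral_3_eq_3 numeral_2_eq_2)
  have B2: "B 0 = 2 * c 0 + ?g * (c 1 - d 1) + ?g\<^sup>2 * (c 2 - d 2) + ?g ^ 3 * B 3"
    unfolding B1 B2' by (simp add: power2_eq_square power3_eq_cube algebra_simps)
  have "?g ^ 3 * - T ?g \<le> ?g ^ 3 * B 3" unfolding B_def using g by (intro mult_left_mono cosine_tail_ge) auto
  then show "2 * c 0 + ?g * (c 1 - d 1) + ?g\<^sup>2 * (c 2 - d 2) \<le> ?g ^ 3 * T ?g + \<eta>" using B0 B2 by simp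
qed

text \<open>The potential at the second point bounds the negated sine sum over the points after it.
  For the second orbit the reflected sine \<open>- t\<close> takes the place of \<open>s\<close>, so
  one inequality \<open>pot\<close> on the circle serves both tails.\<close>

lemma sine_expand:
  assumes pot: "\<And>S C. S\<^sup>2 + C\<^sup>2 = 1 \<Longrightarrow> - S + \<gamma> * (a + p * S - r * C) \<le> a + p * (2 * S * C) - r * (2 * C\<^sup>2 - 1)"
  shows "2 * s 0 + \<gamma> * (s 1 - t 1) \<le> \<gamma>\<^sup>2 * ((a + p * s 1 - r * c 1) + (a - p * t 1 - r * d 1)) + \<eta>"
proof -
  have tail: "(\<Sum>n. \<gamma> ^ n * - \<sigma> (Suc (n + m))) \<le> a + p * \<sigma> m - r * \<zeta> m"
    if "\<And>n. (\<zeta> n)\<^sup>2 + (\<sigma> n)\<^sup>2 = 1" "\<And>n. \<zeta> n = 2 * (\<zeta> (Suc n))\<^sup>2 - 1" "\<And>n. \<sigma> n = 2 * \<sigma> (Suc n) * \<zeta> (Suc n)"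
      and b: "\<And>n. \<bar>\<zeta> n\<bar> \<le> 1" "\<And>n. \<bar>\<sigma> n\<bar> \<le> 1" for \<sigma> \<zeta> :: "nat \<Rightarrow> real" and m
  proof -
    have "(\<Sum>n. \<gamma> ^ n * - \<sigma> (Suc (n + m))) \<le> (\<lambda>n. a + p * \<sigma> (n + m) - r * \<zeta> (n + m)) 0"
    proof (rule suminf_le_potential[OF \<gamma>, where M = 1 and M' = "\<bar>a\<bar> + \<bar>p\<bar> + \<bar>r\<bar>"])
      show "\<bar>a + p * \<sigma> (n + m) - r * \<zeta> (n + m)\<bar> \<le> \<bar>a\<bar> + \<bar>p\<bar> + \<bar>r\<bar>" for n
      proof -
        have "\<bar>p * \<sigma> (n + m)\<bar> \<le> \<bar>p\<bar> * 1" "\<bar>r * \<zeta> (n + m)\<bar> \<le> \<bar>r\<bar> * 1"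
          unfolding abs_mult using b by (intro mult_left_mono; simp)+
        then show ?thesis by linarith
      qed
      show "- \<sigma> (Suc (n + m)) + \<gamma> * (a + p * \<sigma> (Suc n + m) - r * \<zeta> (Suc n + m))
          \<le> a + p * \<sigma> (n + m) - r * \<zeta> (n + m)" for n
        using pot[of "\<sigma> (Suc (n + m))" "\<zeta> (Suc (n + m))"] that(1)[of "Suc (n + m)"]
          that(2)[of "n + m"] that(3)[of "n + m"] by (simp add: add.commute)
    qed (use b in auto)
    then show ?thesis by simp
  qed
  define A where "A m = (\<Sum>n. \<gamma> ^ n * (s (n + m) - t (n + m)))" for m
  have split: "A m = (s m - t m) + \<gamma> * A (Suc m)" for m
    using suminf_power_split[OF \<gamma>, of "\<lambda>n. s (n + m) - t (n + m)" 2] diff_bounded unfolding A_def by simp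
  have A0: "A 0 = 2 * s 0 + \<gamma> * (s 1 - t 1) + \<gamma>\<^sup>2 * A 2"
  proof -
    have A0: "A 0 = 2 * s 0 + \<gamma> * A 1" using split[of 0] opposite by simp
    have A1: "A 1 = (s 1 - t 1) + \<gamma> * A 2" using split[of 1] by (simp add: numeral_2_eq_2)
    show ?thesis unfolding A0 A1 by (simp add: power2_eq_square algebra_simps)
  qed
  have "(\<Sum>n. \<gamma> ^ n * - s (Suc (n + 1))) \<le> a + p * s 1 - r * c 1"
    using circle(1) double(1,2) bounded(1,2) by (rule tail)
  moreover have "(\<Sum>n. \<gamma> ^ n * - (- t (Suc (n + 1)))) \<le> a + p * - t 1 - r * d 1"
  proof (rule tail[of d "\<lambda>n. - t n"])
    show "- t n = 2 * - t (Suc n) * d (Suc n)" for n using double(4)[of n] by simp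
    show "(d n)\<^sup>2 + (- t n)\<^sup>2 = 1" for n using circle(2)[of n] by simp
    show "\<bar>- t n\<bar> \<le> 1" for n using bounded(4)[of n] by simp
  qed (rule double(3) bounded(3))+
  moreover have "(\<Sum>n. \<gamma> ^ n * - s (Suc (n + 1))) + (\<Sum>n. \<gamma> ^ n * - (- t (Suc (n + 1)))) = - A 2"
  proof -
    have "summable (\<lambda>n. \<gamma> ^ n * - s (Suc (n + 1)))" "summable (\<lambda>n. \<gamma> ^ n * - (- t (Suc (n + 1))))"
      using bounded by (intro summable_power_bounded[OF \<gamma>, where M = 1]; simp)+
    from suminf_add[OF this]
    have "(\<Sum>n. \<gamma> ^ n * - s (Suc (n + 1))) + (\<Sum>n. \<gamma> ^ n * - (- t (Suc (n + 1))))
      = (\<Sum>n. - (\<gamma> ^ n * (s (n + 2) - t (n + 2))))" by (simp add: algebra_simps)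
    also have "\<dots> = - A 2"
      unfolding A_def using diff_bounded(2) by (intro suminf_minus summable_power_bounded[OF \<gamma>, where M = 2]) auto
    finally show ?thesis .
  qed
  ultimately have "- A 2 \<le> (a + p * s 1 - r * c 1) + (a - p * t 1 - r * d 1)" by linarith
  then have "\<gamma>\<^sup>2 * - A 2 \<le> \<gamma>\<^sup>2 * ((a + p * s 1 - r * c 1) + (a - p * t 1 - r * d 1))"
    by (intro mult_left_mono) auto
  then show ?thesis using A0 tangent(1) unfolding A_def by simp
qed

end

text \<open>For \<open>b = 2\<close> the separation is \<open>\<bar>sin \<mu>\<bar> = 1\<close>, so
  the orbits start at antipodal points and \<open>\<bar>sin \<phi>\<bar>\<close> is the absolute
  value of the starting cosine, which is \<open>c 0\<close> in the normalised situation.\<close>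

lemma confined_base_2:
  assumes \<gamma>: "0 \<le> \<gamma>" "\<gamma> < 1" and \<eta>: "\<eta> > 0"
    and bound: "\<And>c s d t. opposite_doubling_orbits \<gamma> \<eta> c s d t \<Longrightarrow> c 0 \<le> s0"
  shows "confined 2 \<gamma> s0"
proof (rule confinedI_near_tangent[OF \<eta>])
  fix \<alpha> \<beta> \<phi> \<mu>
  assume orb: "back_orbit 2 \<alpha>" "back_orbit 2 \<beta>" and nt: "near_tangent 2 \<gamma> \<eta> \<alpha> \<beta>"
    and start: "\<alpha> 0 = \<phi> + \<mu>" "\<beta> 0 = \<phi> - \<mu>" and \<mu>: "sin (pi / real 2) \<le> \<bar>sin \<mu>\<bar>"
  have "1 \<le> \<bar>sin \<mu>\<bar>" using \<mu> by simp
  then have "\<bar>sin \<mu>\<bar> = 1" using abs_sin_le_one[of \<mu>] by linarith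
  then have "(sin \<mu>)\<^sup>2 = 1" by (metis power2_abs one_power2)
  then have "cos \<mu> = 0" using sin_cos_squared_add[of \<mu>] by simp
  then have opp: "cos (\<beta> 0) = - cos (\<alpha> 0)" "sin (\<beta> 0) = - sin (\<alpha> 0)" and c0: "\<bar>cos (\<alpha> 0)\<bar> = \<bar>sin \<phi>\<bar>"
    using \<open>\<bar>sin \<mu>\<bar> = 1\<close> by (auto simp: start cos_add cos_diff sin_add sin_diff abs_mult)
  have dbl: "cos (\<zeta> n) = 2 * (cos (\<zeta> (Suc n)))\<^sup>2 - 1" "sin (\<zeta> n) = 2 * sin (\<zeta> (Suc n)) * cos (\<zeta> (Suc n))"
    if "back_orbit 2 \<zeta>" for \<zeta> n
  proof -
    from that have "cos (\<zeta> n) = cos (real 2 * \<zeta> (Suc n))" "sin (\<zeta> n) = sin (real 2 * \<zeta> (Suc n))"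
      unfolding back_orbit_def by blast+
    then show "cos (\<zeta> n) = 2 * (cos (\<zeta> (Suc n)))\<^sup>2 - 1" "sin (\<zeta> n) = 2 * sin (\<zeta> (Suc n)) * cos (\<zeta> (Suc n))"
      by (simp_all add: cos_double_cos sin_double)
  qed
  have tan: "\<bar>\<Sum>n. \<gamma> ^ n * (sin (\<alpha> n) - sin (\<beta> n))\<bar> \<le> \<eta>" "\<bar>\<Sum>n. (\<gamma> / 2) ^ n * (cos (\<alpha> n) - cos (\<beta> n))\<bar> \<le> \<eta>"
    using nt unfolding near_tangent_def by simp_all
  have orbits: "opposite_doubling_orbits \<gamma> \<eta> (\<lambda>n. cos (\<zeta> n)) (\<lambda>n. e * sin (\<zeta> n)) (\<lambda>n. cos (\<xi> n)) (\<lambda>n. e * sin (\<xi> n))"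
    if o: "back_orbit 2 \<zeta>" "back_orbit 2 \<xi>" and opp: "cos (\<xi> 0) = - cos (\<zeta> 0)" "sin (\<xi> 0) = - sin (\<zeta> 0)"
      and e: "e = 1 \<or> e = - 1" and quad: "0 \<le> cos (\<zeta> 0)" "0 \<le> e * sin (\<zeta> 0)"
      and tan: "\<bar>\<Sum>n. \<gamma> ^ n * (sin (\<zeta> n) - sin (\<xi> n))\<bar> \<le> \<eta>"
        "\<bar>\<Sum>n. (\<gamma> / 2) ^ n * (cos (\<zeta> n) - cos (\<xi> n))\<bar> \<le> \<eta>" for \<zeta> \<xi> e
  proof
    have e2: "e\<^sup>2 = 1" using e by auto
    show "(cos (\<zeta> n))\<^sup>2 + (e * sin (\<zeta> n))\<^sup>2 = 1" "(cos (\<xi> n))\<^sup>2 + (e * sin (\<xi> n))\<^sup>2 = 1" for n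
      unfolding power_mult_distrib e2 by simp_all
    show "cos (\<zeta> n) = 2 * (cos (\<zeta> (Suc n)))\<^sup>2 - 1" "cos (\<xi> n) = 2 * (cos (\<xi> (Suc n)))\<^sup>2 - 1"
      "e * sin (\<zeta> n) = 2 * (e * sin (\<zeta> (Suc n))) * cos (\<zeta> (Suc n))"
      "e * sin (\<xi> n) = 2 * (e * sin (\<xi> (Suc n))) * cos (\<xi> (Suc n))" for n
      using dbl[OF o(1), of n] dbl[OF o(2), of n] by simp_all
    have "summable (\<lambda>n. \<gamma> ^ n * (sin (\<zeta> n) - sin (\<xi> n)))"
      by (rule summable_power_bounded[OF \<gamma> abs_sin_diff_le])
    from suminf_mult[OF this, of e]
    have "(\<Sum>n. \<gamma> ^ n * (e * sin (\<zeta> n) - e * sin (\<xi> n))) = e * (\<Sum>n. \<gamma> ^ n * (sin (\<zeta> n) - sin (\<xi> n)))"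
      by (simp add: algebra_simps)
    then show "\<bar>\<Sum>n. \<gamma> ^ n * (e * sin (\<zeta> n) - e * sin (\<xi> n))\<bar> \<le> \<eta>" using e tan(1) by auto
  qed (use \<gamma> opp quad tan in auto)
  have swap: "\<bar>\<Sum>n. r ^ n * (h n - f n)\<bar> \<le> \<eta>"
    if "\<bar>\<Sum>n. r ^ n * (f n - h n)\<bar> \<le> \<eta>" "0 \<le> r" "r < 1" "\<And>n. \<bar>f n - h n\<bar> \<le> 2"
    for r :: real and f h :: "nat \<Rightarrow> real"
    using that(1) suminf_minus[OF summable_power_bounded[OF that(2,3), of "\<lambda>n. f n - h n" 2, OF that(4)]] by (simp add: algebra_simps)
  \<comment> \<open>The reflection aligns the signs of cosine and sine at the start; if the cosine
    is negative, exchanging the orbits then leads to the first quadrant.\<close>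
  define e :: real where "e = (if (0 \<le> cos (\<alpha> 0)) = (0 \<le> sin (\<alpha> 0)) then 1 else - 1)"
  have e: "e = 1 \<or> e = - 1" unfolding e_def by auto
  show "\<bar>sin \<phi>\<bar> \<le> s0"
  proof (cases "0 \<le> cos (\<alpha> 0)")
    case True
    then have "0 \<le> e * sin (\<alpha> 0)" unfolding e_def by auto
    from bound[OF orbits[OF orb opp e True this tan]] show ?thesis using c0 True by simp
  next
    case False
    then have quad: "0 \<le> cos (\<beta> 0)" "0 \<le> e * sin (\<beta> 0)" unfolding e_def opp by auto
    have opp': "cos (\<alpha> 0) = - cos (\<beta> 0)" "sin (\<alpha> 0) = - sin (\<beta> 0)" using opp by auto
    have "\<bar>\<Sum>n. \<gamma> ^ n * (sin (\<beta> n) - sin (\<alpha> n))\<bar> \<le> \<eta>"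
      using tan(1) \<gamma> abs_sin_diff_le by (rule swap)
    moreover have "\<bar>\<Sum>n. (\<gamma> / 2) ^ n * (cos (\<beta> n) - cos (\<alpha> n))\<bar> \<le> \<eta>"
      using tan(2) _ _ abs_cos_diff_le by (rule swap) (use \<gamma> in auto)
    ultimately have "cos (\<beta> 0) \<le> s0" by (rule bound[OF orbits[OF orb(2,1) opp' e quad]])
    then show ?thesis using c0 opp(1) False by simp
  qed
qed simp

context opposite_doubling_orbits
begin

lemma PQ_sum_le:
  assumes "cc \<le> c 0" "0 \<le> cc" "0 \<le> h" "1 - cc\<^sup>2 \<le> (h\<^sup>2 - 1)\<^sup>2" "1 \<le> h"
  shows "P + Q \<le> h"
proof -
  have "(s 0)\<^sup>2 = 1 - (c 0)\<^sup>2" using circle(1)[of 0] by linarith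
  also have "\<dots> \<le> 1 - cc\<^sup>2" using assms by (simp add: power_mono)
  finally have "(s 0)\<^sup>2 \<le> (h\<^sup>2 - 1)\<^sup>2" using assms(4) by linarith
  moreover have "0 \<le> h\<^sup>2 - 1" using assms(5) by simp
  ultimately have "s 0 \<le> h\<^sup>2 - 1" by (rule power2_le_imp_le)
  then have "(P + Q)\<^sup>2 \<le> h\<^sup>2" unfolding PQ_sum_sq by simp
  then show ?thesis using assms(3) by (rule power2_le_imp_le)
qed

text \<open>The cosine sum alone: the worst case is \<open>c 1 = - P\<close>, \<open>d 1 = Q\<close>.\<close>
lemma cosine_sum_contradiction:
  assumes le: "\<gamma> \<le> 2 * g0" "g0 \<le> 1 / 2" and c0: "cc \<le> c 0" "0 < cc"
    and h: "1 \<le> h" "1 - cc\<^sup>2 \<le> (h\<^sup>2 - 1)\<^sup>2"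
    and P0: "0 \<le> P0" "P0\<^sup>2 \<le> (1 + cc) / 2" "(1 - P0) / 2 \<le> u\<^sup>2" "0 \<le> u"
    and Q0: "0 \<le> Q0" "(1 - cc) / 2 \<le> Q0\<^sup>2" "(1 + Q0) / 2 \<le> v\<^sup>2" "0 \<le> v"
    and T0: "(1 + g0\<^sup>2 / 8) / (1 - g0\<^sup>2) + 1 / (1 - g0) \<le> T0"
    and first: "g0 * h + g0\<^sup>2 * (u + v) + g0 ^ 3 * T0 + \<eta> < 2 * cc"
    and second: "g0\<^sup>2 * T0 + \<eta> < (2 - g0) * cc"
  shows False
proof -
  let ?g = "\<gamma> / 2"
  have g: "0 \<le> ?g" "?g \<le> g0" "0 \<le> g0" "g0 < 1" using \<gamma> le by auto
  have "T ?g \<le> T0" using T_mono[OF g(1,2,4)] T0 unfolding T_def by linarith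
  moreover have "0 \<le> T ?g" using g by (intro T_nonneg) auto
  ultimately have T: "0 \<le> T0" "?g\<^sup>2 * T ?g \<le> g0\<^sup>2 * T0" "?g ^ 3 * T ?g \<le> g0 ^ 3 * T0"
    using g by (auto intro!: mult_mono power_mono)
  have PQS: "P + Q \<le> h" by (rule PQ_sum_le[OF c0(1)]) (use c0 h in auto)
  \<comment> \<open>Every sign choice except \<open>c 1 = - P\<close>, \<open>d 1 = Q\<close>
    satisfies this inequality, and there two explicit terms of the cosine sum already
    suffice.\<close>
  have cases_rest: "\<not> (- (P - Q) \<le> c 1 - d 1)"
  proof
    assume "- (P - Q) \<le> c 1 - d 1"
    then have "?g * - (P - Q) \<le> ?g * (c 1 - d 1)" using g by (intro mult_left_mono) auto
    moreover have "?g * (P - Q) \<le> g0 * c 0" using g PQ_diff by (intro mult_mono) auto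
    moreover have "(2 - g0) * cc \<le> (2 - g0) * c 0" using c0 g by (intro mult_left_mono) auto
    ultimately show False
      using cosine_expand_2 T(2) second by (simp only: left_diff_distrib mult_minus_right)
  qed
  have "c 1 = - P" "d 1 = Q"
    using second_points cases_rest PQ PQ_sum by auto
  have "P0 \<le> P"
  proof (rule power2_le_imp_le)
    show "P0\<^sup>2 \<le> P\<^sup>2" unfolding PQ(1) using P0(2) c0 by (simp add: field_simps)
  qed (use PQ in auto)
  have "Q \<le> Q0"
  proof (rule power2_le_imp_le)
    show "Q\<^sup>2 \<le> Q0\<^sup>2" unfolding PQ(2) using Q0(2) c0 by (simp add: field_simps)
  qed (use Q0 in auto)
  have "\<bar>c 2\<bar> \<le> u"
  proof (rule power2_le_imp_le)
    have "(c 2)\<^sup>2 = (1 - P) / 2" using double(1)[of 1] \<open>c 1 = - P\<close> by (simp add: numeral_2_eq_2)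
    then show "\<bar>c 2\<bar>\<^sup>2 \<le> u\<^sup>2" using P0(3) \<open>P0 \<le> P\<close> by simp
  qed (use P0 in auto)
  moreover have "\<bar>d 2\<bar> \<le> v"
  proof (rule power2_le_imp_le)
    have "(d 2)\<^sup>2 = (1 + Q) / 2" using double(3)[of 1] \<open>d 1 = Q\<close> by (simp add: numeral_2_eq_2)
    then show "\<bar>d 2\<bar>\<^sup>2 \<le> v\<^sup>2" using Q0(3) \<open>Q \<le> Q0\<close> by simp
  qed (use Q0 in auto)
  \<comment> \<open>The signs at the third points are unknown, so both cosines enter with the worst
    sign.\<close>
  ultimately have "- (u + v) \<le> c 2 - d 2" by linarith
  then have "?g\<^sup>2 * - (u + v) \<le> ?g\<^sup>2 * (c 2 - d 2)" by (intro mult_left_mono) auto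
  moreover have "?g\<^sup>2 * (u + v) \<le> g0\<^sup>2 * (u + v)"
    using g P0 Q0 by (intro mult_right_mono power_mono) auto
  moreover have "?g * (P + Q) \<le> g0 * h" using g PQS PQ by (intro mult_mono) auto
  moreover have "?g * (c 1 - d 1) = - (?g * (P + Q))"
    using \<open>c 1 = - P\<close> \<open>d 1 = Q\<close> by (simp add: algebra_simps)
  moreover have "?g\<^sup>2 * - (u + v) = - (?g\<^sup>2 * (u + v))" by (rule mult_minus_right)
  ultimately show False
    using cosine_expand_3 T(3) first c0 by linarith
qed

end

text \<open>The trigonometric potential \<open>a + p sin - r cos\<close> dominates the sine sums of backward orbits. For its
  two choices of coefficients the required inequality is a sum of squares on the unit circle.\<close>

lemma potential_mono:
  fixes a p r \<gamma> \<gamma>0 S C :: real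
  assumes "0 \<le> \<gamma>" "\<gamma> \<le> \<gamma>0" "\<bar>p\<bar> + \<bar>r\<bar> \<le> a" "S\<^sup>2 + C\<^sup>2 = 1"
    and main: "- S + \<gamma>0 * (a + p * S - r * C) \<le> a + p * (2 * S * C) - r * (2 * C\<^sup>2 - 1)"
  shows "- S + \<gamma> * (a + p * S - r * C) \<le> a + p * (2 * S * C) - r * (2 * C\<^sup>2 - 1)"
proof -
  have "S\<^sup>2 \<le> 1" "C\<^sup>2 \<le> 1" using assms(4) zero_le_power2[of S] zero_le_power2[of C] by linarith+
  then have "\<bar>S\<bar> \<le> 1" "\<bar>C\<bar> \<le> 1" by (simp_all add: abs_square_le_1)
  then have "\<bar>p * S\<bar> \<le> \<bar>p\<bar> * 1" "\<bar>r * C\<bar> \<le> \<bar>r\<bar> * 1"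
    unfolding abs_mult by (intro mult_left_mono; simp)+
  then have "0 \<le> a + p * S - r * C" using assms(3) by linarith
  then have "\<gamma> * (a + p * S - r * C) \<le> \<gamma>0 * (a + p * S - r * C)" using assms by (intro mult_right_mono)
  then show ?thesis using main by linarith
qed

lemma potential_mid:
  fixes S C :: real
  assumes "S\<^sup>2 + C\<^sup>2 = 1"
  shows "- S + 53/80 * (1.97 + 0.2 * S - 0.34 * C) \<le> 1.97 + 0.2 * (2 * S * C) - 0.34 * (2 * C\<^sup>2 - 1)"
proof -
  \<comment> \<open>Adding 3/4 times \<open>S\<^sup>2 + C\<^sup>2 - 1\<close>, which vanishes on the
    circle, makes the difference of the two sides a positive definite quadratic polynomial;
    completing squares leaves a positive constant.\<close>
  have "0 \<le> 3/4 * (S + 4/15 * C + 347/600)\<^sup>2 + 1/60 * (C - 73/400)\<^sup>2 + 11097/3200000" by simp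
  also have "\<dots> = 1.97 + 0.2 * (2 * S * C) - 0.34 * (2 * C\<^sup>2 - 1) - (- S + 53/80 * (1.97 + 0.2 * S - 0.34 * C))
      + 3/4 * (S\<^sup>2 + C\<^sup>2 - 1)"
    by (simp add: power2_eq_square field_simps)
  finally show ?thesis using assms by simp
qed

lemma potential_low:
  fixes S C :: real
  assumes "S\<^sup>2 + C\<^sup>2 = 1"
  shows "- S + 1149/2000 * (1.59 + 0.15 * S - 0.33 * C) \<le> 1.59 + 0.15 * (2 * S * C) - 0.33 * (2 * C\<^sup>2 - 1)"
proof -
  have "0 \<le> 7/10 * (S + 3/14 * C + 36553/56000)\<^sup>2 + 11/1400 * (C - 1587/4000)\<^sup>2 + 2826691/400000000" by simp
  also have "\<dots> = 1.59 + 0.15 * (2 * S * C) - 0.33 * (2 * C\<^sup>2 - 1)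
      - (- S + 1149/2000 * (1.59 + 0.15 * S - 0.33 * C)) + 7/10 * (S\<^sup>2 + C\<^sup>2 - 1)"
    by (simp add: power2_eq_square field_simps)
  finally show ?thesis using assms by simp
qed

section \<open>The lower range of \<gamma> for base two\<close>

context opposite_doubling_orbits
begin

text \<open>First \<open>c 0 < 0.45\<close>, so \<open>s 0 >= 0.89\<close>. The choice
  \<open>c 1 = P\<close>, \<open>d 1 = - Q\<close> adds \<open>P + Q >= 1\<close> to the cosine
  difference, which the tail cannot cancel; both choices with \<open>d 1 = Q\<close> leave the sine
  sum too large. In the last choice the second cosine term is only \<open>- (P - Q)\<close>, at most
  \<open>c 0\<close> in size, and this yields the bound 0.18.\<close>

lemma second_points_mid:
  assumes \<gamma>': "1 / 2 \<le> \<gamma>" "\<gamma> \<le> 53/80" and \<eta>: "\<eta> \<le> 1/1000"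
  shows "c 1 = - P" "s 1 = - Q" "d 1 = - Q" "t 1 = P" "c 0 < 0.18"
proof -
  let ?g = "\<gamma> / 2"
  have g: "1 / 4 \<le> ?g" "?g \<le> 53/160" using \<gamma>' by auto
  have T0: "(1 + (53/160)\<^sup>2 / 8) / (1 - (53/160)\<^sup>2) + 1 / (1 - 53/160) \<le> (2.635::real)"
    by (simp add: power2_eq_square)
  have "T ?g \<le> T (53/160)" using g by (intro T_mono) auto
  also have "\<dots> \<le> 2.635" unfolding T_def by (rule T0)
  finally have T: "T ?g \<le> 2.635" .
  have gT: "?g\<^sup>2 * T ?g \<le> 0.2892"
  proof -
    have "?g\<^sup>2 * T ?g \<le> ?g\<^sup>2 * 2.635" using T by (intro mult_left_mono) auto
    also have "\<dots> \<le> (53/160)\<^sup>2 * 2.635" using g by (intro mult_right_mono power_mono) auto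
    also have "\<dots> \<le> 0.2892" by (simp add: power2_eq_square)
    finally show ?thesis .
  qed
  have c45: "c 0 < 0.45"
  proof (rule ccontr)
    assume "\<not> c 0 < 0.45"
    then show False
      by (intro cosine_sum_contradiction[where ?g0.0 = "53/160" and cc = "0.45" and h = "1.3759" and ?P0.0 = "0.85"
            and u = "0.274" and ?Q0.0 = "0.525" and v = "0.874" and ?T0.0 = "2.635"])
        (use g T0 \<eta> in \<open>auto simp: power2_eq_square power3_eq_cube\<close>)
  qed
  have s89: "0.89 \<le> s 0"
  proof (rule power2_le_imp_le)
    have "(c 0)\<^sup>2 \<le> 0.45\<^sup>2" using c45 quadrant by (intro power_mono) auto
    then show "0.89\<^sup>2 \<le> (s 0)\<^sup>2" using circle(1)[of 0] by (simp add: power2_eq_square)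
  qed (rule quadrant)
  have \<gamma>2: "\<gamma>\<^sup>2 * 1.97 \<le> 0.87"
  proof -
    have "\<gamma>\<^sup>2 \<le> (53/80)\<^sup>2" using \<gamma>' \<gamma> by (intro power_mono) auto
    then show ?thesis by (simp add: power2_eq_square)
  qed
  have sine: "2 * s 0 + \<gamma> * (s 1 - t 1)
      \<le> \<gamma>\<^sup>2 * ((1.97 + 0.2 * s 1 - 0.34 * c 1) + (1.97 - 0.2 * t 1 - 0.34 * d 1)) + \<eta>"
    by (rule sine_expand, rule potential_mono[OF \<gamma>(1) \<gamma>'(2) _ _ potential_mid]) auto
  have not_plus: "c 1 \<noteq> P"
  proof
    assume c1: "c 1 = P"
    then have s1: "s 1 = Q" using second_points PQ by auto
    from conjunct2[OF second_points] show False
    proof (elim conjE disjE)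
      assume "d 1 = - Q"
      then have "?g * 1 \<le> ?g * (c 1 - d 1)" using c1 PQ_sum g by (intro mult_left_mono) auto
      moreover have "?g\<^sup>2 * T ?g \<le> ?g * 0.873"
      proof -
        have "?g * T ?g \<le> 53/160 * 2.635" using T g T_nonneg[of ?g] by (intro mult_mono) auto
        then have "?g * T ?g \<le> 0.873" by simp
        then have "?g * (?g * T ?g) \<le> ?g * 0.873" using g by (intro mult_left_mono) auto
        then show ?thesis by (simp add: power2_eq_square)
      qed
      ultimately have "?g \<le> ?g * 0.873 + \<eta>" using cosine_expand_2 quadrant(1) by linarith
      then show False using g \<eta> by simp
    next
      assume dt: "d 1 = Q" "t 1 = - P"
      have pot: "(1.97 + 0.2 * s 1 - 0.34 * c 1) + (1.97 - 0.2 * t 1 - 0.34 * d 1) = 2 * 1.97 - 0.14 * (P + Q)"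
        and diff: "s 1 - t 1 = P + Q"
        unfolding c1 s1 dt by (simp_all add: field_simps)
      have "2 * s 0 + \<gamma> * (P + Q) \<le> \<gamma>\<^sup>2 * (2 * 1.97 - 0.14 * (P + Q)) + \<eta>"
        using sine unfolding pot diff .
      also have "\<dots> \<le> \<gamma>\<^sup>2 * (2 * 1.97) + \<eta>" using PQ_sum by (intro add_right_mono mult_left_mono) auto
      finally have "2 * s 0 + \<gamma> * (P + Q) \<le> \<gamma>\<^sup>2 * (2 * 1.97) + \<eta>" .
      moreover have "0 \<le> \<gamma> * (P + Q)" using \<gamma> PQ_sum by simp
      ultimately show False using s89 \<gamma>2 \<eta> by simp
    qed
  qed
  then show c1: "c 1 = - P" and s1: "s 1 = - Q" using second_points by auto
  have "d 1 \<noteq> Q \<or> t 1 \<noteq> - P"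
  proof (rule ccontr)
    assume "\<not> (d 1 \<noteq> Q \<or> t 1 \<noteq> - P)"
    then have dt: "d 1 = Q" "t 1 = - P" by auto
    have pot: "(1.97 + 0.2 * s 1 - 0.34 * c 1) + (1.97 - 0.2 * t 1 - 0.34 * d 1) = 2 * 1.97 + 0.54 * (P - Q)"
      and diff: "s 1 - t 1 = P - Q"
      unfolding c1 s1 dt by (simp_all add: field_simps)
    have "2 * s 0 + \<gamma> * (P - Q) \<le> \<gamma>\<^sup>2 * (2 * 1.97 + 0.54 * (P - Q)) + \<eta>"
      using sine unfolding pot diff .
    moreover have "\<gamma>\<^sup>2 * (0.54 * (P - Q)) \<le> \<gamma> * (P - Q)"
    proof -
      have "\<gamma> * 0.54 \<le> 1" using \<gamma>' by simp
      then have "(\<gamma> * 0.54) * (\<gamma> * (P - Q)) \<le> 1 * (\<gamma> * (P - Q))"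
        using \<gamma> PQ_diff by (intro mult_right_mono) auto
      then show ?thesis by (simp add: power2_eq_square mult_ac)
    qed
    ultimately have "2 * s 0 \<le> \<gamma>\<^sup>2 * (2 * 1.97) + \<eta>" by (simp add: distrib_left)
    then show False using s89 \<gamma>2 \<eta> by simp
  qed
  then show d1: "d 1 = - Q" and t1: "t 1 = P" using second_points by auto
  have "?g * (P - Q) \<le> 53/160 * c 0" using g PQ_diff by (intro mult_mono) auto
  then have "2 * c 0 - 53/160 * c 0 \<le> 0.2892 + \<eta>"
    using cosine_expand_2 gT c1 d1 by (simp add: algebra_simps)
  then show "c 0 < 0.18" using \<eta> by simp
qed

text \<open>With the signs known, the squares of \<open>c 2\<close> and \<open>d 2\<close> add up to
  \<open>1 - (P + Q) / 2\<close>, which is small because \<open>P + Q\<close> is close to sqrt 2. A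
  third explicit cosine term then halves the bound.\<close>

lemma c0_less_fine:
  assumes \<gamma>': "1 / 2 \<le> \<gamma>" "\<gamma> \<le> 0.6105" and \<eta>: "\<eta> \<le> 1/1000"
  shows "c 0 < 0.09"
proof -
  let ?g = "\<gamma> / 2"
  have "\<gamma> \<le> 53/80" using \<gamma>'(2) by simp
  note mid = second_points_mid[OF \<gamma>'(1) this \<eta>]
  have g: "0 \<le> ?g" "?g \<le> 0.30525" using \<gamma>' by auto
  have T0: "(1 + 0.30525\<^sup>2 / 8) / (1 - 0.30525\<^sup>2) + 1 / (1 - 0.30525) \<le> (2.56::real)"
    by (simp add: power2_eq_square)
  have "T ?g \<le> T 0.30525" using g by (intro T_mono) auto
  also have "\<dots> \<le> 2.56" unfolding T_def by (rule T0)
  finally have T: "T ?g \<le> 2.56" .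
  have "?g ^ 3 * T ?g \<le> ?g ^ 3 * 2.56" using T g by (intro mult_left_mono) auto
  also have "\<dots> \<le> 0.30525 ^ 3 * 2.56" using g by (intro mult_right_mono power_mono) auto
  also have "\<dots> \<le> 0.073" by (simp add: power3_eq_cube)
  finally have gT: "?g ^ 3 * T ?g \<le> 0.073" .
  have "(c 0)\<^sup>2 \<le> 0.18\<^sup>2" using mid(5) quadrant by (intro power_mono) auto
  then have s0: "0.98\<^sup>2 \<le> (s 0)\<^sup>2" using circle(1)[of 0] by (simp add: power2_eq_square)
  have "0.98 \<le> s 0" using s0 quadrant(2) by (rule power2_le_imp_le)
  then have "1.407\<^sup>2 \<le> (P + Q)\<^sup>2" unfolding PQ_sum_sq by (simp add: power2_eq_square)
  then have PQ': "1.407 \<le> P + Q" by (rule power2_le_imp_le) (use PQ_sum in auto)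
  have "(\<bar>c 2\<bar> + \<bar>d 2\<bar>)\<^sup>2 \<le> 2 * ((c 2)\<^sup>2 + (d 2)\<^sup>2)"
    using zero_le_power2[of "\<bar>c 2\<bar> - \<bar>d 2\<bar>"] by (simp add: power2_sum power2_diff)
  also have "\<dots> = 2 - (P + Q)"
  proof -
    have "(c 2)\<^sup>2 = (1 - P) / 2" "(d 2)\<^sup>2 = (1 - Q) / 2"
      using double(1,3)[of 1] mid by (simp_all add: numeral_2_eq_2)
    then show ?thesis by simp
  qed
  also have "\<dots> \<le> 0.771\<^sup>2" using PQ' by (simp add: power2_eq_square)
  finally have "\<bar>c 2\<bar> + \<bar>d 2\<bar> \<le> 0.771" by (rule power2_le_imp_le) simp
  then have "- 0.771 \<le> c 2 - d 2" by simp
  then have "?g\<^sup>2 * - 0.771 \<le> ?g\<^sup>2 * (c 2 - d 2)" by (intro mult_left_mono) auto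
  moreover have "?g\<^sup>2 * 0.771 \<le> 0.30525\<^sup>2 * 0.771" using g by (intro mult_right_mono power_mono) auto
  moreover have "?g * (P - Q) \<le> 0.30525 * c 0" using g PQ_diff by (intro mult_mono) auto
  ultimately have "2 * c 0 - 0.30525 * c 0 \<le> 0.072 + 0.073 + \<eta>"
    using cosine_expand_3 gT mid(1,3) by (simp add: algebra_simps power2_eq_square)
  then show ?thesis using \<eta> by simp
qed

text \<open>Now \<open>2 * s 0 >= 1.99\<close>, while the potential fitted to the upper end 0.5745
  lets the remaining sine terms cancel at most about 1.95.\<close>

lemma low_contradiction:
  assumes \<gamma>': "1 / 2 \<le> \<gamma>" "\<gamma> \<le> 0.5745" and \<eta>: "\<eta> \<le> 1/1000"
  shows False
proof -
  have "\<gamma> \<le> 53/80" "\<gamma> \<le> 0.6105" "\<gamma> \<le> 1149/2000" using \<gamma>'(2) by auto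
  note mid = second_points_mid[OF \<gamma>'(1) this(1) \<eta>] c0_less_fine[OF \<gamma>'(1) this(2) \<eta>]
  have "(c 0)\<^sup>2 \<le> 0.09\<^sup>2" using mid(6) quadrant by (intro power_mono) auto
  then have s0: "0.995\<^sup>2 \<le> (s 0)\<^sup>2" using circle(1)[of 0] by (simp add: power2_eq_square)
  have s1: "0.995 \<le> s 0" using s0 quadrant(2) by (rule power2_le_imp_le)
  have pot: "(1.59 + 0.15 * s 1 - 0.33 * c 1) + (1.59 - 0.15 * t 1 - 0.33 * d 1) = 3.18 + 0.18 * (P + Q)"
    unfolding mid by (simp add: field_simps)
  have diff: "\<gamma> * (s 1 - t 1) = - (\<gamma> * (P + Q))"
    unfolding mid by (simp add: algebra_simps)
  have "2 * s 0 + \<gamma> * (s 1 - t 1)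
      \<le> \<gamma>\<^sup>2 * ((1.59 + 0.15 * s 1 - 0.33 * c 1) + (1.59 - 0.15 * t 1 - 0.33 * d 1)) + \<eta>"
    by (rule sine_expand, rule potential_mono[OF \<gamma>(1) \<open>\<gamma> \<le> 1149/2000\<close> _ _ potential_low]) auto
  then have "2 * s 0 \<le> \<gamma> * (P + Q) + \<gamma>\<^sup>2 * (3.18 + 0.18 * (P + Q)) + \<eta>"
    unfolding pot diff by linarith
  also have "\<dots> \<le> 0.5745 * 1.41422 + 0.5745\<^sup>2 * (3.18 + 0.18 * 1.41422) + 1/1000"
    using \<gamma> \<gamma>' \<eta> PQ_sum by (intro add_mono mult_mono power_mono) auto
  also have "\<dots> < 2 * 0.995" by (simp add: power2_eq_square)
  finally show False using s1 by simp
qed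

end

section \<open>Weights for base two\<close>

lemma abs_cos_pi_le_imp_near_half:
  assumes "x \<in> {0..<1}" "0 < \<delta>" "\<delta> \<le> 1 / 2" "s0 < sin (pi * \<delta>)" "\<bar>cos (pi * x)\<bar> \<le> s0"
  shows "\<bar>x - 1 / 2\<bar> < \<delta>"
proof (rule ccontr)
  assume far: "\<not> \<bar>x - 1 / 2\<bar> < \<delta>"
  have even: "\<bar>sin (pi * \<bar>y\<bar>)\<bar> = \<bar>sin (pi * y)\<bar>" for y :: real
    by (cases "0 \<le> y") auto
  have "sin (pi * \<delta>) \<le> sin (pi * \<bar>x - 1 / 2\<bar>)"
  proof (rule sin_monotone_2pi_le)
    have "0 \<le> pi * \<delta>" using assms by simp
    then show "- (pi / 2) \<le> pi * \<delta>" using pi_gt_zero by linarith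
    show "pi * \<delta> \<le> pi * \<bar>x - 1 / 2\<bar>" using far by simp
    have "\<bar>x - 1 / 2\<bar> \<le> 1 / 2" unfolding abs_le_iff using assms(1) by auto
    from mult_left_mono[OF this, of pi] show "pi * \<bar>x - 1 / 2\<bar> \<le> pi / 2" by simp
  qed
  also have "\<dots> \<le> \<bar>sin (pi * \<bar>x - 1 / 2\<bar>)\<bar>" by simp
  also have "\<dots> = \<bar>sin (pi * (x - 1 / 2))\<bar>" by (rule even)
  also have "pi * (x - 1 / 2) = pi * x - pi / 2" by (simp add: algebra_simps)
  also have "\<bar>sin (pi * x - pi / 2)\<bar> = \<bar>cos (pi * x)\<bar>" by (simp add: sin_diff)
  finally show False using assms by linarith
qed

text \<open>The only pair of distinct digits is {0, 1}, with
  \<open>\<phi> = pi * x + pi / 2\<close>. Confinement thus means that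
  \<open>\<bar>cos (pi * x)\<bar>\<close> is small, which puts \<open>x\<close> within \<delta> of
  1/2, and uniqueness of partners is automatic.\<close>

lemma sigma_one_le_base_2:
  fixes \<tau> :: "real \<Rightarrow> nat"
  assumes \<gamma>: "0 \<le> \<gamma>" "\<gamma> < 1" and conf: "confined 2 \<gamma> s0"
    and \<delta>: "0 < \<delta>" "\<delta> \<le> 1 / 2" "s0 < sin (pi * \<delta>)" and \<rho>: "\<rho> > 1"
    and \<tau>: "\<tau> \<in> measurable borel (count_space UNIV)" "\<And>x. \<tau> x \<le> N"
    and step: "\<And>x. 0 \<le> x \<Longrightarrow> x < 1 \<Longrightarrow> \<tau> x \<le> \<tau> (x / 2) + 1 \<and> \<tau> x \<le> \<tau> ((x + 1) / 2) + 1"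
    and pair: "\<And>x. \<bar>x - 1 / 2\<bar> < \<delta> \<Longrightarrow>
      \<tau> x = 0 \<and> 1 \<le> (\<rho> ^ Suc (\<tau> (x / 2)) - 1) * (\<rho> ^ Suc (\<tau> ((x + 1) / 2)) - 1)"
  shows "sigma 2 \<gamma> psi 1 \<le> ereal \<rho>"
proof (rule sigma_one_le_matching[OF _ \<gamma> conf \<rho> \<tau>])
  have lt2: "k = 0 \<or> k = 1" if "k < 2" for k :: nat using that by auto
  show "l = l'" if "k < 2" "l < 2" "l' < 2" "l \<noteq> k" "l' \<noteq> k" for k l l' :: nat using that by linarith
  show "\<tau> x \<le> \<tau> ((x + real k) / real 2) + 1" if "x \<in> {0..<1}" "k < 2" for x k
    using step[of x] that(1) lt2[OF that(2)] by auto
  show "\<tau> x = 0 \<and> 1 \<le> (\<rho> ^ Suc (\<tau> ((x + real k) / real 2)) - 1) * (\<rho> ^ Suc (\<tau> ((x + real l) / real 2)) - 1)"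
    if x: "x \<in> {0..<1}" and kl: "k < 2" "l < 2" "k \<noteq> l"
      and small: "\<bar>sin (pi * (2 * x + real k + real l) / real 2)\<bar> \<le> s0" for x k l
  proof -
    have kl1: "2 * x + real k + real l = 2 * x + 1" using lt2[OF kl(1)] lt2[OF kl(2)] kl(3) by auto
    have "pi * (2 * x + real k + real l) / real 2 = pi * x + pi / 2"
      unfolding kl1 by (simp add: field_simps)
    then have "\<bar>cos (pi * x)\<bar> \<le> s0" using small by (simp only: sin_add) simp
    then have "\<bar>x - 1 / 2\<bar> < \<delta>" by (rule abs_cos_pi_le_imp_near_half[OF x \<delta>])
    from pair[OF this] show ?thesis using lt2[OF kl(1)] lt2[OF kl(2)] kl(3) by (auto simp: mult.commute)
  qed
qed simp

lemma confined_base_2_cosine: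
  fixes cc :: real
  assumes \<gamma>: "0 \<le> \<gamma>" "\<gamma> < 1" and le: "\<gamma> \<le> 2 * g0" "g0 \<le> 1 / 2" and c0: "0 < cc"
    and h: "1 \<le> h" "1 - cc\<^sup>2 \<le> (h\<^sup>2 - 1)\<^sup>2"
    and P0: "0 \<le> P0" "P0\<^sup>2 \<le> (1 + cc) / 2" "(1 - P0) / 2 \<le> u\<^sup>2" "0 \<le> u"
    and Q0: "0 \<le> Q0" "(1 - cc) / 2 \<le> Q0\<^sup>2" "(1 + Q0) / 2 \<le> v\<^sup>2" "0 \<le> v"
    and T0: "(1 + g0\<^sup>2 / 8) / (1 - g0\<^sup>2) + 1 / (1 - g0) \<le> T0"
    and first: "g0 * h + g0\<^sup>2 * (u + v) + g0 ^ 3 * T0 + 1/1000 < 2 * cc"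
    and second: "g0\<^sup>2 * T0 + 1/1000 < (2 - g0) * cc"
  shows "confined 2 \<gamma> cc"
proof (rule confined_base_2[OF \<gamma>, where \<eta> = "1/1000"])
  fix c s d t assume "opposite_doubling_orbits \<gamma> (1/1000) c s d t"
  then interpret opposite_doubling_orbits \<gamma> "1/1000" c s d t .
  show "c 0 \<le> cc"
  proof (rule ccontr)
    assume "\<not> c 0 \<le> cc"
    then have "cc \<le> c 0" by simp
    from cosine_sum_contradiction[OF le this c0 h P0 Q0 T0 first second] show False .
  qed
qed simp

lemma confined_base_2_mid:
  assumes "1 / 2 \<le> \<gamma>"
  shows "\<gamma> \<le> 53/80 \<Longrightarrow> confined 2 \<gamma> 0.18" and "\<gamma> \<le> 0.6105 \<Longrightarrow> confined 2 \<gamma> 0.09"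
    and "\<gamma> \<le> 0.5745 \<Longrightarrow> confined 2 \<gamma> (- 1)"
proof -
  have *: "confined 2 \<gamma> s0"
    if "\<gamma> < 1" "\<And>c s d t. opposite_doubling_orbits \<gamma> (1/1000) c s d t \<Longrightarrow> c 0 \<le> s0" for s0
    using assms that by (intro confined_base_2[where \<eta> = "1/1000"]) auto
  show "\<gamma> \<le> 53/80 \<Longrightarrow> confined 2 \<gamma> 0.18"
    by (rule *) (use assms in \<open>auto dest: opposite_doubling_orbits.second_points_mid(5)\<close>)
  show "\<gamma> \<le> 0.6105 \<Longrightarrow> confined 2 \<gamma> 0.09"
    by (rule *) (use assms in \<open>auto dest: opposite_doubling_orbits.c0_less_fine\<close>)
  show "\<gamma> \<le> 0.5745 \<Longrightarrow> confined 2 \<gamma> (- 1)"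
    by (rule *) (use assms in \<open>auto dest: opposite_doubling_orbits.low_contradiction\<close>)
qed

lemma sin_pi_frac_bounds: "0.382 < sin (pi * (1 / 8))" "0.18 < sin (pi * (1 / 16))" "0.09 < sin (pi * (1 / 34))"
proof -
  have *: "y0 - y1 ^ 3 / 6 \<le> sin y" if "0 \<le> y0" "y0 \<le> y" "y \<le> y1" for y y0 y1 :: real
  proof -
    have "y ^ 3 \<le> y1 ^ 3" using that by (intro power_mono) auto
    then show ?thesis using sin_ge_cubic[of y] that by linarith
  qed
  have "0.39269 - 0.3927 ^ 3 / 6 \<le> sin (pi * (1 / 8))" using pi_approx by (intro *) auto
  then show "0.382 < sin (pi * (1 / 8))" by (simp add: power3_eq_cube)
  have "0.19 - 0.2 ^ 3 / 6 \<le> sin (pi * (1 / 16))" using pi_approx by (intro *) auto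
  then show "0.18 < sin (pi * (1 / 16))" by (simp add: power3_eq_cube)
  have "0.092 - 0.1 ^ 3 / 6 \<le> sin (pi * (1 / 34))" using pi_approx by (intro *) auto
  then show "0.09 < sin (pi * (1 / 34))" by (simp add: power3_eq_cube)
qed

text \<open>In each range of \<open>\<gamma>\<close> the weight exponent counts the steps that the inverse branches need to
  return to the interval around \<open>1/2\<close> that carries the tangent pairs.\<close>

lemma sigma_one_less_base_2:
  assumes \<gamma>: "1 / 2 < \<gamma>" "\<gamma> < 1"
  shows "sigma 2 \<gamma> psi 1 < ereal (real 2 * \<gamma>)"
proof -
  have \<gamma>0: "0 \<le> \<gamma>" using \<gamma> by simp
  have less: "sigma 2 \<gamma> psi 1 < ereal (real 2 * \<gamma>)" if "sigma 2 \<gamma> psi 1 \<le> ereal \<rho>" "\<rho> < 2 * \<gamma>" for \<rho>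
    using that by (metis ereal_less_eq(3) less_ereal.simps(1) of_nat_numeral order.strict_trans1)
  \<comment> \<open>The cut points are at least half of the bounds proved to the right of them:
    1.149, 1.221, 1.325, 1.4143 and 1.6181.\<close>
  consider "\<gamma> \<le> 0.5745" | "0.5745 < \<gamma>" "\<gamma> \<le> 0.6105" | "0.6105 < \<gamma>" "\<gamma> \<le> 53/80"
    | "53/80 < \<gamma>" "\<gamma> \<le> 0.7075" | "0.7075 < \<gamma>" "\<gamma> \<le> 0.81" | "0.81 < \<gamma>" by linarith
  then show ?thesis
  proof cases
    case 1
    then show ?thesis
      using \<gamma> confined_base_2_mid(3)[of \<gamma>] by (intro sigma_one_less_transversal) auto
  next
    case 2
    \<comment> \<open>As 1/2 - 1/34 = 8/17, the break points 1/17, 2/17 and 4/17 reach the central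
      interval by doubling. Both children of a central point have \<tau> = 4, so the condition is
      \<open>(\<rho> ^ 5 - 1)\<^sup>2 >= 1\<close>, that is \<open>\<rho> ^ 5 >= 2\<close>.\<close>
    define \<tau> :: "real \<Rightarrow> nat" where "\<tau> x = (if \<bar>x - 1 / 2\<bar> < 1 / 34 then 0
      else if x < 1 / 17 \<or> 16 / 17 < x then 1 else if x < 2 / 17 \<or> 15 / 17 < x then 2
      else if x < 4 / 17 \<or> 13 / 17 < x then 3 else 4)" for x
    have "sigma 2 \<gamma> psi 1 \<le> ereal 1.149"
    proof (rule sigma_one_le_base_2[OF \<gamma>0 \<gamma>(2), where \<tau> = \<tau> and N = 4 and \<delta> = "1 / 34"])
      show "confined 2 \<gamma> 0.09" using confined_base_2_mid(2) \<gamma> 2 by simp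
      show "\<tau> \<in> borel \<rightarrow>\<^sub>M count_space UNIV" unfolding \<tau>_def by measurable
      show "\<tau> x \<le> \<tau> (x / 2) + 1 \<and> \<tau> x \<le> \<tau> ((x + 1) / 2) + 1" if "0 \<le> x" "x < 1" for x
        using that unfolding \<tau>_def abs_less_iff by (auto simp: field_simps)
      fix x :: real assume "\<bar>x - 1 / 2\<bar> < 1 / 34"
      then have "\<tau> x = 0" "\<tau> (x / 2) = 4" "\<tau> ((x + 1) / 2) = 4"
        unfolding \<tau>_def abs_less_iff by (auto simp: field_simps)
      then show "\<tau> x = 0 \<and> 1 \<le> (1.149 ^ Suc (\<tau> (x / 2)) - 1) * (1.149 ^ Suc (\<tau> ((x + 1) / 2)) - (1::real))"
        by (simp add: eval_nat_numeral)
    qed (use sin_pi_frac_bounds in \<open>auto simp: \<tau>_def\<close>)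
    then show ?thesis using 2 by (intro less) auto
  next
    case 3
    \<comment> \<open>The children of a central point lie around 1/4 and 3/4 at distance 1/2, so at
      most one of them leaves [1/4, 3/4] and drops to \<tau> = 2. The worst exponents are 3 and
      4.\<close>
    define \<tau> :: "real \<Rightarrow> nat" where "\<tau> x = (if \<bar>x - 1 / 2\<bar> < 1 / 16 then 0
      else if x < 1 / 8 \<or> 7 / 8 < x then 1 else if x < 1 / 4 \<or> 3 / 4 < x then 2 else 3)" for x
    have "sigma 2 \<gamma> psi 1 \<le> ereal 1.221"
    proof (rule sigma_one_le_base_2[OF \<gamma>0 \<gamma>(2), where \<tau> = \<tau> and N = 3 and \<delta> = "1 / 16"])
      show "confined 2 \<gamma> 0.18" using confined_base_2_mid(1) \<gamma> 3 by simp
      show "\<tau> \<in> borel \<rightarrow>\<^sub>M count_space UNIV" unfolding \<tau>_def by measurable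
      show "\<tau> x \<le> \<tau> (x / 2) + 1 \<and> \<tau> x \<le> \<tau> ((x + 1) / 2) + 1" if "0 \<le> x" "x < 1" for x
        using that unfolding \<tau>_def abs_less_iff by (auto simp: field_simps)
      fix x :: real assume "\<bar>x - 1 / 2\<bar> < 1 / 16"
      then have "\<tau> x = 0" "\<tau> (x / 2) = 3 \<and> \<tau> ((x + 1) / 2) = 3 \<or> \<tau> (x / 2) = 2 \<and> \<tau> ((x + 1) / 2) = 3
          \<or> \<tau> (x / 2) = 3 \<and> \<tau> ((x + 1) / 2) = 2"
        unfolding \<tau>_def abs_less_iff by (auto simp: field_simps)
      then show "\<tau> x = 0 \<and> 1 \<le> (1.221 ^ Suc (\<tau> (x / 2)) - 1) * (1.221 ^ Suc (\<tau> ((x + 1) / 2)) - (1::real))"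
        by (auto simp: eval_nat_numeral)
    qed (use sin_pi_frac_bounds in \<open>auto simp: \<tau>_def\<close>)
    then show ?thesis using 3 by (intro less) auto
  next
    case 4
    \<comment> \<open>Again at most one child leaves [1/4, 3/4]; the worst exponents are 2 and 3,
      and 1.325 is just above the plastic number.\<close>
    define \<tau> :: "real \<Rightarrow> nat" where "\<tau> x = (if \<bar>x - 1 / 2\<bar> < 1 / 8 then 0
      else if x < 1 / 4 \<or> 3 / 4 < x then 1 else 2)" for x
    have "sigma 2 \<gamma> psi 1 \<le> ereal 1.325"
    proof (rule sigma_one_le_base_2[OF \<gamma>0 \<gamma>(2), where \<tau> = \<tau> and N = 2 and \<delta> = "1 / 8"])
      \<comment> \<open>\<open>g0\<close> is half the upper end of the range of \<gamma>. The other
        parameters are \<open>sqrt (1 + sqrt (1 - cc\<^sup>2))\<close> for \<open>h\<close>, the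
        half angle values \<open>P0\<close> and \<open>Q0\<close> of \<open>cc\<close>, the next
        half angle cosines \<open>u\<close> and \<open>v\<close>, and the tail constant
        \<open>T0\<close>, all rounded to the safe side.\<close>
      show "confined 2 \<gamma> 0.382"
        by (rule confined_base_2_cosine[where ?g0.0 = "0.35375" and h = "1.38716" and ?P0.0 = "0.8312"
              and u = "0.2906" and ?Q0.0 = "0.5559" and v = "0.8821" and ?T0.0 = "2.709"])
          (use \<gamma> 4 in \<open>auto simp: power2_eq_square power3_eq_cube\<close>)
      show "\<tau> \<in> borel \<rightarrow>\<^sub>M count_space UNIV" unfolding \<tau>_def by measurable
      show "\<tau> x \<le> \<tau> (x / 2) + 1 \<and> \<tau> x \<le> \<tau> ((x + 1) / 2) + 1" if "0 \<le> x" "x < 1" for x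
        using that unfolding \<tau>_def abs_less_iff by (auto simp: field_simps)
      fix x :: real assume "\<bar>x - 1 / 2\<bar> < 1 / 8"
      then have "\<tau> x = 0" "\<tau> (x / 2) = 2 \<and> \<tau> ((x + 1) / 2) = 2 \<or> \<tau> (x / 2) = 1 \<and> \<tau> ((x + 1) / 2) = 2
          \<or> \<tau> (x / 2) = 2 \<and> \<tau> ((x + 1) / 2) = 1"
        unfolding \<tau>_def abs_less_iff by (auto simp: field_simps)
      then show "\<tau> x = 0 \<and> 1 \<le> (1.325 ^ Suc (\<tau> (x / 2)) - 1) * (1.325 ^ Suc (\<tau> ((x + 1) / 2)) - (1::real))"
        by (auto simp: eval_nat_numeral)
    qed (use sin_pi_frac_bounds in \<open>auto simp: \<tau>_def\<close>)
    then show ?thesis using 4 by (intro less) auto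
  next
    case 5
    \<comment> \<open>The interval (1/3, 2/3) is disjoint from its images under both inverse
      branches, so both exponents are 2.\<close>
    define \<tau> :: "real \<Rightarrow> nat" where "\<tau> x = (if \<bar>x - 1 / 2\<bar> < 1 / 6 then 0 else 1)" for x
    have "sigma 2 \<gamma> psi 1 \<le> ereal 1.4143"
    proof (rule sigma_one_le_base_2[OF \<gamma>0 \<gamma>(2), where \<tau> = \<tau> and N = 1 and \<delta> = "1 / 6"])
      show "confined 2 \<gamma> 0.49"
        by (rule confined_base_2_cosine[where ?g0.0 = "0.405" and h = "1.3682" and ?P0.0 = "0.863"
              and u = "0.262" and ?Q0.0 = "0.505" and v = "0.868" and ?T0.0 = "2.902"])
          (use \<gamma> 5 in \<open>auto simp: power2_eq_square power3_eq_cube\<close>)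
      show "\<tau> \<in> borel \<rightarrow>\<^sub>M count_space UNIV" unfolding \<tau>_def by measurable
      fix x :: real assume "\<bar>x - 1 / 2\<bar> < 1 / 6"
      then have "\<tau> x = 0" "\<tau> (x / 2) = 1" "\<tau> ((x + 1) / 2) = 1"
        unfolding \<tau>_def abs_less_iff by (auto simp: field_simps)
      then show "\<tau> x = 0 \<and> 1 \<le> (1.4143 ^ Suc (\<tau> (x / 2)) - 1) * (1.4143 ^ Suc (\<tau> ((x + 1) / 2)) - (1::real))"
        by (simp add: eval_nat_numeral)
    qed (auto simp: \<tau>_def sin_30)
    then show ?thesis using 5 by (intro less) auto
  next
    case 6
    \<comment> \<open>At most one child of a point of (1/4, 3/4) returns to this interval; the worst
      exponents are 1 and 2.\<close>
    define \<tau> :: "real \<Rightarrow> nat" where "\<tau> x = (if \<bar>x - 1 / 2\<bar> < 1 / 4 then 0 else 1)" for x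
    have "sigma 2 \<gamma> psi 1 \<le> ereal 1.6181"
    proof (rule sigma_one_le_base_2[OF \<gamma>0 \<gamma>(2), where \<tau> = \<tau> and N = 1 and \<delta> = "1 / 4"])
      show "confined 2 \<gamma> 0.7"
        by (rule confined_base_2_cosine[where ?g0.0 = "1/2" and h = "1.3094" and ?P0.0 = "0.921"
              and u = "0.199" and ?Q0.0 = "0.3874" and v = "0.833" and ?T0.0 = "3.375"])
          (use \<gamma> in \<open>auto simp: power2_eq_square power3_eq_cube\<close>)
      show "\<tau> \<in> borel \<rightarrow>\<^sub>M count_space UNIV" unfolding \<tau>_def by measurable
      show "0.7 < sin (pi * (1 / 4))" using sqrt_2_bounds by (simp add: sin_45)
      fix x :: real assume "\<bar>x - 1 / 2\<bar> < 1 / 4"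
      then have "\<tau> x = 0" "\<tau> (x / 2) = 1 \<and> \<tau> ((x + 1) / 2) = 1 \<or> \<tau> (x / 2) = 0 \<and> \<tau> ((x + 1) / 2) = 1
          \<or> \<tau> (x / 2) = 1 \<and> \<tau> ((x + 1) / 2) = 0"
        unfolding \<tau>_def abs_less_iff by (auto simp: field_simps)
      then show "\<tau> x = 0 \<and> 1 \<le> (1.6181 ^ Suc (\<tau> (x / 2)) - 1) * (1.6181 ^ Suc (\<tau> ((x + 1) / 2)) - (1::real))"
        by (auto simp: eval_nat_numeral)
    qed (auto simp: \<tau>_def)
    then show ?thesis using 6 by (intro less) auto
  qed
qed

theorem theorem2p8:
  fixes b :: nat and gamma :: real
  assumes "b \<ge> 2" and "1 / real b < gamma" and "gamma < 1"
  shows "\<exists>q::nat. q > 0 \<and> sigma b gamma psi q < ereal ((real b * gamma) ^ q)"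
proof (intro exI[of _ 1] conjI)
  have "0 \<le> gamma" using assms(2) zero_le_divide_1_iff[of "real b"] by linarith
  have prod: "1 < real b * gamma" using assms(1,2) by (simp add: field_simps)
  \<comment> \<open>For \<open>b >= 4\<close> the cuts 2, 3 and 7 are values of the digit count: a
    matching gives 2, and \<open>4 * j - 1\<close> gives 3 and 7 for \<open>j = 1\<close> and
    \<open>j = 2\<close>.\<close>
  consider "b = 2" | "b = 3" | "b \<ge> 4" "real b * gamma \<le> 2" | "b \<ge> 4" "2 < real b * gamma" "real b * gamma \<le> 3"
    | "b \<ge> 4" "3 < real b * gamma" "real b * gamma \<le> 7" | "7 < real b * gamma"
    using assms(1) by linarith
  then have "sigma b gamma psi 1 < ereal (real b * gamma)"
  proof cases
    case 1
    then show ?thesis using sigma_one_less_base_2 assms by simp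
  next
    case 2
    then show ?thesis using sigma_one_less_base_3 assms by simp
  next
    case 3
    consider "b = 4" | "b = 5" | "b = 6" | "b \<ge> 7" using 3 by linarith
    then show ?thesis
    proof cases
      case 1
      then show ?thesis using sigma_one_less_base_4[of gamma] assms 3 by simp
    next
      case 2
      then show ?thesis using sigma_one_less_base_5[of gamma] assms 3 by simp
    next
      case 3
      then show ?thesis using sigma_one_less_base_6[of gamma] assms \<open>real b * gamma \<le> 2\<close> by simp
    next
      case 4
      then show ?thesis using sigma_one_less_small_product assms \<open>real b * gamma \<le> 2\<close> by blast
    qed
  next
    case 4
    then show ?thesis using sigma_one_less_count_2 assms \<open>0 \<le> gamma\<close> by blast
  next
    case 5
    then show ?thesis using sigma_one_less_count_3 assms \<open>0 \<le> gamma\<close> by blast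
  next
    case 6
    then show ?thesis using sigma_one_less_count_large[of b gamma] assms \<open>0 \<le> gamma\<close> by simp
  qed
  then show "sigma b gamma psi 1 < ereal ((real b * gamma) ^ 1)" by simp
qed simp

end
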